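(* Assume that $\rho_n=n^3r_n^4\to\infty$ and $nr_n^2\to0$ as $n\to\infty$. Then, for any Borel set $A\subset\mathbb R^m$, $$-\inf_{\mathbf u\in A^\circ}I(\mathbf u)\le\liminf_{n\to\infty}\frac{\rho_n}{b_n^2}\log\mathbb P\Big(\frac1{b_n}\overline{N_n}\in A\Big)\le\limsup_{n\to\infty}\frac{\rho_n}{b_n^2}\log\mathbb P\Big(\frac1{b_n}\overline{N_n}\in A\Big)\le-\inf_{\mathbf u\in\overline A}I(\mathbf u),$$ where $A^\circ$, $\overline A$ are the interior and closure of $A$ in $\mathbb R^m$, and $N_n$ is the vector of Morse critical point counts defined in the context.
   Context: The dimension is $d=2$; $m\ge1$ is an integer. $\mathcal P_n$ is a homogeneous Poisson point process of intensity $n$ on $[0,1]^2$. $(r_n)$ is a sequence of positive numbers with $r_n\to0$. $(b_n)$ is a positive sequence with $\rho_n/b_n\to\infty$ and $\rho_n/b_n^2\to0$. $\overline X=X-\mathbb E[X]$ for a random vector $X$; $\mathbf 0_2$ is the origin of $\mathbb R^2$. For a three-point set $\mathcal Y\subset\mathbb R^2$ in general position (non-collinear), let $\gamma(\mathcal Y)$ be the center of its circumcircle, $\mathcal R(\mathcal Y)$ its circumradius, $\mathcal U(\mathcal Y)$ the open disk of center $\gamma(\mathcal Y)$ and radius $\mathcal R(\mathcal Y)$, and $\mathsf{conv}^\circ(\mathcal Y)$ the interior of its convex hull. Given $t_1,\dots,t_m\in(0,\infty)$ pairwise distinct, define $N_n=(N_n^{(i)})_{i=1,\dots,m}$ by $$N_n^{(i)}=\sum_{\mathcal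 Y\subset\mathcal P_n,\,|\mathcal Y|=3}\mathbf 1\{\gamma(\mathcal Y)\in\mathsf{conv}^\circ(\mathcal Y),\ \mathcal R(\mathcal Y)\le r_nt_i,\ \mathcal U(\mathcal Y)\cap\mathcal P_n=\emptyset\},$$ which is the number of Morse critical points of index 2 of the distance function $x\mapsto\min_{y\in\mathcal P_n}\|x-y\|$ with critical value at most $r_nt_i$. Let $h^{(i)}(x_1,x_2,x_3)=\mathbf 1\{\gamma(x_1,x_2,x_3)\in\mathsf{conv}^\circ(x_1,x_2,x_3),\ \mathcal R(x_1,x_2,x_3)\le t_i\}$ (with value $0$ when the points are not in general position). The rate function is $I(\mathbf u)=\frac12\langle\mathbf u,\Gamma^{-1}\mathbf u\rangle$, $\mathbf u\in\mathbb R^m$, where $\Gamma$ is the (invertible) $m\times m$ matrix with entries $\frac16\int_{(\mathbb R^2)^2}h^{(i)}(\mathbf 0_2,\mathbf y)h^{(j)}(\mathbf 0_2,\mathbf y)\,d\mathbf y$. *)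

theory Defs
  imports "HOL-Probability.Probability"
begin

(* A homogeneous Poisson point process of intensity lam on a bounded Borel set S of the plane,
   given as a random finite subset of S: since Lebesgue measure has no atoms, the process is
   simple and may be identified with its support. The void case lam * area = 0 is covered by
   0 ^ 0 = 1. *)
definition poisson_point_process ::
  "'w measure \<Rightarrow> (real^2) set \<Rightarrow> real \<Rightarrow> ('w \<Rightarrow> (real^2) set) \<Rightarrow> bool" where
  "poisson_point_process M S lam P \<longleftrightarrow>
     prob_space M \<and>
     (\<forall>\<omega>\<in>space M. finite (P \<omega>) \<and> P \<omega> \<subseteq> S) \<and>
     (\<forall>B\<in>sets borel. (\<lambda>\<omega>. card (P \<omega> \<inter> B)) \<in> measurable M (count_space UNIV)) \<and>
     (\<forall>B\<in>sets borel. \<forall>k.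
        measure M {\<omega>\<in>space M. card (P \<omega> \<inter> B) = k} =
          exp (- (lam * measure lborel (S \<inter> B))) * (lam * measure lborel (S \<inter> B)) ^ k / fact k) \<and>
     (\<forall>(I::nat set) B. finite I \<and> (\<forall>i\<in>I. B i \<in> sets borel) \<and> disjoint_family_on B I \<longrightarrow>
        prob_space.indep_vars M (\<lambda>_. count_space UNIV) (\<lambda>i \<omega>. card (P \<omega> \<inter> B i)) I)"

(* Only meaningful for three non-collinear points of the plane. *)
definition circumcenter :: "(real^2) set \<Rightarrow> real^2" where
  "circumcenter Y = (THE c. \<exists>r. \<forall>y\<in>Y. dist c y = r)"

definition circumradius :: "(real^2) set \<Rightarrow> real" where
  "circumradius Y = (THE r. \<forall>y\<in>Y. dist (circumcenter Y) y = r)"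

definition circumdisk :: "(real^2) set \<Rightarrow> (real^2) set" where
  "circumdisk Y = ball (circumcenter Y) (circumradius Y)"

definition morse_cond :: "real \<Rightarrow> (real^2) set \<Rightarrow> bool" where
  "morse_cond s Y \<longleftrightarrow>
     \<not> collinear Y \<and> circumcenter Y \<in> interior (convex hull Y) \<and> circumradius Y \<le> s"

(* If the x's are not pairwise distinct, {x1, x2, x3} is collinear, so the value is 0. *)
definition morse_h :: "real \<Rightarrow> real^2 \<Rightarrow> real^2 \<Rightarrow> real^2 \<Rightarrow> real" where
  "morse_h s x1 x2 x3 = of_bool (morse_cond s {x1, x2, x3})"

definition morse_count :: "real \<Rightarrow> (real^2) set \<Rightarrow> real" where
  "morse_count s P =
     (\<Sum>Y | Y \<subseteq> P \<and> card Y = 3. of_bool (morse_cond s Y \<and> circumdisk Y \<inter> P = {}))"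

definition morse_count_vec ::
  "real \<Rightarrow> ('m::finite \<Rightarrow> real) \<Rightarrow> (real^2) set \<Rightarrow> real^'m" where
  "morse_count_vec r t P = (\<chi> i. morse_count (r * t i) P)"

definition Gamma_mat :: "('m::finite \<Rightarrow> real) \<Rightarrow> real^'m^'m" where
  "Gamma_mat t = (\<chi> i j. (1/6) *
     (\<integral>y. morse_h (t i) 0 (fst y) (snd y) * morse_h (t j) 0 (fst y) (snd y)
        \<partial>(lborel :: ((real^2) \<times> (real^2)) measure)))"

definition rate_fun :: "('m::finite \<Rightarrow> real) \<Rightarrow> real^'m \<Rightarrow> real" where
  "rate_fun t u = (1/2) * (u \<bullet> (matrix_inv (Gamma_mat t) *v u))"

(* Logarithm of a probability, with log 0 = -\<infinity>. *)
definition elog :: "real \<Rightarrow> ereal" where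
  "elog p = (if p = 0 then -\<infinity> else ereal (ln p))"

definition centered :: "'w measure \<Rightarrow> ('w \<Rightarrow> 'b::{banach,second_countable_topology}) \<Rightarrow> 'w \<Rightarrow> 'b"
  where "centered M X \<omega> = X \<omega> - integral\<^sup>L M X"

end

theory Submission
  imports Defs
begin

text \<open>
The proof computes the scaled log moment generating function of every linear combination of the
counts and feeds the limit into a Gaertner-Ellis theorem.

Put \<open>\<epsilon> = b / \<rho>\<close>, which tends to \<open>0\<close>. For a direction \<open>\<theta>\<close> let \<open>W\<close> be the inner product of \<open>\<theta>\<close> with the vector of
counts. The claim is that the log moment generating function of \<open>W - E W\<close> at \<open>\<epsilon>\<close> is
\<open>\<epsilon>\<^sup>2 \<rho> (1/2 \<langle>\<theta>, \<Gamma> \<theta>\<rangle> + o(1))\<close> (\<open>lmgf_limit\<close>). Since \<open>\<epsilon>\<^sup>2 \<rho> = b\<^sup>2 / \<rho>\<close> is the speed, and since the limit is a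
positive definite quadratic form, the large deviation bounds follow by Chernoff bounds for
half-spaces and by exponential tilting (\<open>upper_bound\<close>, \<open>lower_bound\<close>).

For the limit, a critical triple is assigned to the position of its circumcenter. The triple and
its circumdisk lie within distance \<open>r max t\<close> of that position, so the count over circumcenters in a
set \<open>A\<close> depends only on the points near \<open>A\<close>, and counts over well separated sets are independent.
Cut the unit square into cells of side \<open>s\<close> between \<open>r max t\<close> and \<open>2 r max t\<close>, and group them into blocks of \<open>K\<close> by \<open>K\<close>
cells. The inner cells of the blocks give independent contributions. The cells along the block
edges split into nine colour classes, each a sum of independent terms; there are relatively few
of them, and by convexity of the log moment generating function their effect is \<open>O(\<epsilon>\<^sup>2 \<rho> / K)\<close>.

A block contains on average \<open>\<mu> = n K\<^sup>2 s\<^sup>2\<close> points, which tends to \<open>0\<close>, and its count vanishes unless it contains at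
least three points. If it contains exactly three, the count is an indicator, so up to \<open>O(\<mu>\<^sup>4)\<close> its
second moment is the mean of a sum over triples, which the Campbell formula evaluates exactly:
it is \<open>n\<^sup>3 r\<^sup>4 \<langle>\<theta>, \<Gamma> \<theta>\<rangle>\<close> times the area of the inner part of the block. Letting first \<open>n\<close> and then \<open>K\<close> tend to infinity, and
the convexity weight of the block cores to \<open>1\<close>, gives the limit.

What makes exponential moments finite is geometric: the number of critical triples is at most
a constant times the number of points as soon as no four points lie on a common circle
(\<open>card_critical_linear\<close>), which holds almost surely (\<open>AE_no_cocircular\<close>). A quadratic bound would
not suffice, because a Poisson variable has no exponential moments of its square.

Finally \<open>\<Gamma>\<close> is a positive multiple of the matrix of \<open>min (t\<^sub>i, t\<^sub>j)\<^sup>4\<close> by scaling, a Gram matrix of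
indicators of intervals, hence positive definite when the \<open>t\<^sub>i\<close> are distinct.
\<close>

section \<open>A Gaertner-Ellis theorem for quadratic limits\<close>

text \<open>The exponential Markov inequality under the weight \<open>exp (\<theta> \<bullet> Z)\<close>. With \<open>\<theta> = 0\<close> it is the usual Chernoff bound for a half-space; with \<open>\<theta> \<noteq> 0\<close> it controls the law tilted by \<open>\<theta>\<close>, up to normalisation.\<close>

lemma (in prob_space) chernoff_halfspace:
  fixes Z :: "'a \<Rightarrow> 'b::euclidean_space"
  assumes [measurable]: "Z \<in> borel_measurable M"
    and int: "integrable M (\<lambda>\<omega>. exp ((\<theta> + v) \<bullet> Z \<omega>))"
  shows "(\<integral>\<omega>. exp (\<theta> \<bullet> Z \<omega>) * indicator {\<omega>. c \<le> v \<bullet> Z \<omega>} \<omega> \<partial>M)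
           \<le> exp (- c) * expectation (\<lambda>\<omega>. exp ((\<theta> + v) \<bullet> Z \<omega>))"
proof -
  have "(\<integral>\<omega>. exp (\<theta> \<bullet> Z \<omega>) * indicator {\<omega>. c \<le> v \<bullet> Z \<omega>} \<omega> \<partial>M)
     \<le> (\<integral>\<omega>. exp (- c) * exp ((\<theta> + v) \<bullet> Z \<omega>) \<partial>M)"
  proof (rule Bochner_Integration.integral_mono')
    show "integrable M (\<lambda>\<omega>. exp (- c) * exp ((\<theta> + v) \<bullet> Z \<omega>))" using int by simp
    fix \<omega>
    show "exp (\<theta> \<bullet> Z \<omega>) * indicator {\<omega>. c \<le> v \<bullet> Z \<omega>} \<omega> \<le> exp (- c) * exp ((\<theta> + v) \<bullet> Z \<omega>)"
      by (auto simp: indicator_def inner_add_left simp flip: exp_add)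
    show "0 \<le> exp (- c) * exp ((\<theta> + v) \<bullet> Z \<omega>)" by simp
  qed
  then show ?thesis by simp
qed

lemma (in prob_space) expectation_exp_pos:
  fixes X :: "'a \<Rightarrow> real"
  assumes int: "integrable M (\<lambda>\<omega>. exp (X \<omega>))"
  shows "0 < expectation (\<lambda>\<omega>. exp (X \<omega>))"
proof -
  have "expectation (\<lambda>\<omega>. exp (X \<omega>)) \<noteq> 0"
  proof
    assume "expectation (\<lambda>\<omega>. exp (X \<omega>)) = 0"
    then have "AE \<omega> in M. exp (X \<omega>) = 0"
      by (subst (asm) integral_nonneg_eq_0_iff_AE[OF int]) auto
    then show False by simp
  qed
  then show ?thesis
    by (metis Bochner_Integration.integral_nonneg exp_ge_zero order_le_less)
qed

text \<open>Here \<open>a\<close> is the speed, and the limit of the scaled log moment generating functions is the quadratic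
form of the self-adjoint positive definite map \<open>G\<close>, with inverse \<open>B\<close>. Its Legendre transform is \<open>rate\<close>.\<close>

locale quadratic_lmgf =
  fixes M :: "nat \<Rightarrow> 'w measure"
    and Z :: "nat \<Rightarrow> 'w \<Rightarrow> 'a::euclidean_space"
    and a :: "nat \<Rightarrow> real"
    and G B :: "'a \<Rightarrow> 'a"
  assumes ps: "\<And>n. prob_space (M n)"
    and meas [measurable]: "\<And>n. Z n \<in> borel_measurable (M n)"
    and int: "\<And>n \<theta>. integrable (M n) (\<lambda>\<omega>. exp (\<theta> \<bullet> Z n \<omega>))"
    and a_lim: "filterlim a at_top sequentially"
    and linG: "linear G" and linB: "linear B"
    and selfadj: "\<And>x y. x \<bullet> G y = G x \<bullet> y"
    and posG: "\<And>x. x \<noteq> 0 \<Longrightarrow> 0 < x \<bullet> G x"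
    and GB: "\<And>x. G (B x) = x"
    and lmgf: "\<And>\<theta>. (\<lambda>n. ln (\<integral>\<omega>. exp (a n * (\<theta> \<bullet> Z n \<omega>)) \<partial>M n) / a n)
                   \<longlonglongrightarrow> (\<theta> \<bullet> G \<theta>) / 2"
begin

definition rate :: "'a \<Rightarrow> real" where "rate u = (u \<bullet> B u) / 2"

lemma rate_eq: "rate u = (B u \<bullet> G (B u)) / 2"
  by (simp add: rate_def GB inner_commute)

lemma rate_pos: "u \<noteq> 0 \<Longrightarrow> 0 < rate u"
  using posG[of "B u"] GB[of u] linear_0[OF linG] by (cases "B u = 0") (auto simp: rate_eq)

lemma rate_scale: "rate (c *\<^sub>R u) = c\<^sup>2 * rate u"
  using linear_scale[OF linB] by (simp add: rate_def power2_eq_square)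

lemma a_pos: "eventually (\<lambda>n. a n > 0) sequentially"
  using a_lim filterlim_at_top_dense by blast

lemma exp_small: "C > 0 \<Longrightarrow> d > 0 \<Longrightarrow> eventually (\<lambda>n. C * exp (- (a n * d)) \<le> 1) sequentially"
proof -
  assume "C > 0" "d > 0"
  have "eventually (\<lambda>n. a n \<ge> ln C / d) sequentially"
    using a_lim filterlim_at_top by blast
  then show ?thesis
  proof eventually_elim
    case (elim n)
    then have "ln C \<le> a n * d" using \<open>d > 0\<close> by (simp add: field_simps)
    then have "C \<le> exp (a n * d)" using \<open>C > 0\<close> by (metis exp_le_cancel_iff exp_ln)
    then show ?case by (simp add: exp_minus field_simps)
  qed
qed

lemma mgf_upper:
  assumes "d > 0"
  shows "eventually (\<lambda>n. (\<integral>\<omega>. exp (a n * (\<theta> \<bullet> Z n \<omega>)) \<partial>M n) \<le> exp (a n * (\<theta> \<bullet> G \<theta> / 2 + d))) sequentially"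
    and "eventually (\<lambda>n. (\<integral>\<omega>. exp (a n * (\<theta> \<bullet> Z n \<omega>)) \<partial>M n) \<ge> exp (a n * (\<theta> \<bullet> G \<theta> / 2 - d))) sequentially"
proof -
  have ev: "eventually (\<lambda>n. \<bar>ln (\<integral>\<omega>. exp (a n * (\<theta> \<bullet> Z n \<omega>)) \<partial>M n) / a n - \<theta> \<bullet> G \<theta> / 2\<bar> < d) sequentially"
    using tendstoD[OF lmgf[of \<theta>] assms] by (simp add: dist_real_def)
  have pos: "0 < (\<integral>\<omega>. exp (a n * (\<theta> \<bullet> Z n \<omega>)) \<partial>M n)" for n
    using prob_space.expectation_exp_pos[OF ps[of n], of "\<lambda>\<omega>. a n * (\<theta> \<bullet> Z n \<omega>)"] int[of n "a n *\<^sub>R \<theta>"]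
    by simp
  show "eventually (\<lambda>n. (\<integral>\<omega>. exp (a n * (\<theta> \<bullet> Z n \<omega>)) \<partial>M n) \<le> exp (a n * (\<theta> \<bullet> G \<theta> / 2 + d))) sequentially"
    using ev a_pos
  proof eventually_elim
    case (elim n)
    then have "ln (\<integral>\<omega>. exp (a n * (\<theta> \<bullet> Z n \<omega>)) \<partial>M n) / a n \<le> \<theta> \<bullet> G \<theta> / 2 + d" by linarith
    then have "ln (\<integral>\<omega>. exp (a n * (\<theta> \<bullet> Z n \<omega>)) \<partial>M n) \<le> a n * (\<theta> \<bullet> G \<theta> / 2 + d)"
      using elim by (simp add: pos_divide_le_eq mult.commute)
    then show ?case using pos[of n] by (metis exp_le_cancel_iff exp_ln)
  qed
  show "eventually (\<lambda>n. (\<integral>\<omega>. exp (a n * (\<theta> \<bullet> Z n \<omega>)) \<partial>M n) \<ge> exp (a n * (\<theta> \<bullet> G \<theta> / 2 - d))) sequentially"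
    using ev a_pos
  proof eventually_elim
    case (elim n)
    then have "ln (\<integral>\<omega>. exp (a n * (\<theta> \<bullet> Z n \<omega>)) \<partial>M n) / a n \<ge> \<theta> \<bullet> G \<theta> / 2 - d" by linarith
    then have "ln (\<integral>\<omega>. exp (a n * (\<theta> \<bullet> Z n \<omega>)) \<partial>M n) \<ge> a n * (\<theta> \<bullet> G \<theta> / 2 - d)"
      using elim by (simp add: pos_le_divide_eq mult.commute)
    then show ?case using pos[of n] by (metis exp_le_cancel_iff exp_ln)
  qed
qed

lemma compact_rate_sphere: "compact {u. rate u = 1}"
proof -
  have contB: "continuous_on UNIV B" using linB linear_continuous_on linear_conv_bounded_linear by blast
  have cont: "continuous_on S rate" for S
    unfolding rate_def using continuous_on_subset[OF contB]
    by (auto intro!: continuous_intros)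
  have cl: "closed {u. rate u = 1}"
    using continuous_closed_preimage_constant[of UNIV rate 1] cont by simp
  have "bounded {u. rate u = 1}"
  proof (cases "\<exists>u::'a. norm u = 1")
    case False
    have "u = 0" for u :: 'a
    proof (rule ccontr)
      assume "u \<noteq> 0"
      then have "norm (u /\<^sub>R norm u) = 1" by simp
      then show False using False by blast
    qed
    then have "{u. rate u = 1} \<subseteq> {0}" by blast
    then show ?thesis by (rule bounded_subset[rotated]) simp
  next
    case True
    have "sphere (0::'a) 1 \<noteq> {}" using True by (auto simp: dist_norm)
    then obtain v where v: "v \<in> sphere 0 1" "\<And>w. w \<in> sphere 0 1 \<Longrightarrow> rate v \<le> rate w"
      using continuous_attains_inf[OF compact_sphere _ cont] by blast
    have "v \<noteq> 0" using v(1) by auto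
    then have rv: "rate v > 0" by (rule rate_pos)
    have "norm u \<le> sqrt (1 / rate v)" if "rate u = 1" for u
    proof -
      have "u \<noteq> 0" using that by (auto simp: rate_def)
      then have "u /\<^sub>R norm u \<in> sphere 0 1" by simp
      then have "rate v \<le> rate (inverse (norm u) *\<^sub>R u)" using v(2) by blast
      then have "rate v \<le> 1 / (norm u)\<^sup>2" using that by (simp add: rate_scale power_inverse divide_inverse)
      then have "(norm u)\<^sup>2 \<le> 1 / rate v" using rv \<open>u \<noteq> 0\<close> by (simp add: field_simps)
      then show ?thesis by (simp add: real_le_rsqrt)
    qed
    then show ?thesis unfolding bounded_iff by blast
  qed
  with cl show ?thesis by (simp add: compact_eq_bounded_closed)
qed

text \<open>A set on which the rate is at least \<open>\<alpha>\<close> lies outside an ellipsoid. The level set \<open>rate = 1\<close> is compact,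
so by homogeneity finitely many half-spaces, each slightly enlarged from a supporting half-space of the ellipsoid, cover
the exterior of a slightly smaller ellipsoid. Chernoff's bound applies to each of them.\<close>

lemma upper_bound:
  assumes A: "\<And>u. u \<in> A \<Longrightarrow> \<alpha> \<le> rate u" and al: "0 \<le> \<alpha>'" "\<alpha>' < \<alpha>"
  shows "\<exists>C>0. eventually (\<lambda>n. measure (M n) {\<omega>\<in>space (M n). Z n \<omega> \<in> A} \<le> C * exp (- (a n * \<alpha>'))) sequentially"
proof -
  \<comment> \<open>Any \<open>l\<close> with \<open>\<alpha>'\<close> below \<open>l\<^sup>2\<close> below \<open>\<alpha>\<close>: it is both the tilting strength and, up to a factor two, the height of the half-spaces.\<close>
  define l where "l = sqrt ((\<alpha> + \<alpha>') / 2)"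
  have l2: "l\<^sup>2 = (\<alpha> + \<alpha>') / 2" using al by (simp add: l_def)
  have lpos: "l > 0" using al by (simp add: l_def)
  have lless: "l < sqrt \<alpha>" using al by (simp add: l_def)
  have spos: "sqrt \<alpha> > 0" using al by simp
  define H where "H = (\<lambda>w. {u. 2 * l / sqrt \<alpha> < B w \<bullet> u})"
  have H_op: "open (H w)" for w unfolding H_def by (rule open_halfspace_gt)
  have "{u. rate u = 1} \<subseteq> (\<Union>w\<in>{u. rate u = 1}. H w)"
  proof
    fix w assume w: "w \<in> {u. rate u = 1}"
    then have "B w \<bullet> w = 2" by (simp add: rate_def inner_commute)
    moreover have "2 * l / sqrt \<alpha> < 2" using lless spos by (simp add: field_simps)
    ultimately show "w \<in> (\<Union>w\<in>{u. rate u = 1}. H w)" using w by (auto simp: H_def)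
  qed
  then obtain W where W: "W \<subseteq> {u. rate u = 1}" "finite W" "{u. rate u = 1} \<subseteq> (\<Union>w\<in>W. H w)"
    using compactE_image[OF compact_rate_sphere, of "{u. rate u = 1}" H] H_op by metis
  have cover: "\<exists>w\<in>W. 2 * l \<le> B w \<bullet> u" if "u \<in> A" for u
  proof -
    have ru: "rate u \<ge> \<alpha>" using A that by blast
    then have rpos: "rate u > 0" using al by linarith
    define v where "v = (1 / sqrt (rate u)) *\<^sub>R u"
    have "rate v = 1" using rpos by (simp add: v_def rate_scale power_divide)
    then obtain w where w: "w \<in> W" "2 * l / sqrt \<alpha> < B w \<bullet> v" using W(3) by (auto simp: H_def)
    have "2 * l < sqrt \<alpha> * (B w \<bullet> v)" using w(2) spos by (simp add: field_simps)
    also have "\<dots> \<le> sqrt (rate u) * (B w \<bullet> v)"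
    proof (rule mult_right_mono)
      show "sqrt \<alpha> \<le> sqrt (rate u)" using ru by simp
      have "0 \<le> 2 * l / sqrt \<alpha>" using lpos spos by simp
      then show "0 \<le> B w \<bullet> v" using w(2) by linarith
    qed
    also have "\<dots> = B w \<bullet> u" using rpos by (simp add: v_def)
    finally show ?thesis using w(1) by (intro bexI[of _ w]) auto
  qed
  define d where "d = l\<^sup>2 - \<alpha>'"
  have "d > 0" using l2 al by (simp add: d_def)
  have "eventually (\<lambda>n. \<forall>w\<in>W. (\<integral>\<omega>. exp (a n * ((l *\<^sub>R B w) \<bullet> Z n \<omega>)) \<partial>M n) \<le> exp (a n * ((l *\<^sub>R B w) \<bullet> G (l *\<^sub>R B w) / 2 + d))) sequentially"
    by (intro eventually_ball_finite W(2) ballI mgf_upper(1) \<open>d > 0\<close>)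
  then have ev: "eventually (\<lambda>n. \<forall>w\<in>W. (\<integral>\<omega>. exp (a n * ((l *\<^sub>R B w) \<bullet> Z n \<omega>)) \<partial>M n) \<le> exp (a n * (l\<^sup>2 + d))) sequentially"
  proof eventually_elim
    case (elim n)
    have "(l *\<^sub>R B w) \<bullet> G (l *\<^sub>R B w) / 2 = l\<^sup>2" if "w \<in> W" for w
      using that W(1) linear_scale[OF linG] by (auto simp: power2_eq_square rate_eq)
    then show ?case using elim by auto
  qed
  show ?thesis
  proof (intro exI[of _ "real (card W) + 1"] conjI)
    show "eventually (\<lambda>n. measure (M n) {\<omega>\<in>space (M n). Z n \<omega> \<in> A} \<le> (real (card W) + 1) * exp (- (a n * \<alpha>'))) sequentially"
      using ev a_pos
    proof eventually_elim
      case (elim n)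
      interpret prob_space "M n" by (rule ps)
      define S where "S = (\<lambda>w. {\<omega>\<in>space (M n). 2 * l \<le> B w \<bullet> Z n \<omega>})"
      have Sm: "S w \<in> sets (M n)" for w unfolding S_def by measurable
      have "prob {\<omega>\<in>space (M n). Z n \<omega> \<in> A} \<le> prob (\<Union>w\<in>W. S w)"
        using cover W(2) Sm by (intro finite_measure_mono) (auto simp: S_def)
      also have "\<dots> \<le> (\<Sum>w\<in>W. prob (S w))"
        using W(2) Sm by (intro finite_measure_subadditive_finite) auto
      also have "\<dots> \<le> (\<Sum>w\<in>W. exp (- (a n * \<alpha>')))"
      proof (rule sum_mono)
        fix w assume w: "w \<in> W"
        have "prob (S w) = (\<integral>\<omega>. indicator (S w) \<omega> \<partial>M n)"
          using sets.sets_into_space[OF Sm[of w]] by (simp add: Int_absorb1 Int_absorb2)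
        also have "\<dots> = (\<integral>\<omega>. exp (0 \<bullet> Z n \<omega>) * indicator {\<omega>. a n * l * (2 * l) \<le> ((a n * l) *\<^sub>R B w) \<bullet> Z n \<omega>} \<omega> \<partial>M n)"
          using elim lpos by (intro Bochner_Integration.integral_cong) (auto simp: S_def indicator_def)
        also have "\<dots> \<le> exp (- (a n * l * (2 * l))) * expectation (\<lambda>\<omega>. exp ((0 + (a n * l) *\<^sub>R B w) \<bullet> Z n \<omega>))"
          by (rule chernoff_halfspace[OF meas int])
        also have "expectation (\<lambda>\<omega>. exp ((0 + (a n * l) *\<^sub>R B w) \<bullet> Z n \<omega>)) \<le> exp (a n * (l\<^sup>2 + d))"
          using elim w by (simp add: mult.assoc)
        also have "exp (- (a n * l * (2 * l))) * exp (a n * (l\<^sup>2 + d)) = exp (- (a n * \<alpha>'))"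
          by (simp add: d_def power2_eq_square algebra_simps flip: exp_add)
        finally show "prob (S w) \<le> exp (- (a n * \<alpha>'))" by simp
      qed
      also have "\<dots> \<le> (real (card W) + 1) * exp (- (a n * \<alpha>'))" by (simp add: algebra_simps)
      finally show ?case .
    qed
  qed simp
qed

text \<open>Tilting by \<open>\<theta> = B u\<close> moves the mean to \<open>u\<close>. Under the tilted weight each of the finitely many half-spaces that cut off
a small cube around \<open>u\<close> is exponentially negligible, so that almost all of the mass \<open>E exp (a \<theta> \<bullet> Z)\<close> comes from the cube,
where \<open>exp (a \<theta> \<bullet> Z)\<close> is nearly constant.\<close>

lemma lower_bound:
  assumes ball: "ball u r \<subseteq> A" "r > 0" and A[measurable]: "A \<in> sets borel" and eta: "\<eta> > 0"
  shows "eventually (\<lambda>n. measure (M n) {\<omega>\<in>space (M n). Z n \<omega> \<in> A} \<ge> exp (- (a n * (rate u + \<eta>)))) sequentially"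
proof -
  define \<theta> where "\<theta> = B u"
  have G\<theta>: "G \<theta> = u" by (simp add: \<theta>_def GB)
  define V where "V = (Basis :: 'a set) \<union> uminus ` Basis"
  have finV: "finite V" by (simp add: V_def)
  define D where "D = real (DIM('a))"
  have Dpos: "D > 0" by (simp add: D_def)
  define \<delta> where "\<delta> = min (r / (2 * D)) (\<eta> / (4 * D * (norm \<theta> + 1)))"
  have nt: "norm \<theta> + 1 > 0" using norm_ge_zero[of \<theta>] by linarith
  have dpos: "\<delta> > 0" using ball(2) eta Dpos nt by (simp add: \<delta>_def)
  have d1: "D * \<delta> < r" 
  proof -
    have "D * \<delta> \<le> D * (r / (2 * D))" using Dpos by (intro mult_left_mono) (auto simp: \<delta>_def)
    also have "\<dots> = r / 2" using Dpos by simp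
    also have "\<dots> < r" using ball by simp
    finally show ?thesis .
  qed
  have d2: "norm \<theta> * (D * \<delta>) \<le> \<eta> / 4"
  proof -
    have "norm \<theta> * (D * \<delta>) \<le> (norm \<theta> + 1) * (D * \<delta>)" using Dpos dpos by (intro mult_right_mono) auto
    also have "\<dots> \<le> (norm \<theta> + 1) * (D * (\<eta> / (4 * D * (norm \<theta> + 1))))"
      using Dpos nt by (intro mult_left_mono) (auto simp: \<delta>_def)
    also have "\<dots> = \<eta> / 4" using Dpos nt by (simp add: divide_simps)
    finally show ?thesis .
  qed
  define g where "g = (\<Sum>v\<in>V. \<bar>v \<bullet> G v\<bar>) + 1"
  have gpos: "g > 0" by (simp add: g_def sum_nonneg add_nonneg_pos)
  have gV: "v \<bullet> G v \<le> g" if "v \<in> V" for v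
  proof -
    have "\<bar>v \<bullet> G v\<bar> \<le> (\<Sum>v\<in>V. \<bar>v \<bullet> G v\<bar>)" using that finV by (intro member_le_sum) auto
    then show ?thesis by (simp add: g_def)
  qed
  define \<tau> where "\<tau> = \<delta> / g"
  have tpos: "\<tau> > 0" using dpos gpos by (simp add: \<tau>_def)
  \<comment> \<open>The tilt by \<open>\<tau> v\<close> gains \<open>\<tau> \<delta>\<close> and loses at most half of it, which leaves a gap of at least \<open>2 c\<close>.\<close>
  define c where "c = min (\<tau> * \<delta> / 4) (\<eta> / 4)"
  have cpos: "c > 0" using tpos dpos eta by (simp add: c_def)
  have ev1: "eventually (\<lambda>n. \<forall>v\<in>V. (\<integral>\<omega>. exp (a n * ((\<theta> + \<tau> *\<^sub>R v) \<bullet> Z n \<omega>)) \<partial>M n) \<le> exp (a n * ((\<theta> + \<tau> *\<^sub>R v) \<bullet> G (\<theta> + \<tau> *\<^sub>R v) / 2 + c))) sequentially"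
    by (intro eventually_ball_finite finV ballI mgf_upper(1) cpos)
  have ev2: "eventually (\<lambda>n. (\<integral>\<omega>. exp (a n * (\<theta> \<bullet> Z n \<omega>)) \<partial>M n) \<ge> exp (a n * (\<theta> \<bullet> G \<theta> / 2 - c / 2))) sequentially"
    using mgf_upper(2)[of "c / 2"] cpos by simp
  have ev3: "eventually (\<lambda>n. 2 * (real (card V) + 1) * exp (- (a n * (c / 2))) \<le> 1) sequentially"
    using exp_small[of "2 * (real (card V) + 1)" "c / 2"] cpos by simp
  have ev4: "eventually (\<lambda>n. 2 * exp (- (a n * (\<eta> / 4))) \<le> 1) sequentially"
    using exp_small[of 2 "\<eta> / 4"] eta by simp
  have quad: "(\<theta> + \<tau> *\<^sub>R v) \<bullet> G (\<theta> + \<tau> *\<^sub>R v) / 2 + c - \<tau> * (v \<bullet> u + \<delta>) \<le> \<theta> \<bullet> G \<theta> / 2 - c" if v: "v \<in> V" for v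
  proof -
    have "\<theta> \<bullet> G v = u \<bullet> v" using selfadj[of \<theta> v] G\<theta> by simp
    then have "(\<theta> + \<tau> *\<^sub>R v) \<bullet> G (\<theta> + \<tau> *\<^sub>R v) = \<theta> \<bullet> G \<theta> + 2 * \<tau> * (v \<bullet> u) + \<tau>\<^sup>2 * (v \<bullet> G v)"
      using linear_scale[OF linG] linear_add[OF linG] G\<theta>
      by (simp add: inner_add_left inner_add_right inner_commute power2_eq_square algebra_simps)
    moreover have "\<tau>\<^sup>2 * (v \<bullet> G v) \<le> \<tau>\<^sup>2 * g" using gV[OF v] by (intro mult_left_mono) auto
    moreover have "\<tau>\<^sup>2 * g = \<tau> * \<delta>" using gpos by (simp add: \<tau>_def power2_eq_square)
    moreover have "c \<le> \<tau> * \<delta> / 4" by (simp add: c_def)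
    moreover have "\<tau> * (v \<bullet> u + \<delta>) = \<tau> * (v \<bullet> u) + \<tau> * \<delta>" by (simp add: algebra_simps)
    ultimately show ?thesis by linarith
  qed
  show ?thesis
    using ev1 ev2 ev3 ev4 a_pos
  proof eventually_elim
    case (elim n)
    interpret prob_space "M n" by (rule ps)
    let ?T = "\<lambda>\<omega>. exp ((a n *\<^sub>R \<theta>) \<bullet> Z n \<omega>)"
    define E where "E = \<theta> \<bullet> G \<theta> / 2"
    define S where "S = (\<lambda>v. {\<omega>. a n * \<tau> * (v \<bullet> u + \<delta>) \<le> ((a n * \<tau>) *\<^sub>R v) \<bullet> Z n \<omega>})"
    have sint: "integrable (M n) (\<lambda>\<omega>. ?T \<omega> * indicator (S v) \<omega>)" for v
      by (rule Bochner_Integration.integrable_bound[OF int[of n "a n *\<^sub>R \<theta>"]]) (auto simp: indicator_def S_def)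
    have bd: "(\<integral>\<omega>. ?T \<omega> * indicator (S v) \<omega> \<partial>M n) \<le> exp (a n * (E - c))" if v: "v \<in> V" for v
    proof -
      have "(\<integral>\<omega>. ?T \<omega> * indicator (S v) \<omega> \<partial>M n)
        \<le> exp (- (a n * \<tau> * (v \<bullet> u + \<delta>))) * expectation (\<lambda>\<omega>. exp ((a n *\<^sub>R \<theta> + (a n * \<tau>) *\<^sub>R v) \<bullet> Z n \<omega>))"
        unfolding S_def by (rule chernoff_halfspace[OF meas int])
      also have "(\<lambda>\<omega>. exp ((a n *\<^sub>R \<theta> + (a n * \<tau>) *\<^sub>R v) \<bullet> Z n \<omega>)) = (\<lambda>\<omega>. exp (a n * ((\<theta> + \<tau> *\<^sub>R v) \<bullet> Z n \<omega>)))"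
        by (simp add: inner_add_left algebra_simps)
      also have "expectation \<dots> \<le> exp (a n * ((\<theta> + \<tau> *\<^sub>R v) \<bullet> G (\<theta> + \<tau> *\<^sub>R v) / 2 + c))"
        using elim v by blast
      also have "exp (- (a n * \<tau> * (v \<bullet> u + \<delta>))) * exp (a n * ((\<theta> + \<tau> *\<^sub>R v) \<bullet> G (\<theta> + \<tau> *\<^sub>R v) / 2 + c))
          = exp (a n * ((\<theta> + \<tau> *\<^sub>R v) \<bullet> G (\<theta> + \<tau> *\<^sub>R v) / 2 + c - \<tau> * (v \<bullet> u + \<delta>)))"
        unfolding exp_add[symmetric] by (simp add: algebra_simps)
      also have "\<dots> \<le> exp (a n * (E - c))"
        using quad[OF v] elim by (simp add: E_def)
      finally show ?thesis by simp
    qed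
    let ?I = "indicator {\<omega>\<in>space (M n). Z n \<omega> \<in> A} :: 'w \<Rightarrow> real"
    define U where "U = a n * (\<theta> \<bullet> u + norm \<theta> * (D * \<delta>))"
    have pw: "?T \<omega> \<le> exp U * ?I \<omega> + (\<Sum>v\<in>V. ?T \<omega> * indicator (S v) \<omega>)" if om: "\<omega> \<in> space (M n)" for \<omega>
    proof (cases "\<exists>v\<in>V. \<omega> \<in> S v")
      case True
      then obtain v where v: "v \<in> V" "\<omega> \<in> S v" by blast
      have "?T \<omega> * indicator (S v) \<omega> \<le> (\<Sum>v\<in>V. ?T \<omega> * indicator (S v) \<omega>)"
        using v finV by (intro member_le_sum) auto
      moreover have "0 \<le> exp U * ?I \<omega>" by simp
      moreover have "?T \<omega> * indicator (S v) \<omega> = ?T \<omega>" using v(2) by simp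
      ultimately show ?thesis by linarith
    next
      case False
      have lt: "v \<bullet> (Z n \<omega> - u) < \<delta>" if "v \<in> V" for v
      proof -
        have "\<not> a n * \<tau> * (v \<bullet> u + \<delta>) \<le> (a n * \<tau>) * (v \<bullet> Z n \<omega>)" using False that by (auto simp: S_def)
        then have "v \<bullet> Z n \<omega> < v \<bullet> u + \<delta>" using elim tpos by (simp add: not_le)
        then show ?thesis by (simp add: inner_diff_right)
      qed
      have ab: "\<bar>(Z n \<omega> - u) \<bullet> i\<bar> \<le> \<delta>" if "i \<in> Basis" for i
      proof -
        have "i \<in> V" "- i \<in> V" using that by (auto simp: V_def)
        then have "i \<bullet> (Z n \<omega> - u) < \<delta>" "(- i) \<bullet> (Z n \<omega> - u) < \<delta>" using lt by blast+
        moreover have "(- i) \<bullet> (Z n \<omega> - u) = - (i \<bullet> (Z n \<omega> - u))" by (rule inner_minus_left)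
        ultimately have "i \<bullet> (Z n \<omega> - u) < \<delta>" "- \<delta> < i \<bullet> (Z n \<omega> - u)" by linarith+
        then show ?thesis unfolding inner_commute[of _ i] by linarith
      qed
      have nm: "norm (Z n \<omega> - u) \<le> D * \<delta>"
      proof -
        have "norm (Z n \<omega> - u) \<le> (\<Sum>i\<in>Basis. \<bar>(Z n \<omega> - u) \<bullet> i\<bar>)" by (rule norm_le_l1)
        also have "\<dots> \<le> (\<Sum>i\<in>(Basis::'a set). \<delta>)" by (intro sum_mono ab)
        also have "\<dots> = D * \<delta>" by (simp add: D_def)
        finally show ?thesis .
      qed
      then have "Z n \<omega> \<in> A" using ball d1 by (auto simp: subset_iff dist_norm norm_minus_commute)
      then have I1: "?I \<omega> = 1" using om by simp
      have "\<theta> \<bullet> Z n \<omega> = \<theta> \<bullet> u + \<theta> \<bullet> (Z n \<omega> - u)" by (simp add: inner_diff_right)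
      also have "\<theta> \<bullet> (Z n \<omega> - u) \<le> norm \<theta> * norm (Z n \<omega> - u)" by (rule norm_cauchy_schwarz)
      also have "\<dots> \<le> norm \<theta> * (D * \<delta>)" using nm by (intro mult_left_mono) auto
      finally have "a n * (\<theta> \<bullet> Z n \<omega>) \<le> U" using elim by (simp add: U_def)
      then have "?T \<omega> \<le> exp U * ?I \<omega>" using I1 by simp
      moreover have "0 \<le> (\<Sum>v\<in>V. ?T \<omega> * indicator (S v) \<omega>)" by (intro sum_nonneg) auto
      ultimately show ?thesis by linarith
    qed
    have Iint: "integrable (M n) (\<lambda>\<omega>. exp U * ?I \<omega>)" by (auto intro!: integrable_mult_right simp: emeasure_eq_measure)
    have "exp (a n * (E - c / 2)) \<le> expectation ?T" using elim by (simp add: E_def)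
    also have "\<dots> \<le> (\<integral>\<omega>. exp U * ?I \<omega> + (\<Sum>v\<in>V. ?T \<omega> * indicator (S v) \<omega>) \<partial>M n)"
      by (intro integral_mono Bochner_Integration.integrable_add Bochner_Integration.integrable_sum sint Iint int pw)
    also have "\<dots> = exp U * prob {\<omega>\<in>space (M n). Z n \<omega> \<in> A} + (\<Sum>v\<in>V. (\<integral>\<omega>. ?T \<omega> * indicator (S v) \<omega> \<partial>M n))"
      using sint Iint
      by (subst Bochner_Integration.integral_add) (auto simp: Bochner_Integration.integral_sum Int_absorb2 intro!: Bochner_Integration.integrable_sum)
    also have "(\<Sum>v\<in>V. (\<integral>\<omega>. ?T \<omega> * indicator (S v) \<omega> \<partial>M n)) \<le> (\<Sum>v\<in>V. exp (a n * (E - c)))"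
      by (intro sum_mono bd)
    also have "\<dots> \<le> (real (card V) + 1) * exp (a n * (E - c))" by (simp add: algebra_simps)
    also have "\<dots> = exp (a n * (E - c / 2)) * ((real (card V) + 1) * exp (- (a n * (c / 2))))"
      by (simp add: algebra_simps flip: exp_add)
    also have "\<dots> \<le> exp (a n * (E - c / 2)) * (1 / 2)"
      using elim(3) by (intro mult_left_mono) (simp_all add: algebra_simps)
    finally have "exp (a n * (E - c / 2)) / 2 \<le> exp U * prob {\<omega>\<in>space (M n). Z n \<omega> \<in> A}" by simp
    then have "exp (- U) * (exp (a n * (E - c / 2)) / 2) \<le> exp (- U) * (exp U * prob {\<omega>\<in>space (M n). Z n \<omega> \<in> A})"
      by (intro mult_left_mono) auto
    then have P: "exp (- U + a n * (E - c / 2)) / 2 \<le> prob {\<omega>\<in>space (M n). Z n \<omega> \<in> A}"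
      by (simp add: mult.assoc[symmetric] exp_add[symmetric])
    have E: "E = rate u" "\<theta> \<bullet> u = 2 * rate u" using G\<theta> by (simp_all add: E_def rate_def \<theta>_def GB inner_commute)
    have "exp (- (a n * (rate u + \<eta>))) = exp (- (a n * (rate u + 3 * \<eta> / 4))) * exp (- (a n * (\<eta> / 4)))"
      by (simp add: algebra_simps flip: exp_add)
    also have "\<dots> \<le> exp (- (a n * (rate u + 3 * \<eta> / 4))) * (1 / 2)"
      using elim(4) by (intro mult_left_mono) auto
    also have "exp (- (a n * (rate u + 3 * \<eta> / 4))) \<le> exp (- U + a n * (E - c / 2))"
    proof -
      have "c / 2 + norm \<theta> * (D * \<delta>) \<le> 3 * \<eta> / 4" using d2 cpos eta by (auto simp: c_def)
      then have "a n * (c / 2 + norm \<theta> * (D * \<delta>)) \<le> a n * (3 * \<eta> / 4)" using elim by (intro mult_left_mono) auto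
      then show ?thesis by (simp add: U_def E algebra_simps)
    qed
    finally show ?case using P by simp
  qed
qed

end

section \<open>Circumcircles in coordinates\<close>

definition cross2 :: "real^2 \<Rightarrow> real^2 \<Rightarrow> real" where
  "cross2 p q = p $ 1 * q $ 2 - p $ 2 * q $ 1"

text \<open>The circumcenter of the triangle with vertices \<open>0\<close>, \<open>p\<close>, \<open>q\<close>: the solution of \<open>2 (w \<bullet> p) = p \<bullet> p\<close> and \<open>2 (w \<bullet> q) = q \<bullet> q\<close> by Cramer's rule.\<close>

definition circum_offset :: "real^2 \<Rightarrow> real^2 \<Rightarrow> real^2" where
  "circum_offset p q = (1 / (2 * cross2 p q)) *\<^sub>R
     vector [(p \<bullet> p) * q $ 2 - (q \<bullet> q) * p $ 2, (q \<bullet> q) * p $ 1 - (p \<bullet> p) * q $ 1]"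

text \<open>The two quotients are the barycentric coordinates, with respect to \<open>p\<close> and \<open>q\<close>, of the circumcenter of the triangle
\<open>0\<close>, \<open>p\<close>, \<open>q\<close>. Their positivity together with that of the third coordinate places the circumcenter inside the triangle, which
says that the triangle is acute.\<close>

definition acute :: "real \<Rightarrow> real^2 \<Rightarrow> real^2 \<Rightarrow> bool" where
  "acute s p q \<longleftrightarrow> cross2 p q \<noteq> 0 \<and>
     0 < cross2 (circum_offset p q) q / cross2 p q \<and>
     0 < cross2 p (circum_offset p q) / cross2 p q \<and>
     cross2 (circum_offset p q) q / cross2 p q + cross2 p (circum_offset p q) / cross2 p q < 1 \<and>
     norm (circum_offset p q) \<le> s"

lemma inner2: "(p::real^2) \<bullet> q = p $ 1 * q $ 1 + p $ 2 * q $ 2"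
  by (simp add: inner_vec_def sum_2)

lemma eq2: "(p::real^2) = q \<longleftrightarrow> p $ 1 = q $ 1 \<and> p $ 2 = q $ 2"
  by (simp add: vec_eq_iff forall_2)

lemma cross2_zero [simp]: "cross2 0 p = 0" "cross2 p 0 = 0" "cross2 p p = 0"
  by (simp_all add: cross2_def)

lemma cross2_decomp:
  assumes "cross2 p q \<noteq> 0"
  shows "v = (cross2 v q / cross2 p q) *\<^sub>R p + (cross2 p v / cross2 p q) *\<^sub>R q"
proof -
  have "cross2 p q *\<^sub>R v = cross2 v q *\<^sub>R p + cross2 p v *\<^sub>R q"
    by (auto simp: eq2 cross2_def algebra_simps)
  then have "(1 / cross2 p q) *\<^sub>R (cross2 p q *\<^sub>R v) = (1 / cross2 p q) *\<^sub>R (cross2 v q *\<^sub>R p + cross2 p v *\<^sub>R q)"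
    by simp
  then show ?thesis using assms by (simp add: scaleR_add_right)
qed

lemma cross2_eq_0_iff_collinear: "collinear {a, b, c} \<longleftrightarrow> cross2 (b - a) (c - a) = 0"
proof -
  have "collinear {a, b, c} \<longleftrightarrow> collinear {0, b - a, c - a}"
    using collinear_3[of b a c] by (simp add: insert_commute)
  also have "\<dots> \<longleftrightarrow> cross2 (b - a) (c - a) = 0" (is "_ \<longleftrightarrow> ?R (b - a) (c - a)")
  proof -
    define p q where "p = b - a" and "q = c - a"
    have "collinear {0, p, q} \<longleftrightarrow> cross2 p q = 0"
    proof
      assume "collinear {0, p, q}"
      then show "cross2 p q = 0" by (auto simp: collinear_lemma cross2_def)
    next
      assume 0: "cross2 p q = 0"
      show "collinear {0, p, q}"
      proof (cases "p = 0")
        case False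
        then have pp: "p \<bullet> p \<noteq> 0" by simp
        have "(p \<bullet> p) * q $ 1 - (p \<bullet> q) * p $ 1 = - p $ 2 * cross2 p q"
          "(p \<bullet> p) * q $ 2 - (p \<bullet> q) * p $ 2 = p $ 1 * cross2 p q"
          by (simp_all add: cross2_def inner2 algebra_simps)
        then have "(p \<bullet> p) *\<^sub>R q = (p \<bullet> q) *\<^sub>R p"
          using 0 by (simp add: eq2)
        then have "(1 / (p \<bullet> p)) *\<^sub>R ((p \<bullet> p) *\<^sub>R q) = (1 / (p \<bullet> p)) *\<^sub>R ((p \<bullet> q) *\<^sub>R p)" by simp
        then have "q = ((p \<bullet> q) / (p \<bullet> p)) *\<^sub>R p" using pp by simp
        then show ?thesis by (auto simp: collinear_lemma)
      qed (simp add: collinear_lemma)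
    qed
    then show ?thesis by (simp add: p_def q_def)
  qed
  finally show ?thesis .
qed

lemma circum_offset_components:
  "circum_offset p q $ 1 = ((p \<bullet> p) * q $ 2 - (q \<bullet> q) * p $ 2) / (2 * cross2 p q)"
  "circum_offset p q $ 2 = ((q \<bullet> q) * p $ 1 - (p \<bullet> p) * q $ 1) / (2 * cross2 p q)"
  by (simp_all add: circum_offset_def)

lemma circum_offset_inner:
  assumes "cross2 p q \<noteq> 0"
  shows "2 * (circum_offset p q \<bullet> p) = p \<bullet> p" "2 * (circum_offset p q \<bullet> q) = q \<bullet> q"
proof -
  have e: "2 * cross2 p q * circum_offset p q $ 1 = (p \<bullet> p) * q $ 2 - (q \<bullet> q) * p $ 2"
     "2 * cross2 p q * circum_offset p q $ 2 = (q \<bullet> q) * p $ 1 - (p \<bullet> p) * q $ 1"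
    using assms by (simp_all add: circum_offset_components)
  have "cross2 p q * (2 * (circum_offset p q \<bullet> p)) = (2 * cross2 p q * circum_offset p q $ 1) * p $ 1 + (2 * cross2 p q * circum_offset p q $ 2) * p $ 2"
    by (simp add: inner2 algebra_simps)
  also have "\<dots> = cross2 p q * (p \<bullet> p)"
    unfolding e by (simp add: cross2_def algebra_simps)
  finally show "2 * (circum_offset p q \<bullet> p) = p \<bullet> p" using assms by simp
  have "cross2 p q * (2 * (circum_offset p q \<bullet> q)) = (2 * cross2 p q * circum_offset p q $ 1) * q $ 1 + (2 * cross2 p q * circum_offset p q $ 2) * q $ 2"
    by (simp add: inner2 algebra_simps)
  also have "\<dots> = cross2 p q * (q \<bullet> q)"
    unfolding e by (simp add: cross2_def algebra_simps)
  finally show "2 * (circum_offset p q \<bullet> q) = q \<bullet> q" using assms by simp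
qed

lemma equidistant_iff: "dist (a + w) (a + p) = dist (a + w) a \<longleftrightarrow> 2 * (w \<bullet> p) = p \<bullet> p"
  for a w p :: "'a::real_inner"
proof -
  have "dist (a + w) (a + p) = dist (a + w) a \<longleftrightarrow> norm (w - p) = norm w"
    by (simp add: dist_norm)
  also have "\<dots> \<longleftrightarrow> (norm (w - p))\<^sup>2 = (norm w)\<^sup>2" by simp
  also have "\<dots> \<longleftrightarrow> 2 * (w \<bullet> p) = p \<bullet> p"
    by (auto simp: power2_norm_eq_inner inner_diff_left inner_diff_right inner_commute)
  finally show ?thesis .
qed

lemma inner_determines:
  assumes "cross2 p q \<noteq> 0" "w \<bullet> p = 0" "w \<bullet> q = 0"
  shows "w = 0"
proof -
  have "cross2 p q * w $ 1 = (w \<bullet> p) * q $ 2 - (w \<bullet> q) * p $ 2"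
    "cross2 p q * w $ 2 = (w \<bullet> q) * p $ 1 - (w \<bullet> p) * q $ 1"
    by (simp_all add: cross2_def inner2 algebra_simps)
  then show ?thesis using assms by (simp add: eq2)
qed

lemma circumcenter_eq:
  assumes "cross2 (b - a) (c - a) \<noteq> 0"
  shows "circumcenter {a, b, c} = a + circum_offset (b - a) (c - a)"
    and "circumradius {a, b, c} = norm (circum_offset (b - a) (c - a))"
proof -
  define p q where "p = b - a" and "q = c - a"
  have b: "b = a + p" and c: "c = a + q" by (simp_all add: p_def q_def)
  have cr: "cross2 p q \<noteq> 0" using assms by (simp add: p_def q_def)
  have d: "dist (a + circum_offset p q) b = dist (a + circum_offset p q) a" "dist (a + circum_offset p q) c = dist (a + circum_offset p q) a"
    unfolding b c equidistant_iff by (rule circum_offset_inner[OF cr])+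
  show cc: "circumcenter {a, b, c} = a + circum_offset (b - a) (c - a)"
    unfolding circumcenter_def
  proof (rule the_equality)
    show "\<exists>r. \<forall>y\<in>{a, b, c}. dist (a + circum_offset (b - a) (c - a)) y = r"
      using d unfolding p_def[symmetric] q_def[symmetric] by auto
  next
    fix x assume "\<exists>r. \<forall>y\<in>{a, b, c}. dist x y = r"
    then have "dist x b = dist x a" "dist x c = dist x a" by auto
    moreover define o' where "o' = x - a"
    moreover have x: "x = a + o'" by (simp add: o'_def)
    ultimately have "2 * (o' \<bullet> p) = p \<bullet> p" "2 * (o' \<bullet> q) = q \<bullet> q"
      unfolding b c x equidistant_iff by blast+
    then have "(o' - circum_offset p q) \<bullet> p = 0" "(o' - circum_offset p q) \<bullet> q = 0"
      using circum_offset_inner[OF cr] by (simp_all add: inner_diff_left)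
    then have "o' - circum_offset p q = 0" by (rule inner_determines[OF cr])
    then show "x = a + circum_offset (b - a) (c - a)" by (simp add: x p_def q_def)
  qed
  have "\<forall>y\<in>{a, b, c}. dist (a + circum_offset p q) y = norm (circum_offset p q)"
    using d by (auto simp: dist_norm)
  then show "circumradius {a, b, c} = norm (circum_offset (b - a) (c - a))"
    unfolding circumradius_def cc by (intro the_equality) (auto simp: p_def q_def)
qed

text \<open>Turns the Morse condition into explicit real inequalities in the edge vectors. Translation
invariance, scaling and measurability can be read off from the right hand side.\<close>

lemma morse_cond_iff: "morse_cond s {a, b, c} \<longleftrightarrow> acute s (b - a) (c - a)"
proof (cases "cross2 (b - a) (c - a) = 0")
  case True
  then show ?thesis by (simp add: morse_cond_def acute_def cross2_eq_0_iff_collinear)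
next
  case False
  define p q where "p = b - a" and "q = c - a"
  have cr: "cross2 p q \<noteq> 0" using False by (simp add: p_def q_def)
  define o' where "o' = circum_offset p q"
  define \<beta> \<gamma> where "\<beta> = cross2 o' q / cross2 p q" and "\<gamma> = cross2 p o' / cross2 p q"
  have o': "o' = \<beta> *\<^sub>R p + \<gamma> *\<^sub>R q" unfolding \<beta>_def \<gamma>_def by (rule cross2_decomp[OF cr])
  have nc: "\<not> collinear {a, b, c}" using False by (simp add: cross2_eq_0_iff_collinear)
  have int: "a + o' \<in> interior (convex hull {a, b, c}) \<longleftrightarrow> 0 < \<beta> \<and> 0 < \<gamma> \<and> \<beta> + \<gamma> < 1"
  proof
    assume "a + o' \<in> interior (convex hull {a, b, c})"
    then obtain x y z where xyz: "0 < x" "0 < y" "0 < z" "x + y + z = 1" "x *\<^sub>R a + y *\<^sub>R b + z *\<^sub>R c = a + o'"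
      using interior_convex_hull_3_minimal[OF nc] by auto
    have "x *\<^sub>R a + y *\<^sub>R b + z *\<^sub>R c = (x + y + z) *\<^sub>R a + y *\<^sub>R p + z *\<^sub>R q"
      by (simp add: p_def q_def algebra_simps)
    then have o2: "o' = y *\<^sub>R p + z *\<^sub>R q" using xyz by simp
    have "cross2 o' q = y * cross2 p q" "cross2 p o' = z * cross2 p q"
      unfolding o2 by (simp_all add: cross2_def algebra_simps)
    then have "\<beta> = y" "\<gamma> = z" using cr by (simp_all add: \<beta>_def \<gamma>_def)
    then show "0 < \<beta> \<and> 0 < \<gamma> \<and> \<beta> + \<gamma> < 1" using xyz by auto
  next
    assume bg: "0 < \<beta> \<and> 0 < \<gamma> \<and> \<beta> + \<gamma> < 1"
    have "(1 - \<beta> - \<gamma>) *\<^sub>R a + \<beta> *\<^sub>R b + \<gamma> *\<^sub>R c = a + o'"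
      unfolding o' by (simp add: p_def q_def algebra_simps)
    then show "a + o' \<in> interior (convex hull {a, b, c})"
      unfolding interior_convex_hull_3_minimal[OF nc, simplified] mem_Collect_eq
      using bg by (intro exI[of _ "1 - \<beta> - \<gamma>"] exI[of _ \<beta>] exI[of _ \<gamma>] conjI) simp_all
  qed
  have cc: "circumcenter {a, b, c} = a + o'" "circumradius {a, b, c} = norm o'"
    using circumcenter_eq[OF False] by (simp_all add: o'_def p_def q_def)
  have "morse_cond s {a, b, c} \<longleftrightarrow> 0 < \<beta> \<and> 0 < \<gamma> \<and> \<beta> + \<gamma> < 1 \<and> norm o' \<le> s"
    unfolding morse_cond_def cc int using nc by blast
  also have "\<dots> \<longleftrightarrow> acute s p q"
    unfolding acute_def \<beta>_def \<gamma>_def o'_def using cr by blast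
  finally show ?thesis by (simp add: p_def q_def)
qed

lemma acuteD:
  assumes "acute s p q"
  obtains \<beta> \<gamma> where "cross2 p q \<noteq> 0" "0 < \<beta>" "0 < \<gamma>" "\<beta> + \<gamma> < 1" "circum_offset p q = \<beta> *\<^sub>R p + \<gamma> *\<^sub>R q"
    "norm (circum_offset p q) \<le> s"
  using assms cross2_decomp[of p q "circum_offset p q"] unfolding acute_def by blast

text \<open>If the angle at \<open>0\<close> were at least a right angle, the two equations for the circumcenter would force both barycentric
coordinates \<open>\<beta>\<close> and \<open>\<gamma>\<close> to be at least \<open>1/2\<close>, against \<open>\<beta> + \<gamma> < 1\<close>.\<close>

lemma acute_inner_pos:
  assumes "acute s p q"
  shows "0 < p \<bullet> q"
proof -
  obtain \<beta> \<gamma> where h: "cross2 p q \<noteq> 0" "0 < \<beta>" "0 < \<gamma>" "\<beta> + \<gamma> < 1" "circum_offset p q = \<beta> *\<^sub>R p + \<gamma> *\<^sub>R q"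
    using assms by (rule acuteD)
  have e: "2 * (\<beta> * (p \<bullet> p) + \<gamma> * (p \<bullet> q)) = p \<bullet> p" "2 * (\<beta> * (p \<bullet> q) + \<gamma> * (q \<bullet> q)) = q \<bullet> q"
    using circum_offset_inner[OF h(1)] unfolding h(5) by (simp_all add: inner_add_left inner_add_right inner_commute[of q p])
  define A B C where "A = p \<bullet> p" and "B = q \<bullet> q" and "C = p \<bullet> q"
  have "p \<noteq> 0" "q \<noteq> 0" using h(1) by auto
  then have AB: "A > 0" "B > 0" by (simp_all add: A_def B_def)
  have e1: "2 * \<gamma> * C = A * (1 - 2 * \<beta>)" "2 * \<beta> * C = B * (1 - 2 * \<gamma>)"
    using e by (simp_all add: A_def B_def C_def algebra_simps)
  show ?thesis
  proof (rule ccontr)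
    assume "\<not> ?thesis"
    then have "C \<le> 0" by (simp add: C_def)
    then have "\<gamma> * C \<le> 0" "\<beta> * C \<le> 0" using h by (simp_all add: mult_nonneg_nonpos)
    then have "A * (1 - 2 * \<beta>) \<le> 0" "B * (1 - 2 * \<gamma>) \<le> 0" using e1 by linarith+
    then have "1 - 2 * \<beta> \<le> 0" "1 - 2 * \<gamma> \<le> 0" using AB by (simp_all add: mult_le_0_iff)
    then show False using h by linarith
  qed
qed

lemma circum_offset_scale:
  assumes "r \<noteq> 0"
  shows "circum_offset (r *\<^sub>R p) (r *\<^sub>R q) = r *\<^sub>R circum_offset p q"
proof -
  have cr: "2 * cross2 (r *\<^sub>R p) (r *\<^sub>R q) = r\<^sup>2 * (2 * cross2 p q)"
    by (simp add: cross2_def power2_eq_square algebra_simps)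
  have num: "((r *\<^sub>R u) \<bullet> (r *\<^sub>R u)) * (r *\<^sub>R v) $ i - ((r *\<^sub>R v) \<bullet> (r *\<^sub>R v)) * (r *\<^sub>R u) $ i
      = r\<^sup>2 * (r * ((u \<bullet> u) * v $ i - (v \<bullet> v) * u $ i))" for u v :: "real^2" and i
    by (simp add: power2_eq_square algebra_simps)
  have "r\<^sup>2 \<noteq> 0" using assms by simp
  then show ?thesis
    unfolding eq2 circum_offset_components num cr mult_divide_mult_cancel_left[OF \<open>r\<^sup>2 \<noteq> 0\<close>]
    by (simp add: circum_offset_components)
qed

lemma acute_scale:
  assumes "r > 0"
  shows "acute (r * s) (r *\<^sub>R p) (r *\<^sub>R q) \<longleftrightarrow> acute s p q"
proof -
  have c: "cross2 (r *\<^sub>R a) (r *\<^sub>R b) = r\<^sup>2 * cross2 a b" for a b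
    by (simp add: cross2_def power2_eq_square algebra_simps)
  show ?thesis unfolding acute_def using assms by (simp add: circum_offset_scale c)
qed

lemma acute_min: "acute (min s s') p q \<longleftrightarrow> acute s p q \<and> acute s' p q"
  by (auto simp: acute_def)

lemma borel_measurable_vec_nth [measurable]:
  fixes f :: "'x \<Rightarrow> real^2"
  assumes "f \<in> borel_measurable M"
  shows "(\<lambda>x. f x $ i) \<in> borel_measurable M"
  using assms by (rule measurable_compose[OF _ borel_measurable_continuous_onI])
    (auto intro!: continuous_intros)

lemma borel_measurable_cross2 [measurable]:
  assumes [measurable]: "f \<in> borel_measurable M" "g \<in> borel_measurable M"
  shows "(\<lambda>x. cross2 (f x) (g x)) \<in> borel_measurable M"
  unfolding cross2_def by measurable

lemma borel_measurable_vector2: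
  fixes f :: "'x \<Rightarrow> real^2"
  assumes "(\<lambda>x. f x $ 1) \<in> borel_measurable M" "(\<lambda>x. f x $ 2) \<in> borel_measurable M"
  shows "f \<in> borel_measurable M"
proof (rule borel_measurable_euclidean_space[THEN iffD2], rule)
  fix i :: "real^2" assume "i \<in> Basis"
  then obtain k where "i = axis k 1" by (auto simp: Basis_vec_def)
  then show "(\<lambda>x. f x \<bullet> i) \<in> borel_measurable M"
    using assms exhaust_2[of k] by (auto simp: inner_axis)
qed

lemma borel_measurable_circum_offset [measurable]:
  assumes [measurable]: "f \<in> borel_measurable M" "g \<in> borel_measurable M"
  shows "(\<lambda>x. circum_offset (f x) (g x)) \<in> borel_measurable M"
  by (rule borel_measurable_vector2) (simp_all add: circum_offset_components)

lemma pred_acute [measurable]: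
  assumes [measurable]: "f \<in> borel_measurable M" "g \<in> borel_measurable M"
  shows "Measurable.pred M (\<lambda>x. acute s (f x) (g x))"
  unfolding acute_def by measurable

section \<open>Linear bound for the number of critical triples\<close>

text \<open>Only circles through three non-collinear points are considered; other three-point sets are never critical.\<close>

definition no_cocircular :: "(real^2) set \<Rightarrow> bool" where
  "no_cocircular F \<longleftrightarrow> (\<forall>Y\<subseteq>F. card Y = 3 \<and> \<not> collinear Y \<longrightarrow>
     (\<forall>x\<in>F - Y. dist (circumcenter Y) x \<noteq> circumradius Y))"

definition critical :: "real \<Rightarrow> (real^2) set \<Rightarrow> (real^2) set set" where
  "critical s F = {Y. Y \<subseteq> F \<and> card Y = 3 \<and> morse_cond s Y \<and> circumdisk Y \<inter> F = {}}"

lemma finite_critical: "finite F \<Longrightarrow> finite (critical s F)"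
  by (rule finite_subset[of _ "Pow F"]) (auto simp: critical_def)

definition in_cone :: "real^2 \<Rightarrow> real^2 \<Rightarrow> real^2 \<Rightarrow> bool" where
  "in_cone d p q \<longleftrightarrow> (\<exists>l m. 0 < l \<and> 0 < m \<and> d = l *\<^sub>R p + m *\<^sub>R q)"

lemma in_cone_scale:
  assumes "in_cone d (u *\<^sub>R p) (v *\<^sub>R q)" "0 < u" "0 < v"
  shows "in_cone d p q"
proof -
  obtain l m where "0 < l" "0 < m" "d = l *\<^sub>R u *\<^sub>R p + m *\<^sub>R v *\<^sub>R q"
    using assms(1) by (auto simp: in_cone_def)
  then show ?thesis unfolding in_cone_def using assms
    by (intro exI[of _ "l * u"] exI[of _ "m * v"]) simp
qed

lemma cross2_sq: "(cross2 p q)\<^sup>2 = (p \<bullet> p) * (q \<bullet> q) - (p \<bullet> q)\<^sup>2"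
  by (simp add: cross2_def inner2 power2_eq_square algebra_simps)

text \<open>The pairs of unit vectors at an angle between \<open>60\<close> and \<open>90\<close> degrees form a compact set. Each such pair has its own
bisector \<open>p + q\<close> in the open cone it spans, and a vector stays in the open cone under small changes of the pair, so finitely
many vectors serve all pairs.\<close>

lemma finite_directions_unit:
  "\<exists>D. finite D \<and> (\<forall>p q. norm p = 1 \<and> norm q = 1 \<and> 0 \<le> p \<bullet> q \<and> p \<bullet> q \<le> 1/2 \<longrightarrow> (\<exists>d\<in>D. in_cone d p q))"
proof -
  let ?K = "(sphere 0 1 \<times> sphere 0 1) \<inter> {z :: (real^2) \<times> (real^2). 0 \<le> fst z \<bullet> snd z \<and> fst z \<bullet> snd z \<le> 1/2}"
  define U :: "real^2 \<Rightarrow> ((real^2) \<times> (real^2)) set"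
    where "U = (\<lambda>d. {z. 0 < cross2 d (snd z) * cross2 (fst z) (snd z)} \<inter> {z. 0 < cross2 (fst z) d * cross2 (fst z) (snd z)})"
  have cl: "closed {z :: (real^2) \<times> (real^2). 0 \<le> fst z \<bullet> snd z \<and> fst z \<bullet> snd z \<le> 1/2}"
    by (intro closed_Collect_conj closed_Collect_le continuous_intros)
  have K: "compact ?K" by (intro compact_Int_closed compact_Times compact_sphere cl)
  have Uop: "open (U d)" for d
    unfolding U_def cross2_def by (intro open_Int open_Collect_less continuous_intros)
  have cov: "z \<in> U (fst z + snd z)" if z: "z \<in> ?K" for z
  proof -
    obtain p q where pq: "z = (p, q)" by (cases z)
    have n: "p \<bullet> p = 1" "q \<bullet> q = 1" "0 \<le> p \<bullet> q" "p \<bullet> q \<le> 1/2"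
      using z pq by (auto simp: norm_eq_1)
    have "(p \<bullet> q)\<^sup>2 \<le> (1/2)\<^sup>2" using n by (intro power_mono) auto
    then have "cross2 p q \<noteq> 0" using cross2_sq[of p q] n by (auto simp: power2_eq_square)
    moreover have "cross2 (p + q) q = cross2 p q" "cross2 p (p + q) = cross2 p q"
      by (simp_all add: cross2_def algebra_simps)
    ultimately show ?thesis by (auto simp: U_def pq zero_less_mult_iff linorder_neq_iff)
  qed
  have cov': "?K \<subseteq> (\<Union>d\<in>UNIV. U d)"
  proof
    fix z assume "z \<in> ?K"
    then show "z \<in> (\<Union>d\<in>UNIV. U d)" using cov by (intro UN_I[of "fst z + snd z"]) auto
  qed
  obtain D where D: "finite D" "?K \<subseteq> (\<Union>d\<in>D. U d)"
    by (rule compactE_image[OF K Uop cov']) simp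
  have "\<exists>d\<in>D. in_cone d p q" if "norm p = 1 \<and> norm q = 1 \<and> 0 \<le> p \<bullet> q \<and> p \<bullet> q \<le> 1/2" for p q
  proof -
    have "(p, q) \<in> ?K" using that by auto
    then obtain d where d: "d \<in> D" "(p, q) \<in> U d" using D(2) by blast
    then have "0 < cross2 d q / cross2 p q" "0 < cross2 p d / cross2 p q"
      by (auto simp: U_def zero_less_divide_iff zero_less_mult_iff)
    moreover from this have "cross2 p q \<noteq> 0" by auto
    ultimately show ?thesis unfolding in_cone_def using cross2_decomp[of p q d] d(1) by blast
  qed
  then show ?thesis using D(1) by blast
qed

lemma finite_directions:
  "\<exists>D. finite D \<and> (\<forall>p q. 0 < p \<bullet> q \<and> 2 * (p \<bullet> q) \<le> p \<bullet> p \<and> 2 * (p \<bullet> q) \<le> q \<bullet> q \<longrightarrow> (\<exists>d\<in>D. in_cone d p q))"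
proof -
  obtain D where D: "finite D" "\<And>p q. norm p = 1 \<and> norm q = 1 \<and> 0 \<le> p \<bullet> q \<and> p \<bullet> q \<le> 1/2 \<Longrightarrow> \<exists>d\<in>D. in_cone d p q"
    using finite_directions_unit by blast
  have "\<exists>d\<in>D. in_cone d p q" if h: "0 < p \<bullet> q" "2 * (p \<bullet> q) \<le> p \<bullet> p" "2 * (p \<bullet> q) \<le> q \<bullet> q" for p q
  proof -
    have nz: "p \<noteq> 0" "q \<noteq> 0" using h by auto
    define u v where "u = inverse (norm p)" and "v = inverse (norm q)"
    have uv: "u > 0" "v > 0" using nz by (simp_all add: u_def v_def)
    have le: "2 * (p \<bullet> q) \<le> norm p * norm q"
    proof (rule power2_le_imp_le)
      have "(2 * (p \<bullet> q))\<^sup>2 \<le> (p \<bullet> p) * (q \<bullet> q)"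
        unfolding power2_eq_square using h by (intro mult_mono) auto
      then show "(2 * (p \<bullet> q))\<^sup>2 \<le> (norm p * norm q)\<^sup>2" by (simp add: power_mult_distrib power2_norm_eq_inner)
    qed simp
    have "(u *\<^sub>R p) \<bullet> (v *\<^sub>R q) = (p \<bullet> q) / (norm p * norm q)"
      by (simp add: u_def v_def divide_inverse)
    moreover have "0 < norm p * norm q" using nz by simp
    ultimately have "0 \<le> (u *\<^sub>R p) \<bullet> (v *\<^sub>R q)" "(u *\<^sub>R p) \<bullet> (v *\<^sub>R q) \<le> 1/2"
      using le h(1) by (simp_all add: divide_le_eq)
    moreover have "norm (u *\<^sub>R p) = 1" "norm (v *\<^sub>R q) = 1" using nz by (simp_all add: u_def v_def)
    ultimately obtain d where "d \<in> D" "in_cone d (u *\<^sub>R p) (v *\<^sub>R q)" using D(2) by blast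
    then show ?thesis using in_cone_scale uv by blast
  qed
  then show ?thesis using D(1) by blast
qed

text \<open>The vertex opposite to a longest side has an angle of at least \<open>60\<close> degrees, which is what the two inequalities express.\<close>

lemma apex_exists:
  assumes Y: "card Y = 3" "morse_cond s Y"
  shows "\<exists>x a b. Y = {x, x + a, x + b} \<and> acute s a b \<and> 2 * (a \<bullet> b) \<le> a \<bullet> a \<and> 2 * (a \<bullet> b) \<le> b \<bullet> b"
proof -
  obtain u v w where uvw: "Y = {u, v, w}" using Y(1) by (auto simp: card_3_iff)
  have key: "\<exists>x a b. Y = {x, x + a, x + b} \<and> acute s a b \<and> 2 * (a \<bullet> b) \<le> a \<bullet> a \<and> 2 * (a \<bullet> b) \<le> b \<bullet> b"
    if "Y = {u, v, w}" "dist u v \<le> dist v w" "dist u w \<le> dist v w" for u v w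
  proof (intro exI conjI)
    define a b where "a = v - u" and "b = w - u"
    show "Y = {u, u + (v - u), u + (w - u)}" using that by simp
    show "acute s (v - u) (w - u)" using Y(2) that morse_cond_iff by simp
    have "(norm a)\<^sup>2 \<le> (norm (a - b))\<^sup>2" "(norm b)\<^sup>2 \<le> (norm (a - b))\<^sup>2"
      using that by (auto simp: a_def b_def dist_norm norm_minus_commute intro!: power_mono)
    then show "2 * ((v - u) \<bullet> (w - u)) \<le> (v - u) \<bullet> (v - u)" "2 * ((v - u) \<bullet> (w - u)) \<le> (w - u) \<bullet> (w - u)"
      unfolding a_def[symmetric] b_def[symmetric]
      by (simp_all add: power2_norm_eq_inner inner_diff_left inner_diff_right inner_commute[of b a])
  qed
  have "(dist u v \<le> dist v w \<and> dist u w \<le> dist v w) \<or> (dist v u \<le> dist u w \<and> dist v w \<le> dist u w)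
    \<or> (dist w u \<le> dist u v \<and> dist w v \<le> dist u v)"
    using dist_commute[of v u] dist_commute[of w u] dist_commute[of w v] by linarith
  then consider "dist u v \<le> dist v w \<and> dist u w \<le> dist v w" | "dist v u \<le> dist u w \<and> dist v w \<le> dist u w"
    | "dist w u \<le> dist u v \<and> dist w v \<le> dist u v"
    by blast
  then show ?thesis
  proof cases
    case 1
    then show ?thesis using key[of u v w] uvw by blast
  next
    case 2
    then show ?thesis using key[of v u w] uvw by (auto simp: insert_commute)
  next
    case 3
    then show ?thesis using key[of w u v] uvw by (auto simp: insert_commute)
  qed
qed

text \<open>Power of a point: a point \<open>x + y\<close> on the circle with center \<open>x + c'\<close> through \<open>x\<close> satisfies \<open>y \<bullet> y = 2 (c' \<bullet> y)\<close>, and lying outside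
the circle with center \<open>x + c\<close> through \<open>x\<close> means \<open>y \<bullet> y \<ge> 2 (c \<bullet> y)\<close>. Hence the cone of the second triangle at \<open>x\<close> lies on one
side of the line through \<open>x\<close> perpendicular to \<open>c' - c\<close>.\<close>

lemma empty_disk_separates:
  assumes cr: "cross2 a b \<noteq> 0" "cross2 a' b' \<noteq> 0"
    and out: "x + a' \<notin> circumdisk {x, x + a, x + b}" "x + b' \<notin> circumdisk {x, x + a, x + b}"
    and d: "in_cone d a' b'"
  shows "0 \<le> d \<bullet> (circum_offset a' b' - circum_offset a b)"
    and "d \<bullet> (circum_offset a' b' - circum_offset a b) = 0 \<Longrightarrow> circum_offset a' b' = circum_offset a b"
proof -
  define c c' where "c = circum_offset a b" and "c' = circum_offset a' b'"
  have disk: "circumdisk {x, x + a, x + b} = ball (x + c) (norm c)"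
    using circumcenter_eq[of "x + a" x "x + b"] cr(1) by (simp add: circumdisk_def c_def)
  have ge: "2 * (c \<bullet> y) \<le> y \<bullet> y" if "x + y \<notin> circumdisk {x, x + a, x + b}" for y
  proof -
    have "norm c \<le> norm (c - y)" using that by (simp add: disk dist_norm)
    then have "(norm c)\<^sup>2 \<le> (norm (c - y))\<^sup>2" by (intro power_mono) auto
    then show ?thesis by (simp add: power2_norm_eq_inner inner_diff_left inner_diff_right inner_commute[of y c])
  qed
  have g: "0 \<le> a' \<bullet> (c' - c)" "0 \<le> b' \<bullet> (c' - c)"
    using ge[OF out(1)] ge[OF out(2)] circum_offset_inner[OF cr(2)]
    by (simp_all add: c'_def inner_diff_right inner_commute)
  obtain l m where lm: "0 < l" "0 < m" "d = l *\<^sub>R a' + m *\<^sub>R b'" using d by (auto simp: in_cone_def)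
  have dd: "d \<bullet> (c' - c) = l * (a' \<bullet> (c' - c)) + m * (b' \<bullet> (c' - c))"
    by (simp add: lm inner_add_left)
  have p: "0 \<le> l * (a' \<bullet> (c' - c))" "0 \<le> m * (b' \<bullet> (c' - c))"
    using lm g by simp_all
  show "0 \<le> d \<bullet> (circum_offset a' b' - circum_offset a b)"
    using dd p unfolding c_def c'_def by linarith
  assume "d \<bullet> (circum_offset a' b' - circum_offset a b) = 0"
  then have "d \<bullet> (c' - c) = 0" by (simp add: c_def c'_def)
  then have "l * (a' \<bullet> (c' - c)) = 0" "m * (b' \<bullet> (c' - c)) = 0" using dd p by linarith+
  then have "(c' - c) \<bullet> a' = 0" "(c' - c) \<bullet> b' = 0" using lm by (auto simp: inner_commute)
  then have "c' - c = 0" by (rule inner_determines[OF cr(2)])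
  then show "circum_offset a' b' = circum_offset a b" by (simp add: c_def c'_def)
qed

text \<open>Charge each critical triple to the pair of its apex and a direction from a fixed finite set that
meets the cone at the apex. By \<open>empty_disk_separates\<close> the cones of two triples with the same apex lie on opposite sides of a
line unless the circumcenters agree, so a common direction forces equal circumcircles, and then equal triples because no
four points are cocircular. Hence the charging is injective.\<close>

lemma card_critical_linear:
  "\<exists>\<kappa>::nat. \<forall>s F. finite F \<and> no_cocircular F \<longrightarrow> card (critical s F) \<le> \<kappa> * card F"
proof -
  obtain D where D: "finite D" "\<And>p q. 0 < p \<bullet> q \<and> 2 * (p \<bullet> q) \<le> p \<bullet> p \<and> 2 * (p \<bullet> q) \<le> q \<bullet> q \<Longrightarrow> \<exists>d\<in>D. in_cone d p q"
    using finite_directions by blast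
  have "card (critical s F) \<le> card D * card F" if F: "finite F" "no_cocircular F" for s F
  proof -
    define W where "W = (\<lambda>Y (x, d). d \<in> D \<and> (\<exists>a b. Y = {x, x + a, x + b} \<and> acute s a b \<and> in_cone d a b))"
    have ex: "\<exists>z. W Y z" if "Y \<in> critical s F" for Y
    proof -
      obtain x a b where h: "Y = {x, x + a, x + b}" "acute s a b" "2 * (a \<bullet> b) \<le> a \<bullet> a" "2 * (a \<bullet> b) \<le> b \<bullet> b"
        using apex_exists[of Y s] \<open>Y \<in> critical s F\<close> unfolding critical_def by blast
      moreover from acute_inner_pos[OF h(2)] h(3,4) obtain d where "d \<in> D" "in_cone d a b" using D(2) by blast
      ultimately have "W Y (x, d)" unfolding W_def by blast
      then show ?thesis by blast
    qed
    define f where "f = (\<lambda>Y. SOME z. W Y z)"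
    have f: "W Y (f Y)" if "Y \<in> critical s F" for Y
      unfolding f_def using ex[OF that] by (rule someI_ex)
    have "inj_on f (critical s F)"
    proof (rule inj_onI)
      fix Y Y' assume Y: "Y \<in> critical s F" "Y' \<in> critical s F" "f Y = f Y'"
      obtain x d where xd: "f Y = (x, d)" by (cases "f Y")
      obtain a b where ab: "Y = {x, x + a, x + b}" "acute s a b" "in_cone d a b"
        using f[OF Y(1)] unfolding xd W_def by auto
      obtain a' b' where ab': "Y' = {x, x + a', x + b'}" "acute s a' b'" "in_cone d a' b'"
        using f[OF Y(2)] unfolding Y(3)[symmetric] xd W_def by auto
      have cr: "cross2 a b \<noteq> 0" "cross2 a' b' \<noteq> 0" using ab ab' by (auto simp: acute_def)
      have sub: "Y \<subseteq> F" "Y' \<subseteq> F" and emp: "circumdisk Y \<inter> F = {}" "circumdisk Y' \<inter> F = {}"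
        and c3: "card Y = 3" "card Y' = 3" using Y by (auto simp: critical_def)
      have out: "x + a' \<notin> circumdisk {x, x + a, x + b}" "x + b' \<notin> circumdisk {x, x + a, x + b}"
        "x + a \<notin> circumdisk {x, x + a', x + b'}" "x + b \<notin> circumdisk {x, x + a', x + b'}"
        using sub emp ab(1) ab'(1) by blast+
      have "0 \<le> d \<bullet> (circum_offset a' b' - circum_offset a b)"
        using empty_disk_separates(1)[OF cr out(1,2) ab'(3)] .
      moreover have "0 \<le> d \<bullet> (circum_offset a b - circum_offset a' b')"
        using empty_disk_separates(1)[OF cr(2,1) out(3,4) ab(3)] .
      ultimately have "d \<bullet> (circum_offset a' b' - circum_offset a b) = 0" by (simp add: inner_diff_right)
      then have cc: "circum_offset a' b' = circum_offset a b"
        using empty_disk_separates(2)[OF cr out(1,2) ab'(3)] by blast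
      have Yc: "circumcenter Y = x + circum_offset a b" "circumradius Y = norm (circum_offset a b)"
        using circumcenter_eq[of "x + a" x "x + b"] cr by (simp_all add: ab(1))
      have e: "dist (x + circum_offset a b) (x + a') = norm (circum_offset a b)" "dist (x + circum_offset a b) (x + b') = norm (circum_offset a b)"
        using equidistant_iff[of x "circum_offset a' b'" a'] equidistant_iff[of x "circum_offset a' b'" b'] circum_offset_inner[OF cr(2)]
        unfolding cc by (auto simp: dist_norm)
      have ncol: "\<not> collinear Y" using Y(1) by (auto simp: critical_def morse_cond_def)
      have "y \<in> Y" if "y \<in> Y'" for y
      proof (rule ccontr)
        assume "y \<notin> Y"
        then have "dist (circumcenter Y) y \<noteq> circumradius Y"
          using F(2) sub c3 ncol that unfolding no_cocircular_def by blast
        moreover have "y = x + a' \<or> y = x + b'" using that \<open>y \<notin> Y\<close> ab(1) ab'(1) by auto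
        ultimately show False using e Yc by auto
      qed
      then have "Y' \<subseteq> Y" by blast
      then show "Y = Y'" using c3 by (metis card_subset_eq finite_subset[OF sub(1) F(1)])
    qed
    moreover have "f ` critical s F \<subseteq> F \<times> D"
    proof
      fix z assume "z \<in> f ` critical s F"
      then obtain Y where Y: "Y \<in> critical s F" "z = f Y" by blast
      obtain x d where xd: "f Y = (x, d)" by (cases "f Y")
      show "z \<in> F \<times> D" using f[OF Y(1)] Y unfolding xd W_def by (auto simp: critical_def)
    qed
    ultimately have "card (critical s F) \<le> card (F \<times> D)"
      using F(1) D(1) by (intro card_inj_on_le) auto
    then show ?thesis by (simp add: card_cartesian_product mult.commute)
  qed
  then show ?thesis by blast
qed

lemma morse_count_eq_card: "finite F \<Longrightarrow> morse_count s F = real (card (critical s F))"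
proof -
  assume F: "finite F"
  have fin: "finite {Y. Y \<subseteq> F \<and> card Y = 3}"
  proof (rule finite_subset)
    show "{Y. Y \<subseteq> F \<and> card Y = 3} \<subseteq> Pow F" by blast
    show "finite (Pow F)" using F by simp
  qed
  have "morse_count s F = real (card ({Y. Y \<subseteq> F \<and> card Y = 3} \<inter> {Y. morse_cond s Y \<and> circumdisk Y \<inter> F = {}}))"
    unfolding morse_count_def using fin by (subst sum_of_bool_eq) auto
  also have "{Y. Y \<subseteq> F \<and> card Y = 3} \<inter> {Y. morse_cond s Y \<and> circumdisk Y \<inter> F = {}} = critical s F"
    by (auto simp: critical_def)
  finally show ?thesis .
qed

section \<open>Measurability of sums over a point process\<close>

text \<open>The same property is used for the probability space, for its sub-sigma-algebras generated by a region, and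
for products with the plane, so the base space is kept arbitrary.\<close>

definition counts_measurable :: "'w measure \<Rightarrow> ('w \<Rightarrow> (real^2) set) \<Rightarrow> bool" where
  "counts_measurable W P \<longleftrightarrow> (\<forall>w\<in>space W. finite (P w)) \<and>
     (\<forall>B\<in>sets borel. (\<lambda>w. card (P w \<inter> B)) \<in> measurable W (count_space UNIV))"

lemma counts_measurableD:
  assumes "counts_measurable W P"
  shows "B \<in> sets borel \<Longrightarrow> (\<lambda>w. card (P w \<inter> B)) \<in> measurable W (count_space UNIV)"
    and "w \<in> space W \<Longrightarrow> finite (P w)"
  using assms unfolding counts_measurable_def by blast+

lemma counts_measurable_fst:
  "counts_measurable W P \<Longrightarrow> counts_measurable (W \<Otimes>\<^sub>M N) (\<lambda>z. P (fst z))"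
  unfolding counts_measurable_def
proof safe
  fix B :: "(real^2) set" assume "B \<in> sets borel" and c: "\<forall>B\<in>sets borel. (\<lambda>w. card (P w \<inter> B)) \<in> measurable W (count_space UNIV)"
  then have "(\<lambda>w. card (P w \<inter> B)) \<in> measurable W (count_space UNIV)" by blast
  from measurable_compose[OF measurable_fst this]
  show "(\<lambda>z. card (P (fst z) \<inter> B)) \<in> measurable (W \<Otimes>\<^sub>M N) (count_space UNIV)" .
qed (auto simp: space_pair_measure)

text \<open>The map \<open>w \<mapsto> P w\<close> is a kernel of counting measures. The claim passes from measurable rectangles to all
measurable sets by Dynkin's argument, where finiteness of the configuration handles complements, and then to functions by
monotone approximation.\<close>

lemma nn_integral_points_measurable:
  assumes P: "counts_measurable W P" and u: "u \<in> borel_measurable (W \<Otimes>\<^sub>M (borel :: (real^2) measure))"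
  shows "(\<lambda>w. \<integral>\<^sup>+x. u (w, x) \<partial>count_space (P w)) \<in> borel_measurable W"
  using u
proof (induction rule: borel_measurable_induct)
  case (cong f g)
  have "(\<lambda>w. \<integral>\<^sup>+x. f (w, x) \<partial>count_space (P w)) \<in> borel_measurable W \<longleftrightarrow>
    (\<lambda>w. \<integral>\<^sup>+x. g (w, x) \<partial>count_space (P w)) \<in> borel_measurable W"
    using cong(3) by (intro measurable_cong nn_integral_cong) (auto simp: space_pair_measure)
  with cong(4) show ?case by simp
next
  case (set C)
  have *: "(\<integral>\<^sup>+x. indicator C (w, x) \<partial>count_space (P w)) = of_nat (card {x\<in>P w. (w, x) \<in> C})" if "w \<in> space W" for w
  proof -
    have f: "finite (P w)" using P that by (auto simp: counts_measurable_def)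
    have "(\<integral>\<^sup>+x. indicator C (w, x) \<partial>count_space (P w)) = (\<Sum>x\<in>P w. indicator C (w, x))"
      using f by (rule nn_integral_count_space_finite)
    also have "\<dots> = (\<Sum>x\<in>{x\<in>P w. (w, x) \<in> C}. 1)"
      using f by (intro sum.mono_neutral_cong_right) (auto simp: indicator_def)
    finally show ?thesis by simp
  qed
  have "(\<lambda>w. \<integral>\<^sup>+x. indicator C (w, x) \<partial>count_space (P w)) \<in> borel_measurable W"
    using Int_stable_pair_measure_generator[of W borel] pair_measure_closed[of W borel] set
    unfolding sets_pair_measure
  proof (induction rule: sigma_sets_induct_disjoint)
    case (basic A)
    then obtain a b where ab: "A = a \<times> b" "a \<in> sets W" "b \<in> sets borel" by auto
    have [measurable]: "(\<lambda>w. card (P w \<inter> b)) \<in> measurable W (count_space UNIV)" "a \<in> sets W"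
      using P ab by (auto simp: counts_measurable_def)
    have eq: "(\<integral>\<^sup>+x. indicator A (w, x) \<partial>count_space (P w)) = indicator a w * of_nat (card (P w \<inter> b))" if "w \<in> space W" for w
    proof -
      have f: "finite (P w)" using P that by (auto simp: counts_measurable_def)
      have "(\<integral>\<^sup>+x. indicator A (w, x) \<partial>count_space (P w)) = (\<Sum>x\<in>P w. indicator A (w, x))"
        using f by (rule nn_integral_count_space_finite)
      also have "\<dots> = (\<Sum>x\<in>P w. indicator a w * indicator b x)"
        by (intro sum.cong) (auto simp: ab indicator_def)
      also have "\<dots> = indicator a w * (\<Sum>x\<in>P w \<inter> b. 1)"
        unfolding sum_distrib_left[symmetric]
        using f by (intro arg_cong2[where f="(*)"] refl sum.mono_neutral_cong_right) (auto simp: indicator_def)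
      finally show ?thesis by simp
    qed
    have "(\<lambda>w. indicator a w * of_nat (card (P w \<inter> b)) :: ennreal) \<in> borel_measurable W" by measurable
    then show ?case by (subst measurable_cong[OF eq]) auto
  next
    case (compl A)
    have A: "A \<in> sets (W \<Otimes>\<^sub>M borel)" using compl(1) unfolding sets_pair_measure .
    have [measurable]: "(\<lambda>w. card (P w \<inter> UNIV)) \<in> measurable W (count_space UNIV)"
      by (rule counts_measurableD(1)[OF P]) simp
    note compl(2)[measurable]
    have eq: "(\<integral>\<^sup>+x. indicator (space W \<times> space borel - A) (w, x) \<partial>count_space (P w))
       = of_nat (card (P w \<inter> UNIV)) - (\<integral>\<^sup>+x. indicator A (w, x) \<partial>count_space (P w))" if "w \<in> space W" for w
    proof -
      have f: "finite (P w)" using P that by (auto simp: counts_measurable_def)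
      have "of_nat (card (P w \<inter> UNIV)) = (\<Sum>x\<in>P w. 1::ennreal)" by simp
      also have "\<dots> = (\<Sum>x\<in>P w. indicator (space W \<times> space borel - A) (w, x) + indicator A (w, x))"
        using that by (intro sum.cong) (auto simp: indicator_def)
      also have "\<dots> = (\<integral>\<^sup>+x. indicator (space W \<times> space borel - A) (w, x) \<partial>count_space (P w))
          + (\<integral>\<^sup>+x. indicator A (w, x) \<partial>count_space (P w))"
        using f by (simp add: sum.distrib nn_integral_count_space_finite)
      finally have e: "of_nat (card (P w \<inter> UNIV)) = (\<integral>\<^sup>+x. indicator (space W \<times> space borel - A) (w, x) \<partial>count_space (P w))
          + (\<integral>\<^sup>+x. indicator A (w, x) \<partial>count_space (P w))" .
      have "(\<integral>\<^sup>+x. indicator A (w, x) \<partial>count_space (P w)) \<noteq> \<top>"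
        using f by (simp add: nn_integral_count_space_finite indicator_def)
      with e show ?thesis by (metis ennreal_add_diff_cancel_right infinity_ennreal_def)
    qed
    have "(\<lambda>w. of_nat (card (P w \<inter> UNIV)) - (\<integral>\<^sup>+x. indicator A (w, x) \<partial>count_space (P w))) \<in> borel_measurable W"
      by measurable
    then show ?case by (subst measurable_cong[OF eq]) auto
  next
    case (union A)
    note union(3)[measurable]
    have eq: "(\<integral>\<^sup>+x. indicator (\<Union>i. A i) (w, x) \<partial>count_space (P w))
        = (\<Sum>i. \<integral>\<^sup>+x. indicator (A i) (w, x) \<partial>count_space (P w))" for w
    proof -
      have "(\<integral>\<^sup>+x. indicator (\<Union>i. A i) (w, x) \<partial>count_space (P w))
         = (\<integral>\<^sup>+x. (\<Sum>i. indicator (A i) (w, x)) \<partial>count_space (P w))"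
        using union(1) by (intro nn_integral_cong suminf_indicator[symmetric])
      also have "\<dots> = (\<Sum>i. \<integral>\<^sup>+x. indicator (A i) (w, x) \<partial>count_space (P w))"
        by (rule nn_integral_suminf) simp
      finally show ?thesis .
    qed
    show ?case unfolding eq by measurable
  qed simp
  then show ?case .
next
  case (mult u c)
  note mult.IH[measurable]
  have "(\<lambda>w. \<integral>\<^sup>+x. c * u (w, x) \<partial>count_space (P w)) = (\<lambda>w. c * (\<integral>\<^sup>+x. u (w, x) \<partial>count_space (P w)))"
    by (intro ext nn_integral_cmult) simp
  then show ?case by simp
next
  case (add u v)
  note add.IH[measurable]
  have "(\<lambda>w. \<integral>\<^sup>+x. v (w, x) + u (w, x) \<partial>count_space (P w)) =
    (\<lambda>w. (\<integral>\<^sup>+x. v (w, x) \<partial>count_space (P w)) + (\<integral>\<^sup>+x. u (w, x) \<partial>count_space (P w)))"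
    by (intro ext nn_integral_add) simp_all
  then show ?case by simp
next
  case (seq U)
  note seq.IH[measurable]
  have "(\<integral>\<^sup>+x. (SUP i. U i) (w, x) \<partial>count_space (P w)) = (SUP i. \<integral>\<^sup>+x. U i (w, x) \<partial>count_space (P w))" for w
  proof -
    have "(\<integral>\<^sup>+x. (SUP i. U i) (w, x) \<partial>count_space (P w)) = (\<integral>\<^sup>+x. (SUP i. U i (w, x)) \<partial>count_space (P w))"
      by (simp add: SUP_apply image_comp)
    also have "\<dots> = (SUP i. \<integral>\<^sup>+x. U i (w, x) \<partial>count_space (P w))"
      using seq.hyps by (intro nn_integral_monotone_convergence_SUP) (auto simp: incseq_def le_fun_def)
    finally show ?thesis .
  qed
  then show ?case by simp
qed

lemma sum_points_measurable:
  fixes f :: "'w \<Rightarrow> real^2 \<Rightarrow> real"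
  assumes P: "counts_measurable W P" and f[measurable]: "(\<lambda>z. f (fst z) (snd z)) \<in> borel_measurable (W \<Otimes>\<^sub>M borel)"
    and pos: "\<And>w x. 0 \<le> f w x"
  shows "(\<lambda>w. \<Sum>x\<in>P w. f w x) \<in> borel_measurable W"
proof -
  have "(\<lambda>z. ennreal (f (fst z) (snd z))) \<in> borel_measurable (W \<Otimes>\<^sub>M borel)" by measurable
  from nn_integral_points_measurable[OF P this]
  have m: "(\<lambda>w. enn2real (\<integral>\<^sup>+x. ennreal (f w x) \<partial>count_space (P w))) \<in> borel_measurable W" by simp
  have "enn2real (\<integral>\<^sup>+x. ennreal (f w x) \<partial>count_space (P w)) = (\<Sum>x\<in>P w. f w x)" if "w \<in> space W" for w
  proof -
    have "finite (P w)" using P that by (auto simp: counts_measurable_def)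
    then show ?thesis using pos by (simp add: nn_integral_count_space_finite sum_ennreal enn2real_ennreal sum_nonneg)
  qed
  then show ?thesis using m by (subst measurable_cong[where g="\<lambda>w. enn2real (\<integral>\<^sup>+x. ennreal (f w x) \<partial>count_space (P w))"]) auto
qed

section \<open>Independence over disjoint regions\<close>

lemma poissonD:
  assumes "poisson_point_process M S lam P"
  shows "prob_space M" "\<And>\<omega>. \<omega> \<in> space M \<Longrightarrow> finite (P \<omega>)" "\<And>\<omega>. \<omega> \<in> space M \<Longrightarrow> P \<omega> \<subseteq> S"
    "counts_measurable M P"
    "\<And>B k. B \<in> sets borel \<Longrightarrow> measure M {\<omega>\<in>space M. card (P \<omega> \<inter> B) = k} =
          exp (- (lam * measure lborel (S \<inter> B))) * (lam * measure lborel (S \<inter> B)) ^ k / fact k"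
    "\<And>(I::nat set) B. finite I \<Longrightarrow> (\<And>i. i \<in> I \<Longrightarrow> B i \<in> sets borel) \<Longrightarrow> disjoint_family_on B I \<Longrightarrow>
        prob_space.indep_vars M (\<lambda>_. count_space UNIV) (\<lambda>i \<omega>. card (P \<omega> \<inter> B i)) I"
  using assms unfolding poisson_point_process_def counts_measurable_def by blast+

text \<open>The events that depend on the counts in a finite measurable partition of \<open>R\<close>, the partition being given
by a labelling \<open>l\<close>. This form of a generator is stable under intersection (pair the labels), and for disjoint regions
it involves only counts in disjoint sets.\<close>

definition label_events :: "'w measure \<Rightarrow> ('w \<Rightarrow> (real^2) set) \<Rightarrow> (real^2) set \<Rightarrow> 'w set set" where
  "label_events M P R = {{\<omega>\<in>space M. (\<lambda>j. card (P \<omega> \<inter> (R \<inter> l -` {j}))) \<in> \<Phi>} | l J \<Phi>.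
      l \<in> measurable borel (count_space UNIV) \<and> (\<forall>x. l x < (J::nat))}"

lemma label_events_iff: "E \<in> label_events M P R \<longleftrightarrow> (\<exists>l J \<Phi>. E = {\<omega>\<in>space M. (\<lambda>j. card (P \<omega> \<inter> (R \<inter> l -` {j}))) \<in> \<Phi>}
    \<and> l \<in> measurable borel (count_space UNIV) \<and> (\<forall>x. l x < (J::nat)))"
  unfolding label_events_def by blast

lemma vimage_label_borel:
  "l \<in> measurable borel (count_space UNIV) \<Longrightarrow> R \<in> sets borel \<Longrightarrow> R \<inter> l -` {j} \<in> sets (borel :: (real^2) measure)"
  using measurable_sets[of l borel "count_space UNIV" "{j}"] by auto

lemma card_split_label:
  fixes l' :: "real^2 \<Rightarrow> nat"
  assumes "finite F" "\<forall>x. l' x < J'"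
  shows "card (F \<inter> A) = (\<Sum>j<J'. card (F \<inter> (A \<inter> l' -` {j})))"
proof -
  have "F \<inter> A = (\<Union>j\<in>{..<J'}. F \<inter> (A \<inter> l' -` {j}))" using assms(2) by auto
  also have "card \<dots> = (\<Sum>j<J'. card (F \<inter> (A \<inter> l' -` {j})))"
    using assms(1) by (intro card_UN_disjoint) auto
  finally show ?thesis .
qed

lemma Int_stable_label_events:
  assumes fin: "\<And>\<omega>. \<omega> \<in> space M \<Longrightarrow> finite (P \<omega>)"
  shows "Int_stable (label_events M P R)"
proof (rule Int_stableI)
  fix E E' assume "E \<in> label_events M P R" "E' \<in> label_events M P R"
  then obtain l J \<Phi> l' J' \<Phi>' where
    E: "E = {\<omega>\<in>space M. (\<lambda>j. card (P \<omega> \<inter> (R \<inter> l -` {j}))) \<in> \<Phi>}" and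
    l: "l \<in> measurable borel (count_space UNIV)" "\<forall>x. l x < (J::nat)" and
    E': "E' = {\<omega>\<in>space M. (\<lambda>j. card (P \<omega> \<inter> (R \<inter> l' -` {j}))) \<in> \<Phi>'}" and
    l': "l' \<in> measurable borel (count_space UNIV)" "\<forall>x. l' x < (J'::nat)"
    unfolding label_events_iff by blast
  \<comment> \<open>The common refinement of the two partitions, labelled by pairs.\<close>
  define L where "L = (\<lambda>x. prod_encode (l x, l' x))"
  define N where "N = Suc (Max (prod_encode ` ({..<J} \<times> {..<J'})))"
  have LN: "L x < N" for x
  proof -
    have "prod_encode (l x, l' x) \<in> prod_encode ` ({..<J} \<times> {..<J'})" using l l' by auto
    then have "prod_encode (l x, l' x) \<le> Max (prod_encode ` ({..<J} \<times> {..<J'}))"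
      by (intro Max_ge) auto
    then show ?thesis by (simp add: N_def L_def)
  qed
  have Lm: "L \<in> measurable borel (count_space UNIV)"
    unfolding L_def using l(1) l'(1) by measurable
  have pre: "L -` {prod_encode (j, j')} = l -` {j} \<inter> l' -` {j'}" for j j' by (auto simp: L_def)
  define \<Psi> where "\<Psi> = {n. (\<lambda>j. \<Sum>j'<J'. n (prod_encode (j, j'))) \<in> \<Phi> \<and> (\<lambda>j'. \<Sum>j<J. n (prod_encode (j, j'))) \<in> \<Phi>'}"
  have "E \<inter> E' = {\<omega>\<in>space M. (\<lambda>q. card (P \<omega> \<inter> (R \<inter> L -` {q}))) \<in> \<Psi>}"
  proof -
    have "card (P \<omega> \<inter> (R \<inter> l -` {j})) = (\<Sum>j'<J'. card (P \<omega> \<inter> (R \<inter> L -` {prod_encode (j, j')})))"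
      "card (P \<omega> \<inter> (R \<inter> l' -` {j})) = (\<Sum>j'<J. card (P \<omega> \<inter> (R \<inter> L -` {prod_encode (j', j)})))"
      if "\<omega> \<in> space M" for \<omega> j
      unfolding pre card_split_label[OF fin[OF that] l'(2), of "R \<inter> l -` {j}"]
        card_split_label[OF fin[OF that] l(2), of "R \<inter> l' -` {j}"]
      by (auto intro!: sum.cong arg_cong[where f=card])
    then show ?thesis unfolding E E' \<Psi>_def by auto
  qed
  then show "E \<inter> E' \<in> label_events M P R"
    unfolding label_events_iff using Lm LN by blast
qed

text \<open>The parts of all partitions are pairwise disjoint, so all the counts are jointly independent; grouping them by
regions keeps independence.\<close>

lemma indep_sets_label_events:
  fixes R :: "nat \<Rightarrow> (real^2) set"
  assumes P: "poisson_point_process M S lam P"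
    and R: "\<And>i. i \<in> I \<Longrightarrow> R i \<in> sets borel" and dis: "disjoint_family_on R I"
  shows "prob_space.indep_sets M (\<lambda>i. label_events M P (R i)) I"
proof -
  interpret prob_space M using poissonD(1)[OF P] .
  note fin = poissonD(2)[OF P]
  have cm: "(\<lambda>\<omega>. card (P \<omega> \<inter> B)) \<in> measurable M (count_space UNIV)" if "B \<in> sets borel" for B
    using poissonD(4)[OF P] that by (auto simp: counts_measurable_def)
  have both: "E \<in> events" if E: "E \<in> label_events M P (R i)" and i: "i \<in> I" for E i
  proof -
    obtain l J \<Phi> where E: "E = {\<omega>\<in>space M. (\<lambda>j. card (P \<omega> \<inter> (R i \<inter> l -` {j}))) \<in> \<Phi>}" and
      l: "l \<in> measurable borel (count_space UNIV)" "\<forall>x. l x < (J::nat)"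
      using E unfolding label_events_iff by blast
    let ?X = "\<lambda>\<omega>. \<lambda>j\<in>{..<J}. card (P \<omega> \<inter> (R i \<inter> l -` {j}))"
    have X: "?X \<in> measurable M (PiM {..<J} (\<lambda>_. count_space UNIV))"
      by (intro measurable_restrict cm vimage_label_borel l R i)
    have eq: "(\<lambda>j. card (P \<omega> \<inter> (R i \<inter> l -` {j}))) = (\<lambda>j. if j < J then ?X \<omega> j else 0)" for \<omega>
    proof
      fix j show "card (P \<omega> \<inter> (R i \<inter> l -` {j})) = (if j < J then ?X \<omega> j else 0)"
      proof (cases "j < J")
        case False
        then have "l -` {j} = {}" using l(2) by auto
        then show ?thesis using False by simp
      qed simp
    qed
    let ?A = "{g \<in> PiE {..<J} (\<lambda>_. UNIV). (\<lambda>j. if j < J then g j else 0) \<in> \<Phi>}"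
    have "?A \<in> sets (PiM {..<J} (\<lambda>_. count_space (UNIV :: nat set)))"
      by (subst count_space_PiM_finite) auto
    from measurable_sets[OF X this] have "?X -` ?A \<inter> space M \<in> events" .
    moreover have "(\<lambda>j. card (P \<omega> \<inter> (R i \<inter> l -` {j}))) \<in> \<Phi> \<longleftrightarrow> ?X \<omega> \<in> ?A" for \<omega>
      unfolding mem_Collect_eq eq[of \<omega>, symmetric] by simp
    then have "E = ?X -` ?A \<inter> space M" unfolding E by blast
    ultimately show "E \<in> events" by simp
  qed
  show ?thesis
  proof (rule indep_setsI)
    fix i assume "i \<in> I" then show "label_events M P (R i) \<subseteq> events" using both by blast
  next
    fix A K assume K: "K \<noteq> {}" "K \<subseteq> I" "finite K" and A: "\<forall>j\<in>K. A j \<in> label_events M P (R j)"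
    have "\<forall>i\<in>K. \<exists>l J \<Phi>. A i = {\<omega>\<in>space M. (\<lambda>j. card (P \<omega> \<inter> (R i \<inter> l -` {j}))) \<in> \<Phi>} \<and>
      l \<in> measurable borel (count_space UNIV) \<and> (\<forall>x. l x < (J::nat))"
      using A unfolding label_events_iff by blast
    from bchoice[OF this] obtain l where "\<forall>i\<in>K. \<exists>J \<Phi>. A i = {\<omega>\<in>space M. (\<lambda>j. card (P \<omega> \<inter> (R i \<inter> l i -` {j}))) \<in> \<Phi>} \<and>
      l i \<in> measurable borel (count_space UNIV) \<and> (\<forall>x. l i x < (J::nat))" ..
    from bchoice[OF this] obtain J where "\<forall>i\<in>K. \<exists>\<Phi>. A i = {\<omega>\<in>space M. (\<lambda>j. card (P \<omega> \<inter> (R i \<inter> l i -` {j}))) \<in> \<Phi>} \<and>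
      l i \<in> measurable borel (count_space UNIV) \<and> (\<forall>x. l i x < (J i::nat))" ..
    from bchoice[OF this] obtain \<Phi> where "\<forall>i\<in>K. A i = {\<omega>\<in>space M. (\<lambda>j. card (P \<omega> \<inter> (R i \<inter> l i -` {j}))) \<in> \<Phi> i} \<and>
      l i \<in> measurable borel (count_space UNIV) \<and> (\<forall>x. l i x < (J i::nat))" ..
    then have h: "\<And>i. i \<in> K \<Longrightarrow> A i = {\<omega>\<in>space M. (\<lambda>j. card (P \<omega> \<inter> (R i \<inter> l i -` {j}))) \<in> \<Phi> i}"
      "\<And>i. i \<in> K \<Longrightarrow> l i \<in> measurable borel (count_space UNIV)" "\<And>i x. i \<in> K \<Longrightarrow> l i x < (J i::nat)"
      by auto
    define Q where "Q = (\<lambda>i. (\<lambda>j. prod_encode (i, j)) ` {..<J i})"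
    define B where "B = (\<lambda>q. R (fst (prod_decode q)) \<inter> l (fst (prod_decode q)) -` {snd (prod_decode q)})"
    have B[simp]: "B (prod_encode (i, j)) = R i \<inter> l i -` {j}" for i j by (simp add: B_def)
    have Bm: "B q \<in> sets borel" if qK: "q \<in> (\<Union>i\<in>K. Q i)" for q
    proof -
      obtain i j where q: "q = prod_encode (i, j)" "i \<in> K" using qK unfolding Q_def by blast
      then have "i \<in> I" using K by blast
      then show ?thesis using vimage_label_borel[OF h(2)[OF q(2)] R, of i j] q by simp
    qed
    have ind: "indep_vars (\<lambda>_. count_space UNIV) (\<lambda>q \<omega>. card (P \<omega> \<inter> B q)) (\<Union>i\<in>K. Q i)"
    proof (rule poissonD(6)[OF P])
      show "finite (\<Union>i\<in>K. Q i)" using K by (auto simp: Q_def)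
      show "disjoint_family_on B (\<Union>i\<in>K. Q i)"
        unfolding disjoint_family_on_def
      proof (intro ballI impI)
        fix q q' assume "q \<in> (\<Union>i\<in>K. Q i)" "q' \<in> (\<Union>i\<in>K. Q i)" "q \<noteq> q'"
        then obtain i j i' j' where q: "q = prod_encode (i, j)" "i \<in> K" "q' = prod_encode (i', j')" "i' \<in> K" "(i, j) \<noteq> (i', j')"
          unfolding Q_def by blast
        show "B q \<inter> B q' = {}"
        proof (cases "i = i'")
          case True then show ?thesis using q by auto
        next
          case False
          then have "R i \<inter> R i' = {}" using dis K q unfolding disjoint_family_on_def by blast
          then show ?thesis using q by auto
        qed
      qed
    qed (rule Bm)
    have ind2: "indep_vars (\<lambda>i. PiM (Q i) (\<lambda>_. count_space UNIV)) (\<lambda>i \<omega>. restrict (\<lambda>q. card (P \<omega> \<inter> B q)) (Q i)) K"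
      by (rule indep_vars_restrict[OF ind]) (auto simp: disjoint_family_on_def Q_def)
    define T where "T = (\<lambda>i. {g \<in> PiE (Q i) (\<lambda>_. UNIV). (\<lambda>j. if j < J i then g (prod_encode (i, j)) else 0) \<in> \<Phi> i})"
    have AT: "A i = (\<lambda>\<omega>. restrict (\<lambda>q. card (P \<omega> \<inter> B q)) (Q i)) -` T i \<inter> space M" if i: "i \<in> K" for i
    proof -
      have "(\<lambda>j. if j < J i then restrict (\<lambda>q. card (P \<omega> \<inter> B q)) (Q i) (prod_encode (i, j)) else 0)
          = (\<lambda>j. card (P \<omega> \<inter> (R i \<inter> l i -` {j})))" for \<omega>
      proof
        fix j
        show "(if j < J i then restrict (\<lambda>q. card (P \<omega> \<inter> B q)) (Q i) (prod_encode (i, j)) else 0)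
          = card (P \<omega> \<inter> (R i \<inter> l i -` {j}))"
        proof (cases "j < J i")
          case True then show ?thesis by (auto simp: Q_def)
        next
          case False
          then have "l i -` {j} = {}" using h(3)[OF i] by auto
          then show ?thesis using False by simp
        qed
      qed
      then show ?thesis unfolding h(1)[OF i] T_def by auto
    qed
    have "prob (\<Inter>i\<in>K. (\<lambda>\<omega>. restrict (\<lambda>q. card (P \<omega> \<inter> B q)) (Q i)) -` T i \<inter> space M)
       = (\<Prod>i\<in>K. prob ((\<lambda>\<omega>. restrict (\<lambda>q. card (P \<omega> \<inter> B q)) (Q i)) -` T i \<inter> space M))"
    proof (rule indep_varsD[OF ind2])
      fix i assume "i \<in> K"
      show "T i \<in> sets (PiM (Q i) (\<lambda>_. count_space UNIV))"
        by (subst count_space_PiM_finite) (auto simp: T_def Q_def)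
    qed (use K in auto)
    then show "prob (\<Inter>j\<in>K. A j) = (\<Prod>j\<in>K. prob (A j))" using AT by simp
  qed
qed

text \<open>The measurability assumption on \<open>\<Phi>\<close> quantifies over all measurable structures for which the counts in
the region are measurable. It is applied to the sigma-algebra generated by the label events of the region.\<close>

lemma poisson_restrictions_indep:
  fixes M :: "'w measure" and R :: "nat \<Rightarrow> (real^2) set" and \<Phi> :: "nat \<Rightarrow> (real^2) set \<Rightarrow> real"
  assumes P: "poisson_point_process M S lam P"
    and R: "\<And>i. i \<in> I \<Longrightarrow> R i \<in> sets borel" and dis: "disjoint_family_on R I"
    and m: "\<And>i (W :: 'w measure). i \<in> I \<Longrightarrow> counts_measurable W (\<lambda>\<omega>. P \<omega> \<inter> R i) \<Longrightarrow>
        (\<lambda>\<omega>. \<Phi> i (P \<omega> \<inter> R i)) \<in> borel_measurable W"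
  shows "prob_space.indep_vars M (\<lambda>_. borel) (\<lambda>i \<omega>. \<Phi> i (P \<omega> \<inter> R i)) I"
proof -
  interpret prob_space M using poissonD(1)[OF P] .
  note fin = poissonD(2)[OF P]
  define W where "W = (\<lambda>i. sigma (space M) (label_events M P (R i)))"
  have sub: "label_events M P (R i) \<subseteq> Pow (space M)" for i by (auto simp: label_events_def)
  have W: "space (W i) = space M" "sets (W i) = sigma_sets (space M) (label_events M P (R i))" for i
    using sub[of i] by (simp_all add: W_def)
  have cmW: "counts_measurable (W i) (\<lambda>\<omega>. P \<omega> \<inter> R i)" for i
    unfolding counts_measurable_def
  proof (intro conjI ballI)
    fix \<omega> assume "\<omega> \<in> space (W i)" then show "finite (P \<omega> \<inter> R i)" using fin W by auto
  next
    fix B :: "(real^2) set" assume B: "B \<in> sets borel"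
    have "(\<lambda>\<omega>. card (P \<omega> \<inter> R i \<inter> B)) -` {k} \<inter> space (W i) \<in> sets (W i)" for k
    proof -
      let ?l = "\<lambda>x. if x \<in> B then 1 else 0 :: nat"
      have "{\<omega> \<in> space M. (\<lambda>j. card (P \<omega> \<inter> (R i \<inter> ?l -` {j}))) \<in> {n. n 1 = k}} \<in> label_events M P (R i)"
        unfolding label_events_iff
      proof (intro exI conjI)
        show "?l \<in> measurable borel (count_space UNIV)" using B by measurable
        show "\<forall>x. ?l x < 2" by auto
      qed (rule refl)
      moreover have "?l -` {1} = B" by auto
      ultimately have "{\<omega> \<in> space M. card (P \<omega> \<inter> (R i \<inter> B)) = k} \<in> label_events M P (R i)" by simp
      then have "{\<omega> \<in> space M. card (P \<omega> \<inter> (R i \<inter> B)) = k} \<in> sets (W i)" unfolding W by (rule sigma_sets.Basic)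
      moreover have "(\<lambda>\<omega>. card (P \<omega> \<inter> R i \<inter> B)) -` {k} \<inter> space (W i) = {\<omega> \<in> space M. card (P \<omega> \<inter> (R i \<inter> B)) = k}"
        by (auto simp: W Int_assoc)
      ultimately show ?thesis by simp
    qed
    then show "(\<lambda>\<omega>. card (P \<omega> \<inter> R i \<inter> B)) \<in> measurable (W i) (count_space UNIV)"
      by (subst measurable_count_space_eq2_countable) auto
  qed
  have ind: "indep_sets (\<lambda>i. label_events M P (R i)) I" by (rule indep_sets_label_events[OF P R dis])
  have ind2: "indep_sets (\<lambda>i. sets (W i)) I"
    unfolding W by (rule indep_sets_sigma[OF ind Int_stable_label_events[OF fin]])
  have sW: "sets (W i) \<subseteq> events" if "i \<in> I" for i using ind2 that unfolding indep_sets_def by blast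
  have mW: "(\<lambda>\<omega>. \<Phi> i (P \<omega> \<inter> R i)) \<in> borel_measurable (W i)" if "i \<in> I" for i
    by (rule m[OF that cmW])
  have vW: "(\<lambda>\<omega>. \<Phi> i (P \<omega> \<inter> R i)) -` A \<inter> space M \<in> sets (W i)" if "i \<in> I" "A \<in> sets borel" for i A
    using measurable_sets[OF mW[OF that(1)] that(2)] by (simp add: W)
  show ?thesis
    unfolding indep_vars_def2
  proof (intro conjI ballI)
    fix i assume i: "i \<in> I"
    show "random_variable borel (\<lambda>\<omega>. \<Phi> i (P \<omega> \<inter> R i))"
      by (rule measurableI) (use vW[OF i] sW[OF i] in auto)
  next
    show "indep_sets (\<lambda>i. {(\<lambda>\<omega>. \<Phi> i (P \<omega> \<inter> R i)) -` A \<inter> space M |A. A \<in> sets borel}) I"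
      by (rule indep_sets_mono_sets[OF ind2]) (use vW in auto)
  qed
qed

section \<open>Poisson moments and tuples of distinct points\<close>

lemma nn_integral_poisson_count:
  fixes f :: "nat \<Rightarrow> ennreal"
  assumes P: "poisson_point_process M S lam P" and B: "B \<in> sets borel"
  defines "\<mu> \<equiv> lam * measure lborel (S \<inter> B)"
  shows "(\<integral>\<^sup>+\<omega>. f (card (P \<omega> \<inter> B)) \<partial>M) = (\<Sum>k. f k * ennreal (exp (- \<mu>) * \<mu> ^ k / fact k))"
proof -
  interpret prob_space M using poissonD(1)[OF P] .
  have [measurable]: "(\<lambda>\<omega>. card (P \<omega> \<inter> B)) \<in> measurable M (count_space UNIV)"
    by (rule counts_measurableD(1)[OF poissonD(4)[OF P] B])
  have "(\<integral>\<^sup>+\<omega>. f (card (P \<omega> \<inter> B)) \<partial>M) = (\<integral>\<^sup>+\<omega>. (\<Sum>k. f k * indicator {\<omega>\<in>space M. card (P \<omega> \<inter> B) = k} \<omega>) \<partial>M)"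
  proof (rule nn_integral_cong)
    fix \<omega> assume w: "\<omega> \<in> space M"
    have "(\<Sum>k. f k * indicator {\<omega>\<in>space M. card (P \<omega> \<inter> B) = k} \<omega>)
        = (\<Sum>k\<in>{card (P \<omega> \<inter> B)}. f k * indicator {\<omega>\<in>space M. card (P \<omega> \<inter> B) = k} \<omega>)"
      by (rule suminf_finite) auto
    then show "f (card (P \<omega> \<inter> B)) = (\<Sum>k. f k * indicator {\<omega>\<in>space M. card (P \<omega> \<inter> B) = k} \<omega>)"
      using w by simp
  qed
  also have "\<dots> = (\<Sum>k. \<integral>\<^sup>+\<omega>. f k * indicator {\<omega>\<in>space M. card (P \<omega> \<inter> B) = k} \<omega> \<partial>M)"
    by (rule nn_integral_suminf) measurable
  also have "\<dots> = (\<Sum>k. f k * ennreal (exp (- \<mu>) * \<mu> ^ k / fact k))"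
    by (intro arg_cong[where f=suminf] ext)
      (simp add: nn_integral_cmult_indicator emeasure_eq_measure poissonD(5)[OF P B] \<mu>_def)
  finally show ?thesis .
qed

lemma poisson_count_mean:
  assumes P: "poisson_point_process M S lam P" and B: "B \<in> sets borel" and lam: "0 \<le> lam"
  shows "(\<integral>\<^sup>+\<omega>. of_nat (card (P \<omega> \<inter> B)) \<partial>M) = ennreal (lam * measure lborel (S \<inter> B))"
proof -
  define \<mu> where "\<mu> = lam * measure lborel (S \<inter> B)"
  have mu: "\<mu> \<ge> 0" using lam by (simp add: \<mu>_def)
  have "(\<lambda>k. exp (- \<mu>) * \<mu> * (\<mu> ^ k / fact k)) sums (exp (- \<mu>) * \<mu> * exp \<mu>)"
    using exp_converges[of \<mu>] by (intro sums_mult) (simp add: divide_inverse mult.commute)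
  moreover have "exp (- \<mu>) * \<mu> * (\<mu> ^ k / fact k) = real (Suc k) * (exp (- \<mu>) * \<mu> ^ Suc k / fact (Suc k))" for k
    by (simp add: divide_simps del: of_nat_Suc)
  moreover have "exp (- \<mu>) * \<mu> * exp \<mu> = \<mu>" by (simp add: exp_minus)
  ultimately have "(\<lambda>k. real (Suc k) * (exp (- \<mu>) * \<mu> ^ Suc k / fact (Suc k))) sums \<mu>"
    by (simp only:)
  then have s: "(\<lambda>k. real k * (exp (- \<mu>) * \<mu> ^ k / fact k)) sums \<mu>"
    by (subst (asm) sums_Suc_iff) simp
  have "(\<integral>\<^sup>+\<omega>. of_nat (card (P \<omega> \<inter> B)) \<partial>M) = (\<Sum>k. of_nat k * ennreal (exp (- \<mu>) * \<mu> ^ k / fact k))"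
    unfolding \<mu>_def by (rule nn_integral_poisson_count[OF P B])
  also have "\<dots> = (\<Sum>k. ennreal (real k * (exp (- \<mu>) * \<mu> ^ k / fact k)))"
  proof (intro arg_cong[where f=suminf] ext)
    fix k
    show "of_nat k * ennreal (exp (- \<mu>) * \<mu> ^ k / fact k) = ennreal (real k * (exp (- \<mu>) * \<mu> ^ k / fact k))"
      unfolding ennreal_of_nat_eq_real_of_nat using mu by (intro ennreal_mult[symmetric]) auto
  qed
  also have "\<dots> = ennreal \<mu>"
    using mu by (intro suminf_ennreal_eq s) simp
  finally show ?thesis by (simp add: \<mu>_def)
qed

text \<open>For mean at most \<open>\<mu> \<le> 1\<close> the event of at least \<open>m\<close> points costs a factor \<open>\<mu>\<^sup>m\<close>, even with an exponential weight.
This is the source of all error bounds.\<close>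

lemma poisson_count_exp_tail:
  assumes P: "poisson_point_process M S lam P" and B: "B \<in> sets borel" and lam: "0 \<le> lam"
    and \<mu>: "lam * measure lborel (S \<inter> B) \<le> \<mu>" "\<mu> \<le> 1"
  shows "(\<integral>\<^sup>+\<omega>. ennreal (of_bool (m \<le> card (P \<omega> \<inter> B)) * exp (a * real (card (P \<omega> \<inter> B)))) \<partial>M)
      \<le> ennreal (\<mu> ^ m * exp (exp a))"
proof -
  define \<nu> where "\<nu> = lam * measure lborel (S \<inter> B)"
  have nu: "0 \<le> \<nu>" "\<nu> \<le> \<mu>" using lam \<mu> by (simp_all add: \<nu>_def)
  have s: "(\<lambda>k. \<mu> ^ m * (exp a ^ k / fact k)) sums (\<mu> ^ m * exp (exp a))"
    using exp_converges[of "exp a"] by (intro sums_mult) (simp add: divide_inverse mult.commute)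
  have "(\<integral>\<^sup>+\<omega>. ennreal (of_bool (m \<le> card (P \<omega> \<inter> B)) * exp (a * real (card (P \<omega> \<inter> B)))) \<partial>M)
    = (\<Sum>k. ennreal (of_bool (m \<le> k) * exp (a * real k)) * ennreal (exp (- \<nu>) * \<nu> ^ k / fact k))"
    unfolding \<nu>_def by (rule nn_integral_poisson_count[OF P B])
  also have "\<dots> \<le> (\<Sum>k. ennreal (\<mu> ^ m * (exp a ^ k / fact k)))"
  proof (intro suminf_le summableI)
    fix k
    have "of_bool (m \<le> k) * exp (a * real k) * (exp (- \<nu>) * \<nu> ^ k / fact k) \<le> \<mu> ^ m * (exp a ^ k / fact k)"
    proof (cases "m \<le> k")
      case True
      have "\<nu> ^ k \<le> \<mu> ^ k" using nu by (intro power_mono) auto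
      also have "\<dots> \<le> \<mu> ^ m" using True nu \<mu> by (intro power_decreasing) auto
      finally have "exp (- \<nu>) * \<nu> ^ k \<le> 1 * \<mu> ^ m" using nu by (intro mult_mono) auto
      then have "(exp a ^ k / fact k) * (exp (- \<nu>) * \<nu> ^ k) \<le> (exp a ^ k / fact k) * \<mu> ^ m"
        by (intro mult_left_mono) auto
      then show ?thesis using True by (simp add: exp_of_nat2_mult[symmetric] mult.commute mult.left_commute)
    next
      case False
      then show ?thesis using nu by simp
    qed
    then show "ennreal (of_bool (m \<le> k) * exp (a * real k)) * ennreal (exp (- \<nu>) * \<nu> ^ k / fact k) \<le> ennreal (\<mu> ^ m * (exp a ^ k / fact k))"
      using nu by (simp add: ennreal_mult[symmetric] ennreal_leI)
  qed
  also have "\<dots> = ennreal (\<mu> ^ m * exp (exp a))"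
    using nu by (intro suminf_ennreal_eq s) simp
  finally show ?thesis .
qed

lemma poisson_count_exp_finite:
  assumes P: "poisson_point_process M S lam P" and B: "B \<in> sets borel" and lam: "0 \<le> lam"
  shows "integrable M (\<lambda>\<omega>. exp (a * real (card (P \<omega> \<inter> B))))"
proof (rule integrableI_bounded)
  have [measurable]: "(\<lambda>\<omega>. card (P \<omega> \<inter> B)) \<in> measurable M (count_space UNIV)"
    by (rule counts_measurableD(1)[OF poissonD(4)[OF P] B])
  show "(\<lambda>\<omega>. exp (a * real (card (P \<omega> \<inter> B)))) \<in> borel_measurable M" by measurable
  define \<nu> where "\<nu> = lam * measure lborel (S \<inter> B)"
  have nu: "0 \<le> \<nu>" using lam by (simp add: \<nu>_def)
  have s: "(\<lambda>k. exp (- \<nu>) * ((exp a * \<nu>) ^ k / fact k)) sums (exp (- \<nu>) * exp (exp a * \<nu>))"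
    using exp_converges[of "exp a * \<nu>"] by (intro sums_mult) (simp add: divide_inverse mult.commute)
  have "(\<integral>\<^sup>+\<omega>. ennreal (exp (a * real (card (P \<omega> \<inter> B)))) \<partial>M)
    = (\<Sum>k. ennreal (exp (a * real k)) * ennreal (exp (- \<nu>) * \<nu> ^ k / fact k))"
    unfolding \<nu>_def by (rule nn_integral_poisson_count[OF P B])
  also have "\<dots> = (\<Sum>k. ennreal (exp (- \<nu>) * ((exp a * \<nu>) ^ k / fact k)))"
    using nu by (simp add: ennreal_mult[symmetric] power_mult_distrib exp_of_nat2_mult[symmetric] mult_ac)
  also have "\<dots> = ennreal (exp (- \<nu>) * exp (exp a * \<nu>))"
    using nu by (intro suminf_ennreal_eq s) simp
  finally show "(\<integral>\<^sup>+\<omega>. ennreal (norm (exp (a * real (card (P \<omega> \<inter> B))))) \<partial>M) < \<infinity>" by simp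
qed

text \<open>An abstract view of the space of \<open>k\<close>-tuples of points of the plane as a Euclidean space \<open>'a\<close> with
coordinate maps \<open>c\<close>; the instances are nested products. It yields the Campbell formula for triples and for
quadruples at once.\<close>

locale point_tuples =
  fixes c :: "nat \<Rightarrow> 'a::euclidean_space \<Rightarrow> real^2" and k :: nat
  assumes cont: "\<And>i. i < k \<Longrightarrow> continuous_on UNIV (c i)"
    and inj: "\<And>x y. (\<And>i. i < k \<Longrightarrow> c i x = c i y) \<Longrightarrow> x = y"
    and surj: "\<And>f. \<exists>x. \<forall>i<k. c i x = f i"
    and nbhd: "\<And>x U. open U \<Longrightarrow> x \<in> U \<Longrightarrow>
       \<exists>V. (\<forall>i<k. open (V i) \<and> c i x \<in> V i) \<and> (\<forall>y. (\<forall>i<k. c i y \<in> V i) \<longrightarrow> y \<in> U)"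
    and vol: "\<And>B. (\<And>i. i < k \<Longrightarrow> B i \<in> sets borel) \<Longrightarrow>
       emeasure lborel {x. \<forall>i<k. c i x \<in> B i} = (\<Prod>i<k. emeasure lborel (B i))"
begin

definition offdiag :: "'a set" where "offdiag = {x. inj_on (\<lambda>i. c i x) {..<k}}"

definition tuples :: "(real^2) set \<Rightarrow> 'a set" where "tuples F = {x\<in>offdiag. \<forall>i<k. c i x \<in> F}"

definition cyl :: "(nat \<Rightarrow> (real^2) set) \<Rightarrow> 'a set" where "cyl B = {x. \<forall>i<k. c i x \<in> B i}"

lemma cyl_borel: "(\<And>i. i < k \<Longrightarrow> B i \<in> sets borel) \<Longrightarrow> cyl B \<in> sets borel"
proof -
  assume B: "\<And>i. i < k \<Longrightarrow> B i \<in> sets borel"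
  have "cyl B = (\<Inter>i\<in>{..<k}. c i -` B i \<inter> space borel) \<inter> UNIV" by (auto simp: cyl_def)
  moreover have "c i -` B i \<inter> space borel \<in> sets borel" if "i < k" for i
    using B[OF that] borel_measurable_continuous_onI[OF cont[OF that]] by (rule measurable_sets[rotated])
  ultimately show ?thesis by (cases "k = 0") auto
qed

text \<open>On a product of pairwise disjoint sets the coordinates are automatically distinct, so the tuples form a full product of finite sets.\<close>

lemma cyl_tuples_bij:
  assumes dis: "disjoint_family_on B {..<k}"
  shows "bij_betw (\<lambda>x. \<lambda>i\<in>{..<k}. c i x) (tuples F \<inter> cyl B) (PiE {..<k} (\<lambda>i. F \<inter> B i))"
  unfolding bij_betw_def
proof
  show "inj_on (\<lambda>x. \<lambda>i\<in>{..<k}. c i x) (tuples F \<inter> cyl B)"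
  proof (rule inj_onI)
    fix x y assume e: "(\<lambda>i\<in>{..<k}. c i x) = (\<lambda>i\<in>{..<k}. c i y)"
    show "x = y"
    proof (rule inj)
      fix i assume "i < k" then show "c i x = c i y" using fun_cong[OF e, of i] by simp
    qed
  qed
  show "(\<lambda>x. \<lambda>i\<in>{..<k}. c i x) ` (tuples F \<inter> cyl B) = PiE {..<k} (\<lambda>i. F \<inter> B i)"
  proof (intro equalityI subsetI)
    fix f assume "f \<in> (\<lambda>x. \<lambda>i\<in>{..<k}. c i x) ` (tuples F \<inter> cyl B)"
    then show "f \<in> PiE {..<k} (\<lambda>i. F \<inter> B i)" by (auto simp: tuples_def cyl_def split: if_splits)
  next
    fix f assume f: "f \<in> PiE {..<k} (\<lambda>i. F \<inter> B i)"
    obtain x where x: "\<forall>i<k. c i x = f i" using surj by blast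
    have fi: "f i \<in> F \<inter> B i" if "i < k" for i using f that by auto
    have "inj_on (\<lambda>i. c i x) {..<k}"
    proof (rule inj_onI)
      fix i j assume ij: "i \<in> {..<k}" "j \<in> {..<k}" "c i x = c j x"
      then have "f i = f j" using x by auto
      then have "f i \<in> B i \<inter> B j" using fi[of i] fi[of j] ij by auto
      then show "i = j" using dis ij unfolding disjoint_family_on_def by blast
    qed
    then have "x \<in> tuples F \<inter> cyl B" using x fi by (auto simp: tuples_def cyl_def offdiag_def)
    moreover have "(\<lambda>i\<in>{..<k}. c i x) = f"
      using x f by (auto simp: restrict_def PiE_def extensional_def)
    ultimately show "f \<in> (\<lambda>x. \<lambda>i\<in>{..<k}. c i x) ` (tuples F \<inter> cyl B)" by blast
  qed
qed

lemma card_tuples_cyl: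
  assumes "disjoint_family_on B {..<k}"
  shows "card (tuples F \<inter> cyl B) = (\<Prod>i<k. card (F \<inter> B i))"
  using bij_betw_same_card[OF cyl_tuples_bij[OF assms]] by (simp add: card_PiE)

lemma finite_tuples: "finite F \<Longrightarrow> finite (tuples F)"
proof -
  assume F: "finite F"
  have "inj_on (\<lambda>x. \<lambda>i\<in>{..<k}. c i x) (tuples F)"
  proof (rule inj_onI)
    fix x y assume e: "(\<lambda>i\<in>{..<k}. c i x) = (\<lambda>i\<in>{..<k}. c i y)"
    show "x = y"
    proof (rule inj)
      fix i assume "i < k" then show "c i x = c i y" using fun_cong[OF e, of i] by simp
    qed
  qed
  moreover have "(\<lambda>x. \<lambda>i\<in>{..<k}. c i x) ` tuples F \<subseteq> PiE {..<k} (\<lambda>_. F)" by (auto simp: tuples_def split: if_splits)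
  moreover have "finite (PiE {..<k} (\<lambda>_. F))" using F by (intro finite_PiE) auto
  ultimately show ?thesis by (rule inj_on_finite)
qed

text \<open>Distinct points have disjoint neighbourhoods from a countable basis; hence products of pairwise disjoint sets generate the Borel sets off the diagonals.\<close>

lemma offdiag_cover:
  assumes "topological_basis \<B>" "open U" "x \<in> U" "x \<in> offdiag"
  shows "\<exists>f\<in>PiE {..<k} (\<lambda>_. \<B>). disjoint_family_on f {..<k} \<and> x \<in> cyl f \<and> cyl f \<subseteq> U"
proof -
  obtain V where V: "\<And>i. i < k \<Longrightarrow> open (V i) \<and> c i x \<in> V i" "\<And>y. (\<forall>i<k. c i y \<in> V i) \<Longrightarrow> y \<in> U"
    using nbhd[OF assms(2,3)] by blast
  \<comment> \<open>The element \<open>1\<close> keeps the set nonempty for tuples of length at most one.\<close>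
  define Ds where "Ds = insert 1 ((\<lambda>(i, j). dist (c i x) (c j x)) ` {(i, j) \<in> {..<k} \<times> {..<k}. i \<noteq> j})"
  have "finite {(i, j) \<in> {..<k} \<times> {..<k}. i \<noteq> j}"
    by (rule finite_subset[of _ "{..<k} \<times> {..<k}"]) auto
  then have fin: "finite Ds" unfolding Ds_def by simp
  have pos: "0 < d" if "d \<in> Ds" for d
    using that assms(4) by (auto simp: Ds_def offdiag_def inj_on_def)
  define \<delta> where "\<delta> = Min Ds / 2"
  have "Ds \<noteq> {}" by (simp add: Ds_def)
  then have dpos: "\<delta> > 0" using pos[OF Min_in[OF fin]] by (simp add: \<delta>_def)
  have sep: "2 * \<delta> \<le> dist (c i x) (c j x)" if "i < k" "j < k" "i \<noteq> j" for i j
  proof -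
    have "dist (c i x) (c j x) \<in> Ds" using that by (auto simp: Ds_def)
    then have "Min Ds \<le> dist (c i x) (c j x)" using fin by simp
    then show ?thesis by (simp add: \<delta>_def)
  qed
  have "\<exists>b. b \<in> \<B> \<and> c i x \<in> b \<and> b \<subseteq> V i \<inter> ball (c i x) \<delta>" if ik: "i < k" for i
  proof -
    have op: "open (V i \<inter> ball (c i x) \<delta>)" "c i x \<in> V i \<inter> ball (c i x) \<delta>"
      using V(1)[OF ik] dpos by auto
    show ?thesis by (rule topological_basisE[OF assms(1) op]) blast
  qed
  then have "\<forall>i\<in>{..<k}. \<exists>b. b \<in> \<B> \<and> c i x \<in> b \<and> b \<subseteq> V i \<inter> ball (c i x) \<delta>" by blast
  from bchoice[OF this] obtain b where "\<forall>i\<in>{..<k}. b i \<in> \<B> \<and> c i x \<in> b i \<and> b i \<subseteq> V i \<inter> ball (c i x) \<delta>" ..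
  then have b: "b i \<in> \<B> \<and> c i x \<in> b i \<and> b i \<subseteq> V i \<inter> ball (c i x) \<delta>" if "i < k" for i
    using that by blast
  define f where "f = restrict b {..<k}"
  have "disjoint_family_on f {..<k}"
    unfolding disjoint_family_on_def
  proof (intro ballI impI)
    fix i j assume ij: "i \<in> {..<k}" "j \<in> {..<k}" "i \<noteq> j"
    show "f i \<inter> f j = {}"
    proof (rule ccontr)
      assume "f i \<inter> f j \<noteq> {}"
      then obtain y where "y \<in> b i" "y \<in> b j" using ij by (auto simp: f_def)
      then have "y \<in> ball (c i x) \<delta>" "y \<in> ball (c j x) \<delta>" using b[of i] b[of j] ij by blast+
      then have "dist (c i x) y < \<delta>" "dist (c j x) y < \<delta>" by simp_all
      then have "dist (c i x) (c j x) < 2 * \<delta>" using dist_triangle2[of "c i x" "c j x" y] by linarith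
      then show False using sep[of i j] ij by auto
    qed
  qed
  moreover have "f \<in> PiE {..<k} (\<lambda>_. \<B>)" using b by (auto simp: f_def)
  moreover have "x \<in> cyl f" using b by (auto simp: cyl_def f_def)
  moreover have "cyl f \<subseteq> U"
  proof
    fix y assume "y \<in> cyl f"
    then have "\<forall>i<k. c i y \<in> b i" by (simp add: cyl_def f_def)
    then have "\<forall>i<k. c i y \<in> V i" using b by blast
    then show "y \<in> U" by (rule V(2))
  qed
  ultimately show ?thesis by blast
qed

lemma open_offdiag: "open offdiag"
proof (subst open_subopen, intro ballI)
  fix x assume x: "x \<in> offdiag"
  obtain \<B> :: "(real^2) set set" where B: "countable \<B>" "topological_basis \<B>" using ex_countable_basis by blast
  obtain f where f: "f \<in> PiE {..<k} (\<lambda>_. \<B>)" "disjoint_family_on f {..<k}" "x \<in> cyl f"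
    using offdiag_cover[OF B(2) open_UNIV UNIV_I x] by blast
  have "open (cyl f)"
  proof -
    have "cyl f = (\<Inter>i\<in>{..<k}. c i -` f i)" by (auto simp: cyl_def)
    moreover have "open (c i -` f i)" if "i < k" for i
      using cont[OF that] f(1) that topological_basis_open[OF B(2)] by (auto simp: continuous_on_open_vimage PiE_iff)
    ultimately show ?thesis by auto
  qed
  moreover have "cyl f \<subseteq> offdiag"
  proof
    fix y assume y: "y \<in> cyl f"
    show "y \<in> offdiag"
      unfolding offdiag_def mem_Collect_eq
    proof (rule inj_onI)
      fix i j assume ij: "i \<in> {..<k}" "j \<in> {..<k}" "c i y = c j y"
      then have "c i y \<in> f i \<inter> f j" using y by (auto simp: cyl_def)
      then show "i = j" using f(2) ij unfolding disjoint_family_on_def by blast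
    qed
  qed
  ultimately show "\<exists>T. open T \<and> x \<in> T \<and> T \<subseteq> offdiag" using f(3) by blast
qed

end

section \<open>The Campbell formula\<close>

context point_tuples
begin

definition tuple_mean :: "'w measure \<Rightarrow> ('w \<Rightarrow> (real^2) set) \<Rightarrow> 'a set \<Rightarrow> ennreal" where
  "tuple_mean M P E = (\<integral>\<^sup>+\<omega>. of_nat (card (tuples (P \<omega>) \<inter> E)) \<partial>M)"

text \<open>Both sides are measures in \<open>E\<close> that live off the diagonals. On a product of pairwise disjoint sets the
left hand side is a product of means by independence. Such products are stable under intersection and generate the Borel sets
off the diagonals, so the two measures agree.\<close>

lemma campbell:
  fixes M :: "'w measure"
  assumes P: "poisson_point_process M S lam P" and lam: "0 \<le> lam"
    and S: "S \<in> sets borel" "emeasure lborel S < \<infinity>"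
    and meas: "\<And>E. E \<in> sets borel \<Longrightarrow> (\<lambda>\<omega>. card (tuples (P \<omega>) \<inter> E)) \<in> measurable M (count_space UNIV)"
    and E: "E \<in> sets borel"
  shows "tuple_mean M P E = ennreal (lam ^ k) * emeasure lborel (E \<inter> offdiag \<inter> cyl (\<lambda>_. S))"
proof -
  interpret prob_space M using poissonD(1)[OF P] .
  note fin = poissonD(2)[OF P]
  define \<mu> where "\<mu> = measure_of UNIV (sets (borel :: 'a measure)) (tuple_mean M P)"
  have ms: "measure_space UNIV (sets (borel :: 'a measure)) (tuple_mean M P)"
    unfolding measure_space_def
  proof (intro conjI)
    show "sigma_algebra UNIV (sets (borel :: 'a measure))" using sets.sigma_algebra_axioms[of "borel :: 'a measure"] by simp
    show "positive (sets (borel :: 'a measure)) (tuple_mean M P)" by (simp add: positive_def tuple_mean_def)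
    show "countably_additive (sets (borel :: 'a measure)) (tuple_mean M P)"
    proof (rule countably_additiveI)
      fix A :: "nat \<Rightarrow> 'a set" assume A: "range A \<subseteq> sets borel" "disjoint_family A"
      have [measurable]: "(\<lambda>\<omega>. card (tuples (P \<omega>) \<inter> A i)) \<in> measurable M (count_space UNIV)" for i
        using A by (intro meas) auto
      have "(\<Sum>i. tuple_mean M P (A i)) = (\<integral>\<^sup>+\<omega>. (\<Sum>i. of_nat (card (tuples (P \<omega>) \<inter> A i))) \<partial>M)"
        unfolding tuple_mean_def by (rule nn_integral_suminf[symmetric]) measurable
      also have "\<dots> = tuple_mean M P (\<Union>i. A i)"
        unfolding tuple_mean_def
      proof (rule nn_integral_cong)
        fix \<omega> assume "\<omega> \<in> space M"
        then have f: "finite (tuples (P \<omega>))" using fin finite_tuples by blast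
        have e: "of_nat (card (tuples (P \<omega>) \<inter> B)) = emeasure (count_space (tuples (P \<omega>))) (tuples (P \<omega>) \<inter> B)" for B :: "'a set"
          using f by (subst emeasure_count_space_finite) auto
        show "(\<Sum>i. of_nat (card (tuples (P \<omega>) \<inter> A i))) = (of_nat (card (tuples (P \<omega>) \<inter> (\<Union>i. A i))) :: ennreal)"
        proof -
          have "(\<Sum>i. emeasure (count_space (tuples (P \<omega>))) (tuples (P \<omega>) \<inter> A i))
            = emeasure (count_space (tuples (P \<omega>))) (\<Union>i. tuples (P \<omega>) \<inter> A i)"
            using A(2) by (intro suminf_emeasure) (auto simp: disjoint_family_on_def)
          also have "(\<Union>i. tuples (P \<omega>) \<inter> A i) = tuples (P \<omega>) \<inter> (\<Union>i. A i)" by auto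
          finally show ?thesis unfolding e .
        qed
      qed
      finally show "(\<Sum>i. tuple_mean M P (A i)) = tuple_mean M P (\<Union>i. A i)" .
    qed
  qed
  have mu_sets: "sets \<mu> = sets borel" "space \<mu> = UNIV"
    unfolding \<mu>_def using sets.sigma_sets_eq[of "borel :: 'a measure"] by simp_all
  have mu_eq: "emeasure \<mu> A = tuple_mean M P A" if "A \<in> sets borel" for A
    using ms that unfolding \<mu>_def by (intro emeasure_measure_of_sigma) (auto simp: measure_space_def)
  define T where "T = cyl (\<lambda>_. S)"
  have T: "T \<in> sets borel" unfolding T_def by (rule cyl_borel) (rule S)
  define \<nu> where "\<nu> = density lborel (\<lambda>x. ennreal (lam ^ k) * indicator T x)"
  have nu_eq: "emeasure \<nu> A = ennreal (lam ^ k) * emeasure lborel (A \<inter> T)" if "A \<in> sets borel" for A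
  proof -
    have "emeasure \<nu> A = (\<integral>\<^sup>+x. ennreal (lam ^ k) * indicator T x * indicator A x \<partial>lborel)"
      unfolding \<nu>_def using that T by (intro emeasure_density) auto
    also have "\<dots> = (\<integral>\<^sup>+x. ennreal (lam ^ k) * indicator (A \<inter> T) x \<partial>lborel)"
      by (intro nn_integral_cong) (auto simp: indicator_def)
    also have "\<dots> = ennreal (lam ^ k) * emeasure lborel (A \<inter> T)"
      using that T by (intro nn_integral_cmult_indicator) auto
    finally show ?thesis .
  qed
  have off: "offdiag \<in> sets borel" using open_offdiag by (rule borel_open)
  let ?G = "{cyl B | B. (\<forall>i<k. B i \<in> sets borel) \<and> disjoint_family_on B {..<k}}"
  have Gb: "A \<in> sets borel" if "A \<in> ?G" for A using that cyl_borel by blast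
  have Goff: "A \<subseteq> offdiag" if A: "A \<in> ?G" for A
  proof
    fix y assume y: "y \<in> A"
    obtain B where B: "A = cyl B" "disjoint_family_on B {..<k}" using A by blast
    show "y \<in> offdiag"
      unfolding offdiag_def mem_Collect_eq
    proof (rule inj_onI)
      fix i j assume ij: "i \<in> {..<k}" "j \<in> {..<k}" "c i y = c j y"
      then have "c i y \<in> B i \<inter> B j" using y B by (auto simp: cyl_def)
      then show "i = j" using B(2) ij unfolding disjoint_family_on_def by blast
    qed
  qed
  have G_eq: "emeasure \<mu> A = emeasure \<nu> A" if A: "A \<in> ?G" for A
  proof -
    obtain B where B: "A = cyl B" "\<And>i. i < k \<Longrightarrow> B i \<in> sets borel" "disjoint_family_on B {..<k}" using A by blast
    have cm[measurable]: "(\<lambda>\<omega>. card (P \<omega> \<inter> B i)) \<in> measurable M (count_space UNIV)" if "i < k" for i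
      by (rule counts_measurableD(1)[OF poissonD(4)[OF P] B(2)[OF that]])
    have "indep_vars (\<lambda>_. count_space UNIV) (\<lambda>i \<omega>. card (P \<omega> \<inter> B i)) {..<k}"
      by (rule poissonD(6)[OF P]) (use B in auto)
    then have ind: "indep_vars (\<lambda>_. borel) (\<lambda>i \<omega>. of_nat (card (P \<omega> \<inter> B i)) :: ennreal) {..<k}"
      by (rule indep_vars_compose2) simp
    have "emeasure \<mu> A = (\<integral>\<^sup>+\<omega>. (\<Prod>i<k. of_nat (card (P \<omega> \<inter> B i))) \<partial>M)"
      using mu_eq[OF Gb[OF A]] unfolding tuple_mean_def B(1) card_tuples_cyl[OF B(3)] by simp
    also have "\<dots> = (\<Prod>i<k. \<integral>\<^sup>+\<omega>. of_nat (card (P \<omega> \<inter> B i)) \<partial>M)"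
      using ind by (intro indep_vars_nn_integral) auto
    also have "\<dots> = (\<Prod>i<k. ennreal lam * emeasure lborel (B i \<inter> S))"
    proof (rule prod.cong[OF refl])
      fix i assume "i \<in> {..<k}"
      then have Bi: "B i \<in> sets borel" using B by auto
      have "emeasure lborel (B i \<inter> S) \<noteq> \<infinity>"
        using emeasure_mono[of "B i \<inter> S" S lborel] S by auto
      then have "emeasure lborel (B i \<inter> S) = ennreal (measure lborel (B i \<inter> S))"
        by (simp add: emeasure_eq_ennreal_measure)
      then show "(\<integral>\<^sup>+\<omega>. of_nat (card (P \<omega> \<inter> B i)) \<partial>M) = ennreal lam * emeasure lborel (B i \<inter> S)"
        using lam unfolding poisson_count_mean[OF P Bi lam] by (simp add: ennreal_mult Int_commute)
    qed
    also have "\<dots> = ennreal (lam ^ k) * (\<Prod>i<k. emeasure lborel (B i \<inter> S))"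
      using lam by (simp add: prod.distrib ennreal_power)
    also have "(\<Prod>i<k. emeasure lborel (B i \<inter> S)) = emeasure lborel {x. \<forall>i<k. c i x \<in> B i \<inter> S}"
      using B S by (intro vol[symmetric]) auto
    also have "{x. \<forall>i<k. c i x \<in> B i \<inter> S} = A \<inter> T" by (auto simp: B(1) cyl_def T_def)
    finally show ?thesis using nu_eq[OF Gb[OF A]] by simp
  qed
  obtain \<B> :: "(real^2) set set" where BB: "countable \<B>" "topological_basis \<B>" using ex_countable_basis by blast
  define \<A> where "\<A> = cyl ` {f \<in> PiE {..<k} (\<lambda>_. \<B>). disjoint_family_on f {..<k}}"
  have AG: "\<A> \<subseteq> ?G"
  proof
    fix A assume "A \<in> \<A>"
    then obtain f where f: "A = cyl f" "f \<in> PiE {..<k} (\<lambda>_. \<B>)" "disjoint_family_on f {..<k}" by (auto simp: \<A>_def)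
    have "\<forall>i<k. f i \<in> sets borel" using f(2) topological_basis_open[OF BB(2)] by (auto simp: PiE_iff)
    then show "A \<in> ?G" using f by blast
  qed
  have Acount: "countable \<A>" unfolding \<A>_def
    by (intro countable_image countable_subset[OF _ countable_PiE[of "{..<k}" "\<lambda>_. \<B>"]]) (use BB in auto)
  have Acov: "U \<inter> offdiag = \<Union>{A\<in>\<A>. A \<subseteq> U}" if "open U" for U
  proof (intro equalityI subsetI)
    fix x assume "x \<in> U \<inter> offdiag"
    then obtain f where "f \<in> PiE {..<k} (\<lambda>_. \<B>)" "disjoint_family_on f {..<k}" "x \<in> cyl f" "cyl f \<subseteq> U"
      using offdiag_cover[OF BB(2) \<open>open U\<close>, of x] by blast
    then show "x \<in> \<Union>{A\<in>\<A>. A \<subseteq> U}" by (auto simp: \<A>_def)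
  next
    fix x assume "x \<in> \<Union>{A\<in>\<A>. A \<subseteq> U}"
    then show "x \<in> U \<inter> offdiag" using AG Goff by blast
  qed
  have AcovUNIV: "\<Union>\<A> = offdiag" using Acov[OF open_UNIV] by simp
  have sig: "sigma_sets offdiag ?G = (\<inter>) offdiag ` sets borel"
  proof (intro equalityI subsetI)
    fix A assume "A \<in> sigma_sets offdiag ?G"
    then show "A \<in> (\<inter>) offdiag ` sets borel"
    proof (induction rule: sigma_sets.induct)
      case (Basic a)
      then show ?case using Gb Goff by (intro image_eqI[of _ _ a]) auto
    next
      case Empty then show ?case by (intro image_eqI[of _ _ "{}"]) auto
    next
      case (Compl a)
      then obtain b where "a = offdiag \<inter> b" "b \<in> sets borel" by auto
      then show ?case using off by (intro image_eqI[of _ _ "- b"]) auto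
    next
      case (Union a)
      then have "\<forall>i. \<exists>b. b \<in> sets borel \<and> a i = offdiag \<inter> b" by blast
      from choice[OF this] obtain b where b: "\<And>i. b i \<in> sets borel" "\<And>i. a i = offdiag \<inter> b i" by blast
      then show ?case by (intro image_eqI[of _ _ "\<Union>i. b i"]) auto
    qed
  next
    fix A assume "A \<in> (\<inter>) offdiag ` sets borel"
    then obtain b where b: "A = offdiag \<inter> b" "b \<in> sigma_sets UNIV {U. open U}" by (auto simp: borel_def)
    interpret s: sigma_algebra offdiag "sigma_sets offdiag ?G"
      using Goff by (intro sigma_algebra_sigma_sets) auto
    from b(2) have "offdiag \<inter> b \<in> sigma_sets offdiag ?G"
    proof (induction rule: sigma_sets.induct)
      case (Basic U)
      then have "offdiag \<inter> U = \<Union>{A\<in>\<A>. A \<subseteq> U}" using Acov[of U] by (simp add: Int_commute)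
      moreover have "\<Union>{A\<in>\<A>. A \<subseteq> U} \<in> sigma_sets offdiag ?G"
        using AG Acount by (intro s.countable_Union countable_subset[OF _ Acount] subsetI sigma_sets.Basic) auto
      ultimately show ?case by simp
    next
      case Empty then show ?case by simp
    next
      case (Compl a)
      have "offdiag \<inter> (UNIV - a) = offdiag - offdiag \<inter> a" by auto
      then show ?case using s.compl_sets[OF Compl.IH] by simp
    next
      case (Union a)
      have "offdiag \<inter> (\<Union>i. a i) = (\<Union>i. offdiag \<inter> a i)" by auto
      moreover have "(\<Union>i. offdiag \<inter> a i) \<in> sigma_sets offdiag ?G" by (rule sigma_sets.Union[OF Union.IH])
      ultimately show ?case by (simp only:)
    qed
    then show "A \<in> sigma_sets offdiag ?G" using b by simp
  qed
  have "restrict_space \<mu> offdiag = restrict_space \<nu> offdiag"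
  proof (rule measure_eqI_generator_eq_countable[where E="?G" and \<Omega>=offdiag and A=\<A>])
    show "Int_stable ?G"
    proof (rule Int_stableI)
      fix a b assume "a \<in> ?G" "b \<in> ?G"
      then obtain B B' where B: "a = cyl B" "\<forall>i<k. B i \<in> sets borel" "disjoint_family_on B {..<k}"
        "b = cyl B'" "\<forall>i<k. B' i \<in> sets borel" "disjoint_family_on B' {..<k}" by blast
      have "a \<inter> b = cyl (\<lambda>i. B i \<inter> B' i)" using B by (auto simp: cyl_def)
      moreover have "disjoint_family_on (\<lambda>i. B i \<inter> B' i) {..<k}" using B unfolding disjoint_family_on_def by blast
      ultimately show "a \<inter> b \<in> ?G" using B by blast
    qed
    show "?G \<subseteq> Pow offdiag" using Goff by blast
    show "sets (restrict_space \<mu> offdiag) = sigma_sets offdiag ?G"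
      using mu_sets by (simp add: sets_restrict_space sig)
    show "sets (restrict_space \<nu> offdiag) = sigma_sets offdiag ?G"
      by (simp add: sets_restrict_space sig \<nu>_def)
    show "emeasure (restrict_space \<mu> offdiag) X = emeasure (restrict_space \<nu> offdiag) X" if X: "X \<in> ?G" for X
    proof -
      have "emeasure (restrict_space \<mu> offdiag) X = emeasure \<mu> X"
        using off mu_sets Goff[OF X] by (intro emeasure_restrict_space) auto
      moreover have "emeasure (restrict_space \<nu> offdiag) X = emeasure \<nu> X"
        using off Goff[OF X] by (intro emeasure_restrict_space) (auto simp: \<nu>_def)
      ultimately show ?thesis using G_eq[OF X] by simp
    qed
    show "\<A> \<subseteq> ?G" by (rule AG)
    show "\<Union>\<A> = offdiag" by (rule AcovUNIV)
    show "countable \<A>" by (rule Acount)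
    show "emeasure (restrict_space \<mu> offdiag) a \<noteq> \<infinity>" if "a \<in> \<A>" for a
    proof -
      have aG: "a \<in> ?G" using AG that by blast
      have Tf: "emeasure lborel T < \<infinity>"
      proof -
        have "emeasure lborel T = (\<Prod>i<k. emeasure lborel S)"
          unfolding T_def cyl_def using S by (intro vol) auto
        then show ?thesis using S(2) by (simp add: ennreal_prod_eq_top less_top power_less_top_ennreal)
      qed
      have "emeasure (restrict_space \<mu> offdiag) a = emeasure \<mu> a"
        using off mu_sets Goff[OF aG] by (intro emeasure_restrict_space) auto
      also have "\<dots> = ennreal (lam ^ k) * emeasure lborel (a \<inter> T)"
        using G_eq[OF aG] nu_eq[OF Gb[OF aG]] by simp
      also have "\<dots> < \<infinity>"
        using Tf emeasure_mono[of "a \<inter> T" T lborel] T by (auto simp: ennreal_mult_less_top)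
      finally show ?thesis by simp
    qed
  qed
  then have "emeasure (restrict_space \<mu> offdiag) (E \<inter> offdiag) = emeasure (restrict_space \<nu> offdiag) (E \<inter> offdiag)" by simp
  moreover have "emeasure (restrict_space \<mu> offdiag) (E \<inter> offdiag) = emeasure \<mu> (E \<inter> offdiag)"
    using off mu_sets by (intro emeasure_restrict_space) auto
  moreover have "emeasure (restrict_space \<nu> offdiag) (E \<inter> offdiag) = emeasure \<nu> (E \<inter> offdiag)"
    using off by (intro emeasure_restrict_space) (auto simp: \<nu>_def)
  moreover have "tuples F \<inter> (E \<inter> offdiag) = tuples F \<inter> E" for F by (auto simp: tuples_def)
  then have "tuple_mean M P (E \<inter> offdiag) = tuple_mean M P E" unfolding tuple_mean_def by simp
  ultimately show ?thesis
    using mu_eq[of "E \<inter> offdiag"] nu_eq[of "E \<inter> offdiag"] E off by (simp add: T_def)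
qed

end

section \<open>Triples and quadruples of points\<close>

definition shift_coord :: "(nat \<Rightarrow> 'a \<Rightarrow> real^2) \<Rightarrow> nat \<Rightarrow> (real^2) \<times> 'a \<Rightarrow> real^2" where
  "shift_coord c i z = (case i of 0 \<Rightarrow> fst z | Suc j \<Rightarrow> c j (snd z))"

lemma all_less_Suc_shift: "(\<forall>i<Suc k. Q i) \<longleftrightarrow> Q 0 \<and> (\<forall>i<k. Q (Suc i))"
  using less_Suc_eq_0_disj by auto

lemma point_tuples_single: "point_tuples (\<lambda>_ x. x) (Suc 0)"
proof
  fix x :: "real^2" and U assume "open U" "x \<in> U"
  then show "\<exists>V. (\<forall>i<Suc 0. open (V i) \<and> x \<in> V i) \<and> (\<forall>y. (\<forall>i<Suc 0. y \<in> V i) \<longrightarrow> y \<in> U)"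
    by (intro exI[of _ "\<lambda>_. U"]) auto
qed (auto simp: all_less_Suc_shift)

text \<open>Adds one point at the front of the tuple.\<close>

lemma point_tuples_shift:
  fixes c :: "nat \<Rightarrow> 'a::euclidean_space \<Rightarrow> real^2"
  assumes "point_tuples c k"
  shows "point_tuples (shift_coord c) (Suc k)"
proof -
  interpret point_tuples c k by fact
  show ?thesis
  proof
    fix i assume "i < Suc k"
    then show "continuous_on UNIV (shift_coord c i)"
      unfolding shift_coord_def using cont
      by (cases i) (auto intro!: continuous_intros continuous_on_compose2[OF cont])
  next
    fix x y assume e: "\<And>i. i < Suc k \<Longrightarrow> shift_coord c i x = shift_coord c i y"
    have "fst x = fst y" using e[of 0] by (simp add: shift_coord_def)
    moreover have "snd x = snd y"
    proof (rule inj)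
      fix i assume "i < k" then show "c i (snd x) = c i (snd y)" using e[of "Suc i"] by (simp add: shift_coord_def)
    qed
    ultimately show "x = y" by (rule prod_eqI)
  next
    fix f :: "nat \<Rightarrow> real^2"
    obtain x where "\<forall>i<k. c i x = f (Suc i)" using surj[of "\<lambda>i. f (Suc i)"] by blast
    then show "\<exists>x. \<forall>i<Suc k. shift_coord c i x = f i"
      by (intro exI[of _ "(f 0, x)"]) (simp add: all_less_Suc_shift shift_coord_def)
  next
    fix x :: "(real^2) \<times> 'a" and U assume U: "open U" "x \<in> U"
    obtain A B where AB: "open A" "open B" "x \<in> A \<times> B" "A \<times> B \<subseteq> U" using open_prod_elim[OF U] by blast
    then obtain V where V: "\<forall>i<k. open (V i) \<and> c i (snd x) \<in> V i" "\<forall>y. (\<forall>i<k. c i y \<in> V i) \<longrightarrow> y \<in> B"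
      using nbhd[of B "snd x"] by auto
    show "\<exists>V. (\<forall>i<Suc k. open (V i) \<and> shift_coord c i x \<in> V i) \<and> (\<forall>y. (\<forall>i<Suc k. shift_coord c i y \<in> V i) \<longrightarrow> y \<in> U)"
    proof (intro exI[of _ "case_nat A V"] conjI allI impI)
      fix y assume "\<forall>i<Suc k. shift_coord c i y \<in> case_nat A V i"
      then have "fst y \<in> A" "\<forall>i<k. c i (snd y) \<in> V i" by (auto simp: all_less_Suc_shift shift_coord_def)
      then have "y \<in> A \<times> B" using V(2) by (simp add: mem_Times_iff)
      then show "y \<in> U" using AB by blast
    next
      fix i assume "i < Suc k"
      then show "open (case_nat A V i)" "shift_coord c i x \<in> case_nat A V i"
        using AB V(1) by (cases i; auto simp: shift_coord_def)+
    qed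
  next
    fix B :: "nat \<Rightarrow> (real^2) set" assume B: "\<And>i. i < Suc k \<Longrightarrow> B i \<in> sets borel"
    have "{x. \<forall>i<Suc k. shift_coord c i x \<in> B i} = B 0 \<times> cyl (\<lambda>i. B (Suc i))"
      by (auto simp: all_less_Suc_shift shift_coord_def cyl_def)
    moreover have "cyl (\<lambda>i. B (Suc i)) \<in> sets borel" using B by (intro cyl_borel) auto
    then have "emeasure (lborel \<Otimes>\<^sub>M lborel) (B 0 \<times> cyl (\<lambda>i. B (Suc i))) = emeasure lborel (B 0) * emeasure lborel (cyl (\<lambda>i. B (Suc i)))"
      using B[of 0] by (intro lborel.emeasure_pair_measure_Times) auto
    moreover have "emeasure lborel (cyl (\<lambda>i. B (Suc i))) = (\<Prod>i<k. emeasure lborel (B (Suc i)))"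
      unfolding cyl_def using B by (intro vol) auto
    ultimately show "emeasure lborel {x. \<forall>i<Suc k. shift_coord c i x \<in> B i} = (\<Prod>i<Suc k. emeasure lborel (B i))"
      by (simp add: lborel_prod prod.lessThan_Suc_shift del: prod.lessThan_Suc)
  qed
qed

abbreviation coord3 :: "nat \<Rightarrow> (real^2) \<times> (real^2) \<times> (real^2) \<Rightarrow> real^2" where
  "coord3 \<equiv> shift_coord (shift_coord (\<lambda>_ x. x))"
abbreviation coord4 :: "nat \<Rightarrow> (real^2) \<times> (real^2) \<times> (real^2) \<times> (real^2) \<Rightarrow> real^2" where
  "coord4 \<equiv> shift_coord (shift_coord (shift_coord (\<lambda>_ x. x)))"

interpretation tri: point_tuples coord3 "Suc (Suc (Suc 0))"
  by (intro point_tuples_shift point_tuples_single)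

interpretation quad: point_tuples coord4 "Suc (Suc (Suc (Suc 0)))"
  by (intro point_tuples_shift point_tuples_single)

lemma inj_on_Suc_shift:
  "inj_on f {..<Suc k} \<longleftrightarrow> inj_on (\<lambda>i. f (Suc i)) {..<k} \<and> (\<forall>i<k. f 0 \<noteq> f (Suc i))"
proof -
  have "{..<Suc k} = insert 0 (Suc ` {..<k})" using lessThan_Suc_eq_insert_0 by simp
  then show ?thesis
    by (auto simp: inj_on_def)
qed

lemma tri_tuples_iff:
  "(a, b, c) \<in> tri.tuples F \<longleftrightarrow> a \<in> F \<and> b \<in> F \<and> c \<in> F \<and> a \<noteq> b \<and> a \<noteq> c \<and> b \<noteq> c"
  unfolding tri.tuples_def tri.offdiag_def mem_Collect_eq
  by (auto simp: inj_on_Suc_shift all_less_Suc_shift shift_coord_def)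

lemma quad_tuples_iff:
  "(a, b, c, d) \<in> quad.tuples F \<longleftrightarrow> a \<in> F \<and> b \<in> F \<and> c \<in> F \<and> d \<in> F \<and> distinct [a, b, c, d]"
  unfolding quad.tuples_def quad.offdiag_def mem_Collect_eq
  by (auto simp: inj_on_Suc_shift all_less_Suc_shift shift_coord_def)

lemma sum3_points_measurable:
  assumes P: "counts_measurable W P"
    and f: "(\<lambda>z. f (fst (fst (fst z))) (snd (fst (fst z))) (snd (fst z)) (snd z)) \<in> borel_measurable (((W \<Otimes>\<^sub>M borel) \<Otimes>\<^sub>M borel) \<Otimes>\<^sub>M borel)"
    and pos: "\<And>w a b c. 0 \<le> (f w a b c :: real)"
  shows "(\<lambda>w. \<Sum>a\<in>P w. \<Sum>b\<in>P w. \<Sum>c\<in>P w. f w a b c) \<in> borel_measurable W"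
proof -
  have 1: "(\<lambda>z. \<Sum>c\<in>P (fst (fst z)). f (fst (fst z)) (snd (fst z)) (snd z) c) \<in> borel_measurable ((W \<Otimes>\<^sub>M borel) \<Otimes>\<^sub>M borel)"
    using sum_points_measurable[OF counts_measurable_fst[OF counts_measurable_fst[OF P]],
        of "\<lambda>z c. f (fst (fst z)) (snd (fst z)) (snd z) c" borel borel] f pos by simp
  have 2: "(\<lambda>z. \<Sum>b\<in>P (fst z). \<Sum>c\<in>P (fst z). f (fst z) (snd z) b c) \<in> borel_measurable (W \<Otimes>\<^sub>M borel)"
    using sum_points_measurable[OF counts_measurable_fst[OF P],
        of "\<lambda>z b. \<Sum>c\<in>P (fst z). f (fst z) (snd z) b c" borel] 1 pos by (simp add: sum_nonneg)
  show ?thesis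
    using sum_points_measurable[OF P, of "\<lambda>w a. \<Sum>b\<in>P w. \<Sum>c\<in>P w. f w a b c"] 2 pos by (simp add: sum_nonneg)
qed

lemma tri_count_measurable:
  assumes P: "counts_measurable W P" and E: "E \<in> sets borel"
  shows "(\<lambda>w. card (tri.tuples (P w) \<inter> E)) \<in> measurable W (count_space UNIV)"
proof -
  define D where "D = E \<inter> tri.offdiag"
  have D: "D \<in> sets borel" unfolding D_def using E borel_open[OF tri.open_offdiag] by blast
  have eq: "real (card (tri.tuples (P w) \<inter> E)) = (\<Sum>a\<in>P w. \<Sum>b\<in>P w. \<Sum>c\<in>P w. indicator D (a, b, c))"
    if w: "w \<in> space W" for w
  proof -
    have f: "finite (P w)" using counts_measurableD(2)[OF P w] .
    have "(\<Sum>a\<in>P w. \<Sum>b\<in>P w. \<Sum>c\<in>P w. indicator D (a, b, c)) = (\<Sum>z\<in>P w \<times> P w \<times> P w. indicator D z :: real)"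
      by (simp add: sum.cartesian_product)
    also have "\<dots> = real (card ((P w \<times> P w \<times> P w) \<inter> D))"
      using f by (simp add: sum.If_cases indicator_def)
    also have "(P w \<times> P w \<times> P w) \<inter> D = tri.tuples (P w) \<inter> E"
      by (auto simp: D_def tri_tuples_iff tri.offdiag_def inj_on_Suc_shift all_less_Suc_shift shift_coord_def)
    finally show ?thesis by simp
  qed
  have "(\<lambda>w. \<Sum>a\<in>P w. \<Sum>b\<in>P w. \<Sum>c\<in>P w. indicator D (a, b, c) :: real) \<in> borel_measurable W"
    using D by (intro sum3_points_measurable[OF P]) auto
  then have r: "(\<lambda>w. real (card (tri.tuples (P w) \<inter> E))) \<in> borel_measurable W"
    by (subst measurable_cong[OF eq]) auto
  have "(\<lambda>x::real. nat \<lfloor>x\<rfloor>) \<in> measurable borel (count_space UNIV)" by measurable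
  from measurable_compose[OF r this] show ?thesis by simp
qed

section \<open>Integrals over acute triangles\<close>

lemma card_orderings:
  assumes "card Y = 3"
  shows "card {(a, b, c). {a, b, c} = Y} = 6"
proof -
  obtain p q r where Y: "Y = {p, q, r}" "p \<noteq> q" "p \<noteq> r" "q \<noteq> r" using assms by (auto simp: card_3_iff)
  have "{(a, b, c). {a, b, c} = Y} = {(p, q, r), (p, r, q), (q, p, r), (q, r, p), (r, p, q), (r, q, p)}" (is "?L = ?R")
  proof (intro equalityI subsetI)
    fix z assume "z \<in> ?L"
    then obtain a b c where z: "z = (a, b, c)" "{a, b, c} = Y" by (cases z) auto
    then have "a \<in> Y" "b \<in> Y" "c \<in> Y" "card {a, b, c} = 3" using assms by auto
    then have "a \<noteq> b" "a \<noteq> c" "b \<noteq> c" by (auto simp: card_insert_if split: if_splits)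
    with \<open>a \<in> Y\<close> \<open>b \<in> Y\<close> \<open>c \<in> Y\<close> show "z \<in> ?R" unfolding z Y by auto
  next
    fix z assume "z \<in> ?R" then show "z \<in> ?L" unfolding Y by auto
  qed
  then show ?thesis using Y by simp
qed

text \<open>Passes between unordered triples, over which the counts run, and ordered ones, over which the Campbell formula integrates: each triple has six orderings.\<close>

lemma card_ordered_triples:
  assumes F: "finite F"
  shows "card (tri.tuples F \<inter> {(a, b, c). \<phi> {a, b, c}}) = 6 * card {Y. Y \<subseteq> F \<and> card Y = 3 \<and> \<phi> Y}"
proof -
  define \<Y> where "\<Y> = {Y. Y \<subseteq> F \<and> card Y = 3 \<and> \<phi> Y}"
  have fin: "finite \<Y>"
  proof (rule finite_subset)
    show "\<Y> \<subseteq> Pow F" by (auto simp: \<Y>_def)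
  qed (use F in simp)
  define fib where "fib = (\<lambda>Y :: (real^2) set. {(a, b, c). {a, b, c} = Y})"
  have "tri.tuples F \<inter> {(a, b, c). \<phi> {a, b, c}} = (\<Union>Y\<in>\<Y>. fib Y)"
  proof (intro equalityI subsetI)
    fix z assume z: "z \<in> tri.tuples F \<inter> {(a, b, c). \<phi> {a, b, c}}"
    obtain a b c where abc: "z = (a, b, c)" by (cases z)
    have "{a, b, c} \<in> \<Y>" using z unfolding abc \<Y>_def by (auto simp: tri_tuples_iff)
    then show "z \<in> (\<Union>Y\<in>\<Y>. fib Y)" unfolding abc fib_def by blast
  next
    fix z assume "z \<in> (\<Union>Y\<in>\<Y>. fib Y)"
    then obtain a b c where abc: "z = (a, b, c)" "{a, b, c} \<in> \<Y>" by (auto simp: fib_def)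
    then have "{a, b, c} \<subseteq> F" "card {a, b, c} = 3" "\<phi> {a, b, c}" by (auto simp: \<Y>_def)
    moreover from this have "a \<noteq> b" "a \<noteq> c" "b \<noteq> c" by (auto simp: card_insert_if split: if_splits)
    ultimately show "z \<in> tri.tuples F \<inter> {(a, b, c). \<phi> {a, b, c}}" unfolding abc by (auto simp: tri_tuples_iff)
  qed
  also have "card \<dots> = (\<Sum>Y\<in>\<Y>. card (fib Y))"
  proof (rule card_UN_disjoint[OF fin])
    show "\<forall>Y\<in>\<Y>. finite (fib Y)"
    proof
      fix Y assume "Y \<in> \<Y>"
      then have "card (fib Y) = 6" unfolding fib_def \<Y>_def by (intro card_orderings) auto
      then show "finite (fib Y)" by (metis card.infinite zero_neq_numeral)
    qed
  qed (auto simp: fib_def)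
  also have "\<dots> = (\<Sum>Y\<in>\<Y>. 6)" unfolding fib_def \<Y>_def by (intro sum.cong refl card_orderings) auto
  finally show ?thesis by (simp add: \<Y>_def)
qed

definition centred_acute :: "real \<Rightarrow> (real^2) set \<Rightarrow> ((real^2) \<times> (real^2) \<times> (real^2)) set" where
  "centred_acute s A = {z. acute s (fst (snd z) - fst z) (snd (snd z) - fst z) \<and>
     fst z + circum_offset (fst (snd z) - fst z) (snd (snd z) - fst z) \<in> A}"

lemma centred_acute_borel:
  assumes [measurable]: "A \<in> sets borel"
  shows "centred_acute s A \<in> sets borel"
proof -
  have "{z \<in> space (borel \<Otimes>\<^sub>M borel \<Otimes>\<^sub>M borel). acute s (fst (snd z) - fst z) (snd (snd z) - fst z) \<and>
     fst z + circum_offset (fst (snd z) - fst z) (snd (snd z) - fst z) \<in> A} \<in> sets (borel \<Otimes>\<^sub>M borel \<Otimes>\<^sub>M borel)"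
    by measurable
  moreover have "{z \<in> space (borel \<Otimes>\<^sub>M borel \<Otimes>\<^sub>M borel). acute s (fst (snd z) - fst z) (snd (snd z) - fst z) \<and>
     fst z + circum_offset (fst (snd z) - fst z) (snd (snd z) - fst z) \<in> A} = centred_acute s A"
    by (auto simp: centred_acute_def space_pair_measure)
  ultimately show ?thesis unfolding borel_prod by (simp only:)
qed

definition acute_pairs :: "real \<Rightarrow> ((real^2) \<times> (real^2)) set" where
  "acute_pairs s = {y. acute s (fst y) (snd y)}"

lemma acute_pairs_borel [measurable]: "acute_pairs s \<in> sets borel"
proof -
  have "{y \<in> space (borel \<Otimes>\<^sub>M borel). acute s (fst y) (snd y)} \<in> sets (borel \<Otimes>\<^sub>M borel)" by measurable
  then show ?thesis unfolding borel_prod by (simp add: acute_pairs_def)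
qed

lemma nn_integral_lborel_shift:
  fixes f :: "'a::euclidean_space \<Rightarrow> ennreal"
  assumes [measurable]: "f \<in> borel_measurable borel"
  shows "(\<integral>\<^sup>+x. f (c + x) \<partial>lborel) = (\<integral>\<^sup>+x. f x \<partial>lborel)"
proof -
  have "(\<integral>\<^sup>+x. f x \<partial>lborel) = (\<integral>\<^sup>+x. f x \<partial>distr lborel borel ((+) c))" by (simp add: lborel_distr_plus)
  also have "\<dots> = (\<integral>\<^sup>+x. f (c + x) \<partial>lborel)" by (rule nn_integral_distr) measurable
  finally show ?thesis ..
qed

text \<open>Substitute \<open>b = a + p\<close> and \<open>c = a + q\<close> and integrate over \<open>a\<close> first: for a fixed shape the position of the
circumcenter runs over \<open>A\<close> with Lebesgue measure. Since triangles are located by their circumcenters there is no boundary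
effect.\<close>

lemma emeasure_centred_acute:
  assumes A[measurable]: "A \<in> sets borel"
  shows "emeasure lborel (centred_acute s A) = emeasure lborel A * emeasure lborel (acute_pairs s)"
proof -
  have D: "centred_acute s A \<in> sets (lborel \<Otimes>\<^sub>M lborel)"
    unfolding lborel_prod using centred_acute_borel[OF A] by simp
  have "emeasure lborel (centred_acute s A) = emeasure (lborel \<Otimes>\<^sub>M lborel) (centred_acute s A)" by (simp add: lborel_prod)
  also have "\<dots> = (\<integral>\<^sup>+a. \<integral>\<^sup>+y. indicator (centred_acute s A) (a, y) \<partial>lborel \<partial>lborel)"
    using D by (rule lborel.emeasure_pair_measure)
  also have "\<dots> = (\<integral>\<^sup>+a. \<integral>\<^sup>+y. indicator (acute_pairs s) y * indicator A (a + circum_offset (fst y) (snd y)) \<partial>lborel \<partial>lborel)"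
  proof (rule nn_integral_cong)
    fix a :: "real^2"
    have [measurable]: "(\<lambda>y. indicator (centred_acute s A) (a, y) :: ennreal) \<in> borel_measurable borel"
      using measurable_Pair2[OF borel_measurable_indicator[OF D], of a] by simp
    have "(\<integral>\<^sup>+y. indicator (centred_acute s A) (a, y) \<partial>lborel) = (\<integral>\<^sup>+y. indicator (centred_acute s A) (a, (a, a) + y) \<partial>lborel)"
      by (rule nn_integral_lborel_shift[symmetric]) measurable
    also have "\<dots> = (\<integral>\<^sup>+y. indicator (acute_pairs s) y * indicator A (a + circum_offset (fst y) (snd y)) \<partial>lborel)"
      by (intro nn_integral_cong) (auto simp: indicator_def centred_acute_def acute_pairs_def)
    finally show "(\<integral>\<^sup>+y. indicator (centred_acute s A) (a, y) \<partial>lborel) = (\<integral>\<^sup>+y. indicator (acute_pairs s) y * indicator A (a + circum_offset (fst y) (snd y)) \<partial>lborel)" .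
  qed
  also have "\<dots> = (\<integral>\<^sup>+y. \<integral>\<^sup>+a. indicator (acute_pairs s) y * indicator A (a + circum_offset (fst y) (snd y)) \<partial>lborel \<partial>lborel)"
  proof (rule lborel_pair.Fubini'[symmetric])
    have "(\<lambda>z. indicator (acute_pairs s) (snd z) * indicator A (fst z + circum_offset (fst (snd z)) (snd (snd z))) :: ennreal)
      \<in> borel_measurable (borel \<Otimes>\<^sub>M (borel \<Otimes>\<^sub>M borel))"
      using acute_pairs_borel[of s, folded borel_prod, measurable] by measurable
    then show "(\<lambda>(a, y). indicator (acute_pairs s) y * indicator A (a + circum_offset (fst y) (snd y)) :: ennreal) \<in> borel_measurable (lborel \<Otimes>\<^sub>M lborel)"
      unfolding borel_prod lborel_prod by (simp add: case_prod_beta')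
  qed
  also have "\<dots> = (\<integral>\<^sup>+y. emeasure lborel A * indicator (acute_pairs s) y \<partial>lborel)"
  proof (rule nn_integral_cong)
    fix y :: "(real^2) \<times> (real^2)"
    have "(\<integral>\<^sup>+a. indicator (acute_pairs s) y * indicator A (a + circum_offset (fst y) (snd y)) \<partial>lborel)
       = indicator (acute_pairs s) y * (\<integral>\<^sup>+a. indicator A (circum_offset (fst y) (snd y) + a) \<partial>lborel)"
      by (subst nn_integral_cmult) (auto simp: add.commute)
    also have "(\<integral>\<^sup>+a. indicator A (circum_offset (fst y) (snd y) + a) \<partial>lborel) = emeasure lborel A"
      by (subst nn_integral_lborel_shift) auto
    finally show "(\<integral>\<^sup>+a. indicator (acute_pairs s) y * indicator A (a + circum_offset (fst y) (snd y)) \<partial>lborel) = emeasure lborel A * indicator (acute_pairs s) y"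
      by (simp add: mult.commute)
  qed
  also have "\<dots> = emeasure lborel A * emeasure lborel (acute_pairs s)"
    by (intro nn_integral_cmult_indicator) auto
  finally show ?thesis .
qed

lemma emeasure_acute_pairs_scale:
  assumes "s > 0"
  shows "emeasure lborel (acute_pairs s) = ennreal (s ^ 4) * emeasure lborel (acute_pairs 1)"
proof -
  have "emeasure lborel (acute_pairs s) = emeasure (density (distr lborel borel (\<lambda>x. 0 + s *\<^sub>R x)) (\<lambda>_. ennreal (\<bar>s\<bar> ^ DIM((real^2) \<times> (real^2))))) (acute_pairs s)"
    using lborel_affine[of s "0 :: (real^2) \<times> (real^2)"] assms by simp
  also have "\<dots> = ennreal (s ^ 4) * emeasure (distr lborel borel (\<lambda>x. s *\<^sub>R x)) (acute_pairs s)"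
    using assms by (simp add: emeasure_density nn_integral_cmult_indicator)
  also have "emeasure (distr lborel borel (\<lambda>x. s *\<^sub>R x)) (acute_pairs s) = emeasure lborel (acute_pairs 1)"
  proof -
    have "(\<lambda>x. s *\<^sub>R x) -` acute_pairs s = acute_pairs 1"
      using acute_scale[OF assms, of 1] by (auto simp: acute_pairs_def)
    then show ?thesis by (subst emeasure_distr) auto
  qed
  finally show ?thesis .
qed

lemma acute_bounded:
  assumes "acute s p q"
  shows "norm p \<le> 2 * s" "norm q \<le> 2 * s"
proof -
  have cr: "cross2 p q \<noteq> 0" and n: "norm (circum_offset p q) \<le> s" using assms by (auto simp: acute_def)
  have *: "norm x \<le> 2 * s" if x: "2 * (circum_offset p q \<bullet> x) = x \<bullet> x" for x
  proof (cases "x = 0")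
    case True
    have "0 \<le> s" using n norm_ge_zero order_trans by blast
    then show ?thesis using True by simp
  next
    case False
    have "norm x * norm x = 2 * (circum_offset p q \<bullet> x)"
      using x by (simp add: power2_norm_eq_inner[symmetric] power2_eq_square)
    also have "\<dots> \<le> 2 * (norm (circum_offset p q) * norm x)" using norm_cauchy_schwarz by simp
    also have "\<dots> \<le> 2 * (s * norm x)" using n by (simp add: mult_right_mono)
    finally have "norm x * norm x \<le> (2 * s) * norm x" by simp
    then show ?thesis using False by simp
  qed
  show "norm p \<le> 2 * s" "norm q \<le> 2 * s" using circum_offset_inner[OF cr] * by blast+
qed

lemma acute_pairs_finite: "emeasure lborel (acute_pairs s) < \<infinity>"
proof -
  have "acute_pairs s \<subseteq> cball 0 (2 * s) \<times> cball 0 (2 * s)"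
    using acute_bounded by (auto simp: acute_pairs_def)
  then have "bounded (acute_pairs s)" by (rule bounded_subset[rotated]) (intro bounded_Times bounded_cball)
  then show ?thesis using emeasure_bounded_finite by auto
qed

definition acute_volume :: real where
  "acute_volume = measure lborel (acute_pairs 1)"

text \<open>Multiplying out the denominators gives a subset of the acute pairs that is defined by strict polynomial
inequalities, hence open. It contains the triangle with vertices \<open>(0,0)\<close>, \<open>(1,0)\<close>, \<open>(1/2,1)\<close>, whose circumradius is \<open>5/8\<close>.\<close>

lemma acute_volume_pos: "0 < acute_volume"
proof -
  define n1 n2 where "n1 = (\<lambda>(p :: real^2) (q :: real^2). (p \<bullet> p) * q $ 2 - (q \<bullet> q) * p $ 2)"
    and "n2 = (\<lambda>(p :: real^2) (q :: real^2). (q \<bullet> q) * p $ 1 - (p \<bullet> p) * q $ 1)"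
  define U where "U = {z. 0 < cross2 (fst z) (snd z)} \<inter>
     {z. 0 < n1 (fst z) (snd z) * snd z $ 2 - n2 (fst z) (snd z) * snd z $ 1} \<inter>
     {z. 0 < fst z $ 1 * n2 (fst z) (snd z) - fst z $ 2 * n1 (fst z) (snd z)} \<inter>
     {z. (n1 (fst z) (snd z) * snd z $ 2 - n2 (fst z) (snd z) * snd z $ 1) +
         (fst z $ 1 * n2 (fst z) (snd z) - fst z $ 2 * n1 (fst z) (snd z)) < 2 * (cross2 (fst z) (snd z))\<^sup>2} \<inter>
     {z. (n1 (fst z) (snd z))\<^sup>2 + (n2 (fst z) (snd z))\<^sup>2 < 4 * (cross2 (fst z) (snd z))\<^sup>2}"
  have op: "open U" unfolding U_def n1_def n2_def cross2_def
    by (intro open_Int open_Collect_less continuous_intros)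
  have sub: "U \<subseteq> acute_pairs 1"
  proof
    fix z assume z: "z \<in> U"
    define p q where "p = fst z" and "q = snd z"
    define D where "D = cross2 p q"
    have D: "D > 0" using z by (auto simp: U_def D_def p_def q_def)
    have cc: "circum_offset p q $ 1 = n1 p q / (2 * D)" "circum_offset p q $ 2 = n2 p q / (2 * D)"
      by (simp_all add: circum_offset_components n1_def n2_def D_def)
    define u v where "u = n1 p q * q $ 2 - n2 p q * q $ 1" and "v = p $ 1 * n2 p q - p $ 2 * n1 p q"
    have h: "0 < u" "0 < v" "u + v < 2 * D\<^sup>2" "(n1 p q)\<^sup>2 + (n2 p q)\<^sup>2 < 4 * D\<^sup>2"
      using z by (auto simp: U_def D_def p_def q_def u_def v_def)
    have b: "cross2 (circum_offset p q) q = u / (2 * D)" "cross2 p (circum_offset p q) = v / (2 * D)"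
      unfolding cross2_def cc u_def v_def by (simp_all add: diff_divide_distrib)
    have "(u + v) / (2 * D\<^sup>2) < 1" using h D by (simp add: divide_less_eq)
    then have "u / (2 * D) / D + v / (2 * D) / D < 1" by (simp add: power2_eq_square add_divide_distrib mult.assoc)
    moreover have "norm (circum_offset p q) \<le> 1"
    proof -
      have "(norm (circum_offset p q))\<^sup>2 = ((n1 p q)\<^sup>2 + (n2 p q)\<^sup>2) / (4 * D\<^sup>2)"
        unfolding power2_norm_eq_inner inner2 cc by (simp add: power2_eq_square add_divide_distrib)
      also have "\<dots> \<le> 1" using h(4) D by (simp add: divide_le_eq)
      finally have "(norm (circum_offset p q))\<^sup>2 \<le> 1\<^sup>2" by simp
      then show ?thesis by (rule power2_le_imp_le) simp
    qed
    ultimately have "acute 1 p q" unfolding acute_def D_def[symmetric] b using D h(1,2) by simp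
    then show "z \<in> acute_pairs 1" by (simp add: acute_pairs_def p_def q_def)
  qed
  define z0 :: "(real^2) \<times> (real^2)" where "z0 = (vector [1, 0], vector [1/2, 1])"
  have "z0 \<in> U" unfolding U_def n1_def n2_def cross2_def inner2 z0_def by (simp add: power2_eq_square)
  then obtain e where e: "e > 0" "ball z0 e \<subseteq> U" using op open_contains_ball by blast
  have "0 < measure lborel (ball z0 e)" using e(1) by (simp add: content_ball_pos)
  also have "\<dots> \<le> acute_volume"
    unfolding acute_volume_def
    using e(2) sub acute_pairs_finite[of 1] by (intro measure_mono_fmeasurable) (auto simp: fmeasurable_def)
  finally show ?thesis .
qed

lemma measure_acute_pairs:
  assumes "s > 0"
  shows "measure lborel (acute_pairs s) = s ^ 4 * acute_volume"
  using emeasure_acute_pairs_scale[OF assms] assms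
  by (simp add: measure_def acute_volume_def enn2real_mult)

section \<open>Critical triples of a Poisson process\<close>

definition triples_in :: "real \<Rightarrow> (real^2) set \<Rightarrow> (real^2) set \<Rightarrow> (real^2) set set" where
  "triples_in s A F = {Y. Y \<subseteq> F \<and> card Y = 3 \<and> morse_cond s Y \<and> circumcenter Y \<in> A}"

definition critical_in :: "real \<Rightarrow> (real^2) set \<Rightarrow> (real^2) set \<Rightarrow> (real^2) set set" where
  "critical_in s A F = {Y. Y \<subseteq> F \<and> card Y = 3 \<and> morse_cond s Y \<and> circumcenter Y \<in> A \<and> circumdisk Y \<inter> F = {}}"

lemma critical_in_subset: "critical_in s A F \<subseteq> triples_in s A F" "critical_in s A F \<subseteq> critical s F"
  by (auto simp: critical_in_def triples_in_def critical_def)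

lemma finite_triples_in: "finite F \<Longrightarrow> finite (triples_in s A F)"
  by (rule finite_subset[of _ "Pow F"]) (auto simp: triples_in_def)

lemma finite_critical_in: "finite F \<Longrightarrow> finite (critical_in s A F)"
  using finite_subset[OF critical_in_subset(1)] finite_triples_in by blast

lemma morse_circumcenter:
  assumes "morse_cond s {a, b, c}"
  shows "circumcenter {a, b, c} = a + circum_offset (b - a) (c - a)"
    "circumradius {a, b, c} = norm (circum_offset (b - a) (c - a))"
  using assms circumcenter_eq[of b a c] unfolding morse_cond_iff acute_def by auto

lemma circumdisk_radius:
  assumes "morse_cond s Y" "card Y = 3"
  shows "circumradius Y \<le> s" "0 \<le> circumradius Y" "y \<in> Y \<Longrightarrow> dist (circumcenter Y) y = circumradius Y"
proof -
  show "circumradius Y \<le> s" using assms by (simp add: morse_cond_def)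
  obtain a b c where Y: "Y = {a, b, c}" using assms(2) by (auto simp: card_3_iff)
  note cc = morse_circumcenter[OF assms(1)[unfolded Y]]
  show "0 \<le> circumradius Y" unfolding Y cc by simp
  have cr: "cross2 (b - a) (c - a) \<noteq> 0" using assms(1) unfolding Y morse_cond_iff by (auto simp: acute_def)
  show "dist (circumcenter Y) y = circumradius Y" if "y \<in> Y"
  proof -
    have "dist (a + circum_offset (b - a) (c - a)) (a + (b - a)) = dist (a + circum_offset (b - a) (c - a)) a"
      "dist (a + circum_offset (b - a) (c - a)) (a + (c - a)) = dist (a + circum_offset (b - a) (c - a)) a"
      unfolding equidistant_iff by (rule circum_offset_inner[OF cr])+
    then show ?thesis using that unfolding Y cc by (auto simp: dist_norm)
  qed
qed

lemma card_triples_in: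
  assumes "finite F"
  shows "card (tri.tuples F \<inter> centred_acute s A) = 6 * card (triples_in s A F)"
proof -
  have "centred_acute s A = {(a, b, c). morse_cond s {a, b, c} \<and> circumcenter {a, b, c} \<in> A}"
    using morse_circumcenter by (auto simp: centred_acute_def morse_cond_iff)
  then show ?thesis
    using card_ordered_triples[OF assms, of "\<lambda>Y. morse_cond s Y \<and> circumcenter Y \<in> A"] by (simp add: triples_in_def)
qed

lemma triples_in_measurable:
  assumes P: "counts_measurable W P" and A: "A \<in> sets borel"
  shows "(\<lambda>w. real (card (triples_in s A (P w)))) \<in> borel_measurable W"
proof -
  have [measurable]: "(\<lambda>w. card (tri.tuples (P w) \<inter> centred_acute s A)) \<in> measurable W (count_space UNIV)"
    by (rule tri_count_measurable[OF P centred_acute_borel[OF A]])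
  have "(\<lambda>w. real (card (tri.tuples (P w) \<inter> centred_acute s A)) / 6) \<in> borel_measurable W" by measurable
  then show ?thesis
    by (rule measurable_cong[THEN iffD1, rotated]) (simp add: card_triples_in counts_measurableD(2)[OF P])
qed

lemma critical_in_measurable:
  fixes W :: "'a measure"
  assumes P: "counts_measurable W P" and A[measurable]: "A \<in> sets borel"
  shows "(\<lambda>w. real (card (critical_in s A (P w)))) \<in> borel_measurable W"
proof -
  define g where "g = (\<lambda>w a b c. \<Sum>v\<in>P w. of_bool (dist (a + circum_offset (b - a) (c - a)) v < norm (circum_offset (b - a) (c - a))) :: real)"
  define f where "f = (\<lambda>w a b c. of_bool (acute s (b - a) (c - a) \<and> a + circum_offset (b - a) (c - a) \<in> A \<and> g w a b c = 0) :: real)"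
  have [measurable]: "(\<lambda>z. g (fst (fst (fst z))) (snd (fst (fst z))) (snd (fst z)) (snd z)) \<in> borel_measurable (((W \<Otimes>\<^sub>M borel) \<Otimes>\<^sub>M borel) \<Otimes>\<^sub>M borel)"
  proof -
    define h where "h = (\<lambda>(z :: (('a \<times> (real^2)) \<times> (real^2)) \<times> (real^2)) v. of_bool (dist (snd (fst (fst z)) + circum_offset (snd (fst z) - snd (fst (fst z))) (snd z - snd (fst (fst z)))) v
      < norm (circum_offset (snd (fst z) - snd (fst (fst z))) (snd z - snd (fst (fst z))))) :: real)"
    have "(\<lambda>y. h (fst y) (snd y)) \<in> borel_measurable ((((W \<Otimes>\<^sub>M borel) \<Otimes>\<^sub>M borel) \<Otimes>\<^sub>M borel) \<Otimes>\<^sub>M borel)"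
      unfolding h_def by measurable
    from sum_points_measurable[OF counts_measurable_fst[OF counts_measurable_fst[OF counts_measurable_fst[OF P]]] this]
    show ?thesis unfolding g_def h_def by simp
  qed
  have fm: "(\<lambda>z. f (fst (fst (fst z))) (snd (fst (fst z))) (snd (fst z)) (snd z)) \<in> borel_measurable (((W \<Otimes>\<^sub>M borel) \<Otimes>\<^sub>M borel) \<Otimes>\<^sub>M borel)"
    unfolding f_def by measurable
  have m: "(\<lambda>w. (\<Sum>a\<in>P w. \<Sum>b\<in>P w. \<Sum>c\<in>P w. f w a b c) / 6) \<in> borel_measurable W"
    using sum3_points_measurable[OF P fm] by (intro borel_measurable_divide) (auto simp: f_def)
  have "(\<Sum>a\<in>P w. \<Sum>b\<in>P w. \<Sum>c\<in>P w. f w a b c) / 6 = real (card (critical_in s A (P w)))" if w: "w \<in> space W" for w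
  proof -
    have F: "finite (P w)" by (rule counts_measurableD(2)[OF P w])
    let ?\<phi> = "\<lambda>Y. morse_cond s Y \<and> circumcenter Y \<in> A \<and> circumdisk Y \<inter> P w = {}"
    have g0: "g w a b c = 0 \<longleftrightarrow> ball (a + circum_offset (b - a) (c - a)) (norm (circum_offset (b - a) (c - a))) \<inter> P w = {}" for a b c
      unfolding g_def by (subst sum_nonneg_eq_0_iff[OF F]) auto
    have feq: "f w a b c = of_bool (?\<phi> {a, b, c})" for a b c
    proof (cases "acute s (b - a) (c - a)")
      case True
      then have mc: "morse_cond s {a, b, c}" by (simp add: morse_cond_iff)
      show ?thesis using True mc unfolding f_def g0 circumdisk_def morse_circumcenter[OF mc] by simp
    next
      case False
      then show ?thesis by (simp add: f_def morse_cond_iff)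
    qed
    have "(\<Sum>a\<in>P w. \<Sum>b\<in>P w. \<Sum>c\<in>P w. f w a b c) = (\<Sum>z\<in>P w \<times> P w \<times> P w. case z of (a, b, c) \<Rightarrow> f w a b c)"
      by (simp add: sum.cartesian_product)
    also have "\<dots> = (\<Sum>z\<in>P w \<times> P w \<times> P w. of_bool (z \<in> {(a, b, c). ?\<phi> {a, b, c}}))"
      unfolding feq by (intro sum.cong) auto
    also have "\<dots> = real (card ((P w \<times> P w \<times> P w) \<inter> {(a, b, c). ?\<phi> {a, b, c}}))"
      using F by (subst sum_of_bool_eq) auto
    also have "(P w \<times> P w \<times> P w) \<inter> {(a, b, c). ?\<phi> {a, b, c}} = tri.tuples (P w) \<inter> {(a, b, c). ?\<phi> {a, b, c}}"
      by (auto simp: tri_tuples_iff morse_cond_iff acute_def)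
    also have "real (card \<dots>) = 6 * real (card (critical_in s A (P w)))"
      unfolding card_ordered_triples[OF F, of ?\<phi>] by (simp add: critical_in_def)
    finally show ?thesis by simp
  qed
  then show ?thesis using m by (rule measurable_cong[THEN iffD1])
qed

text \<open>The hypothesis on balls around points of \<open>A\<close> makes every acute triangle with circumcenter in \<open>A\<close> lie in \<open>S\<close>, so the Campbell formula sees the full volume.\<close>

lemma triples_in_mean:
  assumes P: "poisson_point_process M S lam P" and lam: "0 \<le> lam"
    and S: "S \<in> sets borel" "emeasure lborel S < \<infinity>" and A: "A \<in> sets borel"
    and s: "0 < s" and AS: "\<And>a. a \<in> A \<Longrightarrow> cball a s \<subseteq> S"
  shows "integrable M (\<lambda>\<omega>. real (card (triples_in s A (P \<omega>))))"
    and "(\<integral>\<omega>. real (card (triples_in s A (P \<omega>))) \<partial>M) = lam ^ 3 * s ^ 4 * acute_volume * measure lborel A / 6"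
proof -
  note fin = poissonD(2)[OF P]
  note cm = poissonD(4)[OF P]
  have AsubS: "A \<subseteq> S"
  proof
    fix a assume "a \<in> A"
    moreover have "a \<in> cball a s" using s by simp
    ultimately show "a \<in> S" using AS by blast
  qed
  have Afin: "emeasure lborel A \<noteq> \<infinity>" using emeasure_mono[OF AsubS, of lborel] S by auto
  have E: "centred_acute s A \<inter> tri.offdiag \<inter> tri.cyl (\<lambda>_. S) = centred_acute s A"
  proof -
    have "z \<in> tri.offdiag \<and> z \<in> tri.cyl (\<lambda>_. S)" if z: "z \<in> centred_acute s A" for z
    proof -
      obtain a b c where abc: "z = (a, b, c)" by (cases z)
      have ac: "acute s (b - a) (c - a)" and inA: "a + circum_offset (b - a) (c - a) \<in> A"
        using z by (auto simp: centred_acute_def abc)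
      have mc: "morse_cond s {a, b, c}" using ac by (simp add: morse_cond_iff)
      have ne: "a \<noteq> b" "a \<noteq> c" "b \<noteq> c" using ac by (auto simp: acute_def)
      then have c3: "card {a, b, c} = 3" by simp
      have "y \<in> S" if "y \<in> {a, b, c}" for y
      proof -
        have "dist (circumcenter {a, b, c}) y \<le> s"
          using circumdisk_radius[OF mc c3] that by auto
        then have "y \<in> cball (a + circum_offset (b - a) (c - a)) s" using morse_circumcenter[OF mc] by simp
        then show ?thesis using AS[OF inA] by blast
      qed
      then show ?thesis unfolding abc using ne
        by (auto simp: tri.offdiag_def tri.cyl_def inj_on_Suc_shift all_less_Suc_shift shift_coord_def)
    qed
    then show ?thesis by blast
  qed
  have "(\<integral>\<^sup>+\<omega>. of_nat (card (tri.tuples (P \<omega>) \<inter> centred_acute s A)) \<partial>M) = ennreal (lam ^ 3) * emeasure lborel (centred_acute s A)"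
    using tri.campbell[OF P lam S tri_count_measurable[OF cm] centred_acute_borel[OF A, of s]]
    unfolding E tri.tuple_mean_def by (simp add: numeral_3_eq_3)
  also have "\<dots> = ennreal (lam ^ 3) * (ennreal (measure lborel A) * (ennreal (s ^ 4) * ennreal acute_volume))"
    unfolding emeasure_centred_acute[OF A] emeasure_acute_pairs_scale[OF s] acute_volume_def
    using Afin acute_pairs_finite[of 1] by (simp add: emeasure_eq_ennreal_measure)
  also have "\<dots> = ennreal (lam ^ 3 * s ^ 4 * acute_volume * measure lborel A)"
    using lam s acute_volume_pos by (simp add: ennreal_mult[symmetric] mult_ac)
  finally have I: "(\<integral>\<^sup>+\<omega>. of_nat (card (tri.tuples (P \<omega>) \<inter> centred_acute s A)) \<partial>M) = ennreal (lam ^ 3 * s ^ 4 * acute_volume * measure lborel A)" .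
  have tm[measurable]: "(\<lambda>\<omega>. real (card (triples_in s A (P \<omega>)))) \<in> borel_measurable M" by (rule triples_in_measurable[OF cm A])
  have "(\<integral>\<^sup>+\<omega>. ennreal (6 * real (card (triples_in s A (P \<omega>)))) \<partial>M) = (\<integral>\<^sup>+\<omega>. of_nat (card (tri.tuples (P \<omega>) \<inter> centred_acute s A)) \<partial>M)"
    by (intro nn_integral_cong) (simp add: card_triples_in[OF fin] ennreal_of_nat_eq_real_of_nat ennreal_mult)
  with I have I6: "(\<integral>\<^sup>+\<omega>. ennreal (6 * real (card (triples_in s A (P \<omega>)))) \<partial>M) = ennreal (lam ^ 3 * s ^ 4 * acute_volume * measure lborel A)" by simp
  have nn: "0 \<le> lam ^ 3 * s ^ 4 * acute_volume * measure lborel A" using lam s acute_volume_pos by simp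
  have h: "has_bochner_integral M (\<lambda>\<omega>. 6 * real (card (triples_in s A (P \<omega>)))) (lam ^ 3 * s ^ 4 * acute_volume * measure lborel A)"
    by (rule has_bochner_integral_nn_integral) (use I6 nn in auto)
  from has_bochner_integral_mult_right[OF h, of "1 / 6"]
  have h': "has_bochner_integral M (\<lambda>\<omega>. real (card (triples_in s A (P \<omega>)))) (lam ^ 3 * s ^ 4 * acute_volume * measure lborel A / 6)" by simp
  show "integrable M (\<lambda>\<omega>. real (card (triples_in s A (P \<omega>))))" using h' by (rule integrable.intros)
  show "(\<integral>\<omega>. real (card (triples_in s A (P \<omega>))) \<partial>M) = lam ^ 3 * s ^ 4 * acute_volume * measure lborel A / 6"
    using h' by (rule has_bochner_integral_integral_eq)
qed

definition cocircular :: "((real^2) \<times> (real^2) \<times> (real^2) \<times> (real^2)) set" where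
  "cocircular = {(a, b, c, d). cross2 (b - a) (c - a) \<noteq> 0 \<and> dist (a + circum_offset (b - a) (c - a)) d = norm (circum_offset (b - a) (c - a))}"

lemma cocircular_borel: "cocircular \<in> sets borel"
proof -
  have "{z \<in> space (borel \<Otimes>\<^sub>M borel \<Otimes>\<^sub>M borel \<Otimes>\<^sub>M borel). cross2 (fst (snd z) - fst z) (fst (snd (snd z)) - fst z) \<noteq> 0 \<and>
      dist (fst z + circum_offset (fst (snd z) - fst z) (fst (snd (snd z)) - fst z)) (snd (snd (snd z))) = norm (circum_offset (fst (snd z) - fst z) (fst (snd (snd z)) - fst z))}
    \<in> sets (borel \<Otimes>\<^sub>M borel \<Otimes>\<^sub>M borel \<Otimes>\<^sub>M borel)" by measurable
  moreover have "{z \<in> space (borel \<Otimes>\<^sub>M borel \<Otimes>\<^sub>M borel \<Otimes>\<^sub>M borel). cross2 (fst (snd z) - fst z) (fst (snd (snd z)) - fst z) \<noteq> 0 \<and>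
      dist (fst z + circum_offset (fst (snd z) - fst z) (fst (snd (snd z)) - fst z)) (snd (snd (snd z))) = norm (circum_offset (fst (snd z) - fst z) (fst (snd (snd z)) - fst z))}
    = cocircular"
    by (auto simp: cocircular_def space_pair_measure)
  ultimately show ?thesis unfolding borel_prod by (simp only:)
qed

lemma emeasure_lborel_sphere_2: "emeasure lborel (sphere (c :: real^2) r) = 0"
proof -
  have "sphere c r \<in> null_sets lebesgue"
    using negligible_sphere[of c r] by (simp add: negligible_iff_null_sets)
  then show ?thesis by (simp add: null_sets_def)
qed

text \<open>For fixed first three points the fourth is confined to a circle, which is a null set.\<close>

lemma emeasure_cocircular: "emeasure lborel cocircular = 0"
proof -
  have slice: "emeasure lborel X = 0" if X: "X \<in> sets borel" and z: "\<And>a. emeasure lborel (Pair a -` X) = 0"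
    for X :: "((real^2) \<times> 'x::euclidean_space) set"
  proof -
    have X2: "X \<in> sets (lborel \<Otimes>\<^sub>M lborel)" unfolding lborel_prod using X by simp
    have "emeasure lborel X = emeasure (lborel \<Otimes>\<^sub>M lborel) X" unfolding lborel_prod ..
    also have "\<dots> = (\<integral>\<^sup>+a. emeasure lborel (Pair a -` X) \<partial>lborel)" by (rule lborel.emeasure_pair_measure_alt[OF X2])
    also have "\<dots> = 0" using z by simp
    finally show ?thesis .
  qed
  have sec: "Pair a -` X \<in> sets borel" if "X \<in> sets borel" for X :: "((real^2) \<times> 'x::euclidean_space) set" and a
  proof -
    have "X \<in> sets (borel \<Otimes>\<^sub>M borel)" unfolding borel_prod by (rule that)
    from sets_Pair1[OF this] show ?thesis .
  qed
  have s1: "Pair a -` cocircular \<in> sets borel" for a by (rule sec[OF cocircular_borel])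
  have s2: "Pair b -` (Pair a -` cocircular) \<in> sets borel" for a b by (rule sec[OF s1])
  show ?thesis
  proof (rule slice[OF cocircular_borel], rule slice[OF s1], rule slice[OF s2])
    fix a b c
    have "Pair c -` Pair b -` Pair a -` cocircular \<subseteq> sphere (a + circum_offset (b - a) (c - a)) (norm (circum_offset (b - a) (c - a)))"
      by (auto simp: cocircular_def)
    then have "emeasure lborel (Pair c -` Pair b -` Pair a -` cocircular) \<le> emeasure lborel (sphere (a + circum_offset (b - a) (c - a)) (norm (circum_offset (b - a) (c - a))))"
      by (rule emeasure_mono) simp
    then show "emeasure lborel (Pair c -` Pair b -` Pair a -` cocircular) = 0" by (simp add: emeasure_lborel_sphere_2)
  qed
qed

lemma quad_count_measurable:
  assumes P: "counts_measurable W P" and E: "E \<in> sets borel"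
  shows "(\<lambda>w. card (quad.tuples (P w) \<inter> E)) \<in> measurable W (count_space UNIV)"
proof -
  define D where "D = E \<inter> quad.offdiag"
  have D: "D \<in> sets borel" unfolding D_def using E borel_open[OF quad.open_offdiag] by blast
  have eq: "real (card (quad.tuples (P w) \<inter> E)) = (\<Sum>a\<in>P w. \<Sum>b\<in>P w. \<Sum>c\<in>P w. \<Sum>d\<in>P w. indicator D (a, b, c, d))"
    if w: "w \<in> space W" for w
  proof -
    have f: "finite (P w)" using counts_measurableD(2)[OF P w] .
    have "(\<Sum>a\<in>P w. \<Sum>b\<in>P w. \<Sum>c\<in>P w. \<Sum>d\<in>P w. indicator D (a, b, c, d)) = (\<Sum>z\<in>P w \<times> P w \<times> P w \<times> P w. indicator D z :: real)"
      by (simp add: sum.cartesian_product)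
    also have "\<dots> = real (card ((P w \<times> P w \<times> P w \<times> P w) \<inter> D))"
      using f by (simp add: sum.If_cases indicator_def)
    also have "(P w \<times> P w \<times> P w \<times> P w) \<inter> D = quad.tuples (P w) \<inter> E"
      by (auto simp: D_def quad_tuples_iff quad.offdiag_def inj_on_Suc_shift all_less_Suc_shift shift_coord_def)
    finally show ?thesis by simp
  qed
  have Dp: "D \<in> sets (borel \<Otimes>\<^sub>M borel \<Otimes>\<^sub>M borel \<Otimes>\<^sub>M borel)" unfolding borel_prod by (rule D)
  have i: "(\<lambda>z. indicator D (snd (fst (fst (fst z))), snd (fst (fst z)), snd (fst z), snd z) :: real)
    \<in> borel_measurable ((((W \<Otimes>\<^sub>M borel) \<Otimes>\<^sub>M borel) \<Otimes>\<^sub>M borel) \<Otimes>\<^sub>M borel)"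
    using Dp by measurable
  have "(\<lambda>w. \<Sum>a\<in>P w. \<Sum>b\<in>P w. \<Sum>c\<in>P w. \<Sum>d\<in>P w. indicator D (a, b, c, d) :: real) \<in> borel_measurable W"
  proof (rule sum3_points_measurable[OF P])
    show "(\<lambda>z. \<Sum>d\<in>P (fst (fst (fst z))). indicator D (snd (fst (fst z)), snd (fst z), snd z, d) :: real)
      \<in> borel_measurable (((W \<Otimes>\<^sub>M borel) \<Otimes>\<^sub>M borel) \<Otimes>\<^sub>M borel)"
      by (rule sum_points_measurable[OF counts_measurable_fst[OF counts_measurable_fst[OF counts_measurable_fst[OF P]]] i]) simp
  qed (simp add: sum_nonneg)
  then have r: "(\<lambda>w. real (card (quad.tuples (P w) \<inter> E))) \<in> borel_measurable W"
    by (subst measurable_cong[OF eq]) auto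
  have "(\<lambda>x::real. nat \<lfloor>x\<rfloor>) \<in> measurable borel (count_space UNIV)" by measurable
  from measurable_compose[OF r this] show ?thesis by simp
qed

text \<open>By the Campbell formula for quadruples the mean number of cocircular quadruples is zero.\<close>

lemma AE_no_cocircular:
  assumes P: "poisson_point_process M S lam P" and lam: "0 \<le> lam"
    and S: "S \<in> sets borel" "emeasure lborel S < \<infinity>"
  shows "AE \<omega> in M. no_cocircular (P \<omega>)"
proof -
  note fin = poissonD(2)[OF P]
  note cm = poissonD(4)[OF P]
  have [measurable]: "(\<lambda>\<omega>. card (quad.tuples (P \<omega>) \<inter> cocircular)) \<in> measurable M (count_space UNIV)"
    by (rule quad_count_measurable[OF cm cocircular_borel])
  have "emeasure lborel (cocircular \<inter> quad.offdiag \<inter> quad.cyl (\<lambda>_. S)) \<le> emeasure lborel cocircular"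
    using cocircular_borel by (intro emeasure_mono) auto
  then have "(\<integral>\<^sup>+\<omega>. of_nat (card (quad.tuples (P \<omega>) \<inter> cocircular)) \<partial>M) = 0"
    using quad.campbell[OF P lam S quad_count_measurable[OF cm] cocircular_borel]
    by (simp add: emeasure_cocircular quad.tuple_mean_def)
  then have "AE \<omega> in M. (of_nat (card (quad.tuples (P \<omega>) \<inter> cocircular)) :: ennreal) = 0"
    by (subst (asm) nn_integral_0_iff_AE) auto
  with AE_space show ?thesis
  proof eventually_elim
    case (elim \<omega>)
    have "finite (quad.tuples (P \<omega>) \<inter> cocircular)" using fin[OF elim(1)] quad.finite_tuples by auto
    then have emp: "quad.tuples (P \<omega>) \<inter> cocircular = {}" using elim(2) by simp
    show ?case unfolding no_cocircular_def
    proof (intro allI impI ballI)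
      fix Y x assume Y: "Y \<subseteq> P \<omega>" "card Y = 3 \<and> \<not> collinear Y" and x: "x \<in> P \<omega> - Y"
      obtain a b c where abc: "Y = {a, b, c}" "a \<noteq> b" "a \<noteq> c" "b \<noteq> c" using Y by (auto simp: card_3_iff)
      have cr: "cross2 (b - a) (c - a) \<noteq> 0" using Y abc by (simp add: cross2_eq_0_iff_collinear)
      have "(a, b, c, x) \<in> quad.tuples (P \<omega>)" unfolding quad_tuples_iff using Y x abc by auto
      then have "(a, b, c, x) \<notin> cocircular" using emp by blast
      then show "dist (circumcenter Y) x \<noteq> circumradius Y"
        using cr unfolding abc circumcenter_eq[OF cr] by (simp add: cocircular_def)
    qed
  qed
qed

section \<open>Bounds for the log moment generating function\<close>

lemma exp_le_quadratic: "exp x \<le> 1 + x + x\<^sup>2 / 2 * exp \<bar>x\<bar>" for x :: real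
proof -
  obtain t where t: "\<bar>t\<bar> \<le> \<bar>x\<bar>" "exp x = (\<Sum>m<2. x ^ m / fact m) + exp t / fact 2 * x ^ 2"
    using Maclaurin_exp_le[of x 2] by blast
  have "exp t * x\<^sup>2 \<le> exp \<bar>x\<bar> * x\<^sup>2" using t(1) by (intro mult_right_mono) auto
  then show ?thesis using t(2) by (simp add: numeral_2_eq_2 mult.commute)
qed

lemma exp_ge_cubic: "1 + x + x\<^sup>2 / 2 - \<bar>x\<bar> ^ 3 / 6 \<le> exp x" for x :: real
proof -
  obtain t where t: "exp x = (\<Sum>m<4. x ^ m / fact m) + exp t / fact 4 * x ^ 4"
    using Maclaurin_exp_le[of x 4] by blast
  have "(\<Sum>m<4. x ^ m / fact m) = 1 + x + x\<^sup>2 / 2 + x ^ 3 / 6"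
    by (simp add: eval_nat_numeral lessThan_Suc fact_numeral)
  moreover have "0 \<le> exp t / fact 4 * x ^ 4" by simp
  moreover have "- (\<bar>x\<bar> ^ 3) \<le> x ^ 3" by (metis abs_ge_minus_self minus_le_iff power_abs)
  ultimately show ?thesis using t by linarith
qed

text \<open>The log moment generating function at \<open>e\<close> of the centred variable \<open>X - E X\<close>.\<close>

definition lmgf :: "'w measure \<Rightarrow> ('w \<Rightarrow> real) \<Rightarrow> real \<Rightarrow> real" where
  "lmgf M X e = ln (\<integral>\<omega>. exp (e * (X \<omega> - (\<integral>\<omega>. X \<omega> \<partial>M))) \<partial>M)"

lemma (in prob_space) lmgf_shift:
  assumes "integrable M (\<lambda>\<omega>. exp (e * X \<omega>))"
  shows "lmgf M X e = ln (expectation (\<lambda>\<omega>. exp (e * X \<omega>))) - e * expectation X"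
    and "0 < expectation (\<lambda>\<omega>. exp (e * X \<omega>))"
    and "0 < expectation (\<lambda>\<omega>. exp (e * (X \<omega> - expectation X)))"
proof -
  show pos: "0 < expectation (\<lambda>\<omega>. exp (e * X \<omega>))" by (rule expectation_exp_pos[OF assms])
  have "(\<lambda>\<omega>. exp (e * (X \<omega> - expectation X))) = (\<lambda>\<omega>. exp (- (e * expectation X)) * exp (e * X \<omega>))"
    by (auto simp: algebra_simps simp flip: exp_add)
  then have eq: "expectation (\<lambda>\<omega>. exp (e * (X \<omega> - expectation X))) = exp (- (e * expectation X)) * expectation (\<lambda>\<omega>. exp (e * X \<omega>))"
    by simp
  show "lmgf M X e = ln (expectation (\<lambda>\<omega>. exp (e * X \<omega>))) - e * expectation X"
    unfolding lmgf_def eq using pos by (simp add: ln_mult)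
  show "0 < expectation (\<lambda>\<omega>. exp (e * (X \<omega> - expectation X)))" unfolding eq using pos by simp
qed

lemma (in prob_space) lmgf_le:
  assumes e: "integrable M (\<lambda>\<omega>. exp (e * X \<omega>))" and X: "integrable M X"
    and q: "integrable M (\<lambda>\<omega>. (X \<omega>)\<^sup>2 * exp \<bar>e * X \<omega>\<bar>)"
  shows "lmgf M X e \<le> e\<^sup>2 / 2 * expectation (\<lambda>\<omega>. (X \<omega>)\<^sup>2 * exp \<bar>e * X \<omega>\<bar>)"
proof -
  have "expectation (\<lambda>\<omega>. exp (e * X \<omega>)) \<le> expectation (\<lambda>\<omega>. 1 + e * X \<omega> + e\<^sup>2 / 2 * ((X \<omega>)\<^sup>2 * exp \<bar>e * X \<omega>\<bar>))"
  proof (intro integral_mono)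
    fix \<omega> show "exp (e * X \<omega>) \<le> 1 + e * X \<omega> + e\<^sup>2 / 2 * ((X \<omega>)\<^sup>2 * exp \<bar>e * X \<omega>\<bar>)"
      using exp_le_quadratic[of "e * X \<omega>"] by (simp add: power_mult_distrib)
  qed (use assms in auto)
  also have "\<dots> = 1 + e * expectation X + e\<^sup>2 / 2 * expectation (\<lambda>\<omega>. (X \<omega>)\<^sup>2 * exp \<bar>e * X \<omega>\<bar>)"
    using X q by (simp add: prob_space)
  finally show ?thesis
    using lmgf_shift[OF e] ln_le_minus_one[OF lmgf_shift(2)[OF e]] by linarith
qed

text \<open>Uses \<open>ln (1 + a) \<ge> a - 2 a\<^sup>2\<close>; the error \<open>a\<^sup>2\<close> is harmless because \<open>a\<close> will be of the order of the small probability of seeing three points.\<close>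

lemma (in prob_space) lmgf_ge:
  assumes e: "integrable M (\<lambda>\<omega>. exp (e * X \<omega>))" and X: "integrable M X"
    and X2: "integrable M (\<lambda>\<omega>. (X \<omega>)\<^sup>2)" and X3: "integrable M (\<lambda>\<omega>. \<bar>X \<omega>\<bar> ^ 3)"
  defines "a \<equiv> e * expectation X + e\<^sup>2 / 2 * expectation (\<lambda>\<omega>. (X \<omega>)\<^sup>2) - \<bar>e\<bar> ^ 3 / 6 * expectation (\<lambda>\<omega>. \<bar>X \<omega>\<bar> ^ 3)"
  assumes a: "\<bar>a\<bar> \<le> 1 / 2"
  shows "a - e * expectation X - 2 * a\<^sup>2 \<le> lmgf M X e"
proof -
  have "1 + a = expectation (\<lambda>\<omega>. 1 + e * X \<omega> + e\<^sup>2 / 2 * (X \<omega>)\<^sup>2 - \<bar>e\<bar> ^ 3 / 6 * \<bar>X \<omega>\<bar> ^ 3)"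
    using X X2 X3 by (simp add: prob_space a_def)
  also have "\<dots> \<le> expectation (\<lambda>\<omega>. exp (e * X \<omega>))"
  proof (intro integral_mono)
    fix \<omega> show "1 + e * X \<omega> + e\<^sup>2 / 2 * (X \<omega>)\<^sup>2 - \<bar>e\<bar> ^ 3 / 6 * \<bar>X \<omega>\<bar> ^ 3 \<le> exp (e * X \<omega>)"
      using exp_ge_cubic[of "e * X \<omega>"] by (simp add: power_mult_distrib abs_mult)
  qed (use assms in auto)
  finally have "ln (1 + a) \<le> ln (expectation (\<lambda>\<omega>. exp (e * X \<omega>)))"
    using a by (intro ln_mono) auto
  moreover have "a - 2 * a\<^sup>2 \<le> ln (1 + a)" using abs_ln_one_plus_x_minus_x_bound[OF a] by linarith
  ultimately show ?thesis using lmgf_shift(1)[OF e] by linarith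
qed

text \<open>Hoelder's inequality in logarithmic form. After normalising each \<open>exp (G c)\<close> to mean one it is Jensen's inequality for the finite weights \<open>w\<close>.\<close>

lemma (in prob_space) ln_expectation_exp_convex:
  fixes G :: "'c \<Rightarrow> 'a \<Rightarrow> real"
  assumes C: "finite C" and w: "\<And>c. c \<in> C \<Longrightarrow> 0 \<le> w c" "sum w C = 1"
    and int: "\<And>c. c \<in> C \<Longrightarrow> integrable M (\<lambda>\<omega>. exp (G c \<omega>))"
    and int': "integrable M (\<lambda>\<omega>. exp (\<Sum>c\<in>C. w c * G c \<omega>))"
  shows "ln (expectation (\<lambda>\<omega>. exp (\<Sum>c\<in>C. w c * G c \<omega>))) \<le> (\<Sum>c\<in>C. w c * ln (expectation (\<lambda>\<omega>. exp (G c \<omega>))))"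
proof -
  define L where "L = (\<lambda>c. ln (expectation (\<lambda>\<omega>. exp (G c \<omega>))))"
  have Lexp: "exp (L c) = expectation (\<lambda>\<omega>. exp (G c \<omega>))" if "c \<in> C" for c
    unfolding L_def using expectation_exp_pos[OF int[OF that]] by simp
  have pw: "exp (\<Sum>c\<in>C. w c * G c \<omega>) \<le> exp (\<Sum>c\<in>C. w c * L c) * (\<Sum>c\<in>C. w c * exp (G c \<omega> - L c))" for \<omega>
  proof -
    have "exp (\<Sum>c\<in>C. w c * (G c \<omega> - L c)) \<le> (\<Sum>c\<in>C. w c * exp (G c \<omega> - L c))"
      using convex_on_sum[OF C _ exp_convex w(2), of "\<lambda>c. G c \<omega> - L c"] w by (cases "C = {}") auto
    then have "exp (\<Sum>c\<in>C. w c * L c) * exp (\<Sum>c\<in>C. w c * (G c \<omega> - L c)) \<le> exp (\<Sum>c\<in>C. w c * L c) * (\<Sum>c\<in>C. w c * exp (G c \<omega> - L c))"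
      by (intro mult_left_mono) auto
    then show ?thesis by (simp add: sum.distrib[symmetric] algebra_simps flip: exp_add)
  qed
  have i: "integrable M (\<lambda>\<omega>. w c * exp (G c \<omega> - L c))" if "c \<in> C" for c
    using int[OF that] by (simp add: exp_diff)
  have "expectation (\<lambda>\<omega>. exp (\<Sum>c\<in>C. w c * G c \<omega>)) \<le> expectation (\<lambda>\<omega>. exp (\<Sum>c\<in>C. w c * L c) * (\<Sum>c\<in>C. w c * exp (G c \<omega> - L c)))"
    using int' i pw by (intro integral_mono) auto
  also have "\<dots> = exp (\<Sum>c\<in>C. w c * L c) * (\<Sum>c\<in>C. w c * expectation (\<lambda>\<omega>. exp (G c \<omega> - L c)))"
    using i by (simp add: Bochner_Integration.integral_sum)
  also have "(\<Sum>c\<in>C. w c * expectation (\<lambda>\<omega>. exp (G c \<omega> - L c))) = (\<Sum>c\<in>C. w c)"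
  proof (rule sum.cong[OF refl])
    fix c assume c: "c \<in> C"
    have "expectation (\<lambda>\<omega>. exp (G c \<omega> - L c)) = expectation (\<lambda>\<omega>. exp (G c \<omega>)) / exp (L c)" by (simp add: exp_diff)
    also have "\<dots> = 1" using Lexp[OF c, symmetric] by simp
    finally show "w c * expectation (\<lambda>\<omega>. exp (G c \<omega> - L c)) = w c" by simp
  qed
  finally have "expectation (\<lambda>\<omega>. exp (\<Sum>c\<in>C. w c * G c \<omega>)) \<le> exp (\<Sum>c\<in>C. w c * L c)" using w by simp
  then have "ln (expectation (\<lambda>\<omega>. exp (\<Sum>c\<in>C. w c * G c \<omega>))) \<le> ln (exp (\<Sum>c\<in>C. w c * L c))"
    using expectation_exp_pos[OF int'] by (intro ln_mono) auto
  then show ?thesis by (simp add: L_def)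
qed

text \<open>The bound \<open>exp (exp a)\<close> of \<open>poisson_count_exp_tail\<close> at \<open>a = 2\<close>: one unit pays for the exponential weight in the log moment generating function and one for polynomial moments.\<close>

definition tail_const :: real where "tail_const = exp (exp 2)"

lemma tail_const_nonneg [simp]: "0 \<le> tail_const" by (simp add: tail_const_def)

lemma tail_const_ge_1: "1 \<le> tail_const" by (simp add: tail_const_def)

lemma real_power_le_exp: "real n ^ j \<le> fact j * exp (real n)"
proof -
  have "(\<Sum>i\<in>{j}. real n ^ i /\<^sub>R fact i) \<le> (\<Sum>i. real n ^ i /\<^sub>R fact i)"
    by (intro sum_le_suminf summable_exp_generic) auto
  then have "real n ^ j / fact j \<le> exp (real n)"
    by (simp add: exp_def divide_inverse mult.commute)
  then show ?thesis by (simp add: divide_le_eq mult.commute)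
qed

text \<open>A variable that is bounded by a multiple of the number of points in a region with small mean \<open>\<mu>\<close> and that vanishes
when there are fewer than three points. All its moments are then \<open>O(\<mu>\<^sup>3)\<close>.\<close>

locale cluster_var =
  fixes M :: "'w measure" and S :: "(real^2) set" and lam :: real and P :: "'w \<Rightarrow> (real^2) set"
    and R :: "(real^2) set" and \<mu> c :: real and W :: "'w \<Rightarrow> real"
  assumes poi: "poisson_point_process M S lam P" and lam: "0 \<le> lam" and R: "R \<in> sets borel"
    and mu: "lam * measure lborel (S \<inter> R) \<le> \<mu>" "\<mu> \<le> 1"
    and W[measurable]: "W \<in> borel_measurable M" and c: "0 \<le> c"
    and dom: "AE \<omega> in M. \<bar>W \<omega>\<bar> \<le> c * (of_bool (3 \<le> card (P \<omega> \<inter> R)) * real (card (P \<omega> \<inter> R)))"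
begin

sublocale prob_space M using poissonD(1)[OF poi] .

abbreviation X :: "'w \<Rightarrow> nat" where "X \<omega> \<equiv> card (P \<omega> \<inter> R)"

lemma X_meas[measurable]: "X \<in> measurable M (count_space UNIV)"
  by (rule counts_measurableD(1)[OF poissonD(4)[OF poi] R])

lemma mu_nonneg: "0 \<le> \<mu>"
  using lam mu(1) by (meson measure_nonneg mult_nonneg_nonneg order_trans)

lemma tail_integrable: "integrable M (\<lambda>\<omega>. of_bool (m \<le> X \<omega>) * exp (a * real (X \<omega>)))"
  by (rule Bochner_Integration.integrable_bound[OF poisson_count_exp_finite[OF poi R lam, of a]])
    (use measurable_compose[OF X_meas, of "\<lambda>n. of_bool (m \<le> n) * exp (a * real n) :: real" borel] in auto)

lemma tail_expectation:
  assumes "a \<le> 2"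
  shows "expectation (\<lambda>\<omega>. of_bool (m \<le> X \<omega>) * exp (a * real (X \<omega>))) \<le> \<mu> ^ m * tail_const"
proof -
  have "ennreal (expectation (\<lambda>\<omega>. of_bool (m \<le> X \<omega>) * exp (a * real (X \<omega>)))) = (\<integral>\<^sup>+\<omega>. ennreal (of_bool (m \<le> X \<omega>) * exp (a * real (X \<omega>))) \<partial>M)"
    by (rule nn_integral_eq_integral[symmetric, OF tail_integrable]) auto
  also have "\<dots> \<le> ennreal (\<mu> ^ m * exp (exp a))" by (rule poisson_count_exp_tail[OF poi R lam mu])
  finally have "expectation (\<lambda>\<omega>. of_bool (m \<le> X \<omega>) * exp (a * real (X \<omega>))) \<le> \<mu> ^ m * exp (exp a)"
    using mu_nonneg by (simp add: ennreal_le_iff)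
  also have "\<dots> \<le> \<mu> ^ m * tail_const"
    unfolding tail_const_def using assms mu_nonneg by (intro mult_left_mono) auto
  finally show ?thesis .
qed

lemma dominated:
  fixes f :: "'w \<Rightarrow> real"
  assumes f[measurable]: "f \<in> borel_measurable M"
    and d: "AE \<omega> in M. \<bar>f \<omega>\<bar> \<le> C * (of_bool (m \<le> X \<omega>) * exp (2 * real (X \<omega>)))" and C: "0 \<le> C"
  shows "integrable M f" and "\<bar>expectation f\<bar> \<le> C * (\<mu> ^ m * tail_const)"
proof -
  have i: "integrable M (\<lambda>\<omega>. C * (of_bool (m \<le> X \<omega>) * exp (2 * real (X \<omega>))))"
    using tail_integrable by simp
  show fi: "integrable M f"
    by (rule Bochner_Integration.integrable_bound[OF i f]) (use d C in \<open>auto elim!: eventually_mono\<close>)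
  have "\<bar>expectation f\<bar> \<le> expectation (\<lambda>\<omega>. \<bar>f \<omega>\<bar>)" by (rule integral_abs_bound)
  also have "\<dots> \<le> expectation (\<lambda>\<omega>. C * (of_bool (m \<le> X \<omega>) * exp (2 * real (X \<omega>))))"
    using fi i d by (intro integral_mono_AE) auto
  also have "\<dots> \<le> C * (\<mu> ^ m * tail_const)"
    using tail_expectation[of 2 m] C by (simp add: mult_left_mono)
  finally show "\<bar>expectation f\<bar> \<le> C * (\<mu> ^ m * tail_const)" .
qed

lemma exp_integrable: "integrable M (\<lambda>\<omega>. exp (a * W \<omega>))"
proof (rule Bochner_Integration.integrable_bound[OF poisson_count_exp_finite[OF poi R lam, of "\<bar>a\<bar> * c"]])
  show "AE \<omega> in M. norm (exp (a * W \<omega>)) \<le> norm (exp (\<bar>a\<bar> * c * real (X \<omega>)))"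
    using dom
  proof eventually_elim
    case (elim \<omega>)
    have "a * W \<omega> \<le> \<bar>a\<bar> * \<bar>W \<omega>\<bar>" by (metis abs_ge_self abs_mult)
    also have "\<dots> \<le> \<bar>a\<bar> * (c * real (X \<omega>))"
    proof (rule mult_left_mono)
      have "c * (of_bool (3 \<le> X \<omega>) * real (X \<omega>)) \<le> c * real (X \<omega>)" using c by (intro mult_left_mono) auto
      then show "\<bar>W \<omega>\<bar> \<le> c * real (X \<omega>)" using elim by linarith
    qed simp
    finally show ?case by (simp add: mult.assoc)
  qed
qed measurable

lemma moment:
  assumes e: "\<bar>e\<bar> * c \<le> 1" and j: "j \<noteq> 0"
  shows "integrable M (\<lambda>\<omega>. \<bar>W \<omega>\<bar> ^ j * exp \<bar>e * W \<omega>\<bar>)"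
    and "expectation (\<lambda>\<omega>. \<bar>W \<omega>\<bar> ^ j * exp \<bar>e * W \<omega>\<bar>) \<le> c ^ j * fact j * (\<mu> ^ 3 * tail_const)" (is ?B)
proof -
  have d: "AE \<omega> in M. \<bar>\<bar>W \<omega>\<bar> ^ j * exp \<bar>e * W \<omega>\<bar>\<bar> \<le> c ^ j * fact j * (of_bool (3 \<le> X \<omega>) * exp (2 * real (X \<omega>)))"
    using dom
  proof eventually_elim
    case (elim \<omega>)
    show ?case
    proof (cases "3 \<le> X \<omega>")
      case False
      then show ?thesis using elim j by (simp add: power_0_left)
    next
      case True
      then have w: "\<bar>W \<omega>\<bar> \<le> c * real (X \<omega>)" using elim by simp
      have "\<bar>W \<omega>\<bar> ^ j \<le> (c * real (X \<omega>)) ^ j" using w by (intro power_mono) auto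
      also have "\<dots> \<le> c ^ j * (fact j * exp (real (X \<omega>)))"
        unfolding power_mult_distrib using c real_power_le_exp by (intro mult_left_mono) auto
      finally have 1: "\<bar>W \<omega>\<bar> ^ j \<le> c ^ j * (fact j * exp (real (X \<omega>)))" .
      have "\<bar>e * W \<omega>\<bar> \<le> \<bar>e\<bar> * (c * real (X \<omega>))" unfolding abs_mult using w by (intro mult_left_mono) auto
      also have "\<dots> \<le> 1 * real (X \<omega>)" unfolding mult.assoc[symmetric] using e by (intro mult_right_mono) auto
      finally have 2: "exp \<bar>e * W \<omega>\<bar> \<le> exp (real (X \<omega>))" by simp
      have "\<bar>W \<omega>\<bar> ^ j * exp \<bar>e * W \<omega>\<bar> \<le> c ^ j * (fact j * exp (real (X \<omega>))) * exp (real (X \<omega>))"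
        using 1 2 c by (intro mult_mono) auto
      then show ?thesis using True by (simp add: exp_double power2_eq_square mult.assoc abs_mult)
    qed
  qed
  have C: "0 \<le> c ^ j * fact j" using c by simp
  have m: "(\<lambda>\<omega>. \<bar>W \<omega>\<bar> ^ j * exp \<bar>e * W \<omega>\<bar>) \<in> borel_measurable M" by measurable
  show "integrable M (\<lambda>\<omega>. \<bar>W \<omega>\<bar> ^ j * exp \<bar>e * W \<omega>\<bar>)" by (rule dominated(1)[OF m d C])
  show ?B using dominated(2)[OF m d C] by linarith
qed

lemma abs_moment:
  assumes j: "j \<noteq> 0"
  shows "integrable M (\<lambda>\<omega>. \<bar>W \<omega>\<bar> ^ j)" "expectation (\<lambda>\<omega>. \<bar>W \<omega>\<bar> ^ j) \<le> c ^ j * fact j * (\<mu> ^ 3 * tail_const)"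
  using moment[of 0 j] j by simp_all

lemma mean_bound: "integrable M W" "\<bar>expectation W\<bar> \<le> c * (\<mu> ^ 3 * tail_const)"
proof -
  show i: "integrable M W" using abs_moment(1)[of 1] by (simp add: integrable_abs_iff)
  show "\<bar>expectation W\<bar> \<le> c * (\<mu> ^ 3 * tail_const)"
    using abs_moment(2)[of 1] by (intro order_trans[OF integral_abs_bound]) simp
qed

lemma square_integrable: "integrable M (\<lambda>\<omega>. (W \<omega>)\<^sup>2)"
  using abs_moment(1)[of 2] by simp

text \<open>This has the right order in \<open>e\<close> and \<open>\<mu>\<close> and serves for the edge cells, of which there are few.\<close>

lemma lmgf_coarse:
  assumes e: "\<bar>e\<bar> * c \<le> 1"
  shows "lmgf M W e \<le> e\<^sup>2 * c\<^sup>2 * (\<mu> ^ 3 * tail_const)"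
proof -
  have "lmgf M W e \<le> e\<^sup>2 / 2 * expectation (\<lambda>\<omega>. (W \<omega>)\<^sup>2 * exp \<bar>e * W \<omega>\<bar>)"
    using moment(1)[OF e, of 2] by (intro lmgf_le exp_integrable mean_bound) simp_all
  also have "\<dots> \<le> e\<^sup>2 / 2 * (c\<^sup>2 * fact 2 * (\<mu> ^ 3 * tail_const))"
    using moment(2)[OF e, of 2] by (intro mult_left_mono) simp_all
  finally show ?thesis by simp
qed

lemma lmgf_fine_upper:
  assumes e: "\<bar>e\<bar> * c \<le> 1"
  shows "lmgf M W e \<le> e\<^sup>2 / 2 * expectation (\<lambda>\<omega>. (W \<omega>)\<^sup>2) + \<bar>e\<bar> ^ 3 * (3 * c ^ 3 * (\<mu> ^ 3 * tail_const))"
proof -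
  have "expectation (\<lambda>\<omega>. (W \<omega>)\<^sup>2 * exp \<bar>e * W \<omega>\<bar>) \<le> expectation (\<lambda>\<omega>. (W \<omega>)\<^sup>2 + \<bar>e\<bar> * (\<bar>W \<omega>\<bar> ^ 3 * exp \<bar>e * W \<omega>\<bar>))"
  proof (intro integral_mono)
    show "integrable M (\<lambda>\<omega>. (W \<omega>)\<^sup>2 * exp \<bar>e * W \<omega>\<bar>)" using moment(1)[OF e, of 2] by simp
    show "integrable M (\<lambda>\<omega>. (W \<omega>)\<^sup>2 + \<bar>e\<bar> * (\<bar>W \<omega>\<bar> ^ 3 * exp \<bar>e * W \<omega>\<bar>))"
      using moment(1)[OF e, of 3] square_integrable by simp
    fix \<omega>
    define y where "y = \<bar>e * W \<omega>\<bar>"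
    have "1 + - y \<le> exp (- y)" by (rule exp_ge_add_one_self)
    then have "(1 - y) * exp y \<le> exp (- y) * exp y" by (intro mult_right_mono) auto
    then have "exp y \<le> 1 + y * exp y" by (simp add: exp_minus algebra_simps)
    then have "(W \<omega>)\<^sup>2 * exp y \<le> (W \<omega>)\<^sup>2 * (1 + y * exp y)" by (intro mult_left_mono) auto
    also have "\<dots> = (W \<omega>)\<^sup>2 + \<bar>e\<bar> * (\<bar>W \<omega>\<bar> ^ 3 * exp y)"
      by (simp add: y_def abs_mult algebra_simps power3_eq_cube power2_eq_square)
    finally show "(W \<omega>)\<^sup>2 * exp \<bar>e * W \<omega>\<bar> \<le> (W \<omega>)\<^sup>2 + \<bar>e\<bar> * (\<bar>W \<omega>\<bar> ^ 3 * exp \<bar>e * W \<omega>\<bar>)"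
      by (simp add: y_def)
  qed
  also have "\<dots> = expectation (\<lambda>\<omega>. (W \<omega>)\<^sup>2) + \<bar>e\<bar> * expectation (\<lambda>\<omega>. \<bar>W \<omega>\<bar> ^ 3 * exp \<bar>e * W \<omega>\<bar>)"
    using moment(1)[OF e, of 3] square_integrable by simp
  also have "\<dots> \<le> expectation (\<lambda>\<omega>. (W \<omega>)\<^sup>2) + \<bar>e\<bar> * (c ^ 3 * fact 3 * (\<mu> ^ 3 * tail_const))"
    using moment(2)[OF e, of 3] by (intro add_left_mono mult_left_mono) simp_all
  finally have b: "expectation (\<lambda>\<omega>. (W \<omega>)\<^sup>2 * exp \<bar>e * W \<omega>\<bar>) \<le> expectation (\<lambda>\<omega>. (W \<omega>)\<^sup>2) + \<bar>e\<bar> * (c ^ 3 * fact 3 * (\<mu> ^ 3 * tail_const))" .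
  have "lmgf M W e \<le> e\<^sup>2 / 2 * expectation (\<lambda>\<omega>. (W \<omega>)\<^sup>2 * exp \<bar>e * W \<omega>\<bar>)"
    using moment(1)[OF e, of 2] by (intro lmgf_le exp_integrable mean_bound) simp_all
  also have "\<dots> \<le> e\<^sup>2 / 2 * (expectation (\<lambda>\<omega>. (W \<omega>)\<^sup>2) + \<bar>e\<bar> * (c ^ 3 * fact 3 * (\<mu> ^ 3 * tail_const)))"
    using b by (intro mult_left_mono) simp_all
  also have "\<dots> = e\<^sup>2 / 2 * expectation (\<lambda>\<omega>. (W \<omega>)\<^sup>2) + \<bar>e\<bar> ^ 3 * (3 * c ^ 3 * (\<mu> ^ 3 * tail_const))"
    by (simp add: fact_numeral power3_eq_cube power2_eq_square[symmetric] power2_abs algebra_simps)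
  finally show ?thesis .
qed

lemma lmgf_fine_lower:
  assumes e: "\<bar>e\<bar> * c \<le> 1" and small: "6 * (\<mu> ^ 3 * tail_const) \<le> 1"
  shows "e\<^sup>2 / 2 * expectation (\<lambda>\<omega>. (W \<omega>)\<^sup>2) - \<bar>e\<bar> ^ 3 * (c ^ 3 * (\<mu> ^ 3 * tail_const))
      - 18 * e\<^sup>2 * c\<^sup>2 * (\<mu> ^ 3 * tail_const)\<^sup>2 \<le> lmgf M W e"
proof -
  define K where "K = \<mu> ^ 3 * tail_const"
  have K: "0 \<le> K" using mu_nonneg tail_const_ge_1 by (simp add: K_def)
  define y where "y = \<bar>e\<bar> * c"
  have y: "0 \<le> y" "y \<le> 1" using e c by (simp_all add: y_def)
  define q where "q = expectation (\<lambda>\<omega>. (W \<omega>)\<^sup>2)"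
  define t where "t = expectation (\<lambda>\<omega>. \<bar>W \<omega>\<bar> ^ 3)"
  have q: "0 \<le> q" "q \<le> c\<^sup>2 * 2 * K" using abs_moment(2)[of 2] by (simp_all add: q_def K_def)
  have t: "0 \<le> t" "t \<le> c ^ 3 * 6 * K" using abs_moment(2)[of 3] by (simp_all add: t_def K_def fact_numeral)
  define a where "a = e * expectation W + e\<^sup>2 / 2 * q - \<bar>e\<bar> ^ 3 / 6 * t"
  have a1: "\<bar>e * expectation W\<bar> \<le> y * K"
    unfolding abs_mult y_def mult.assoc using mean_bound(2) by (intro mult_left_mono) (simp_all add: K_def)
  have yy: "y ^ j \<le> y" if "j \<noteq> 0" for j
    using y that power_decreasing[of 1 j y] by simp
  have a2: "0 \<le> e\<^sup>2 / 2 * q" "e\<^sup>2 / 2 * q \<le> y * K"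
  proof -
    have "e\<^sup>2 / 2 * q \<le> e\<^sup>2 / 2 * (c\<^sup>2 * 2 * K)" using q by (intro mult_left_mono) auto
    also have "\<dots> = y ^ 2 * K" by (simp add: y_def power_mult_distrib)
    also have "\<dots> \<le> y * K" using yy[of 2] K by (intro mult_right_mono) auto
    finally show "e\<^sup>2 / 2 * q \<le> y * K" .
  qed (use q in simp)
  have a3': "\<bar>e\<bar> ^ 3 / 6 * t \<le> \<bar>e\<bar> ^ 3 * (c ^ 3 * K)"
  proof -
    have "\<bar>e\<bar> ^ 3 / 6 * t \<le> \<bar>e\<bar> ^ 3 / 6 * (c ^ 3 * 6 * K)" using t by (intro mult_left_mono) auto
    then show ?thesis by simp
  qed
  have a3: "0 \<le> \<bar>e\<bar> ^ 3 / 6 * t" "\<bar>e\<bar> ^ 3 / 6 * t \<le> y * K"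
  proof -
    have "\<bar>e\<bar> ^ 3 * (c ^ 3 * K) = y ^ 3 * K" by (simp add: y_def power_mult_distrib)
    also have "\<dots> \<le> y * K" using yy[of 3] K by (intro mult_right_mono) auto
    finally show "\<bar>e\<bar> ^ 3 / 6 * t \<le> y * K" using a3' by linarith
  qed (use t in simp)
  have aa: "\<bar>a\<bar> \<le> 3 * (y * K)" using a1 a2 a3 unfolding a_def by linarith
  have "y * K \<le> 1 * K" using y K by (intro mult_right_mono) auto
  then have half: "\<bar>a\<bar> \<le> 1 / 2" using aa small by (simp add: K_def)
  have "a\<^sup>2 \<le> (3 * (y * K))\<^sup>2" using aa by (metis abs_ge_zero power2_abs power_mono)
  then have sq: "2 * a\<^sup>2 \<le> 18 * e\<^sup>2 * c\<^sup>2 * K\<^sup>2" by (simp add: y_def power_mult_distrib mult_ac)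
  have "a - e * expectation W - 2 * a\<^sup>2 \<le> lmgf M W e"
    using lmgf_ge[OF exp_integrable mean_bound(1) square_integrable abs_moment(1)[of 3], of e] half
    unfolding a_def q_def t_def by simp
  then have "e\<^sup>2 / 2 * q - \<bar>e\<bar> ^ 3 * (c ^ 3 * K) - 18 * e\<^sup>2 * c\<^sup>2 * K\<^sup>2 \<le> lmgf M W e"
    using a3' sq unfolding a_def by linarith
  then show ?thesis unfolding K_def q_def .
qed

end

section \<open>Counts localised at the circumcenter\<close>

text \<open>A linear combination of the counts for several radii, restricted to circumcenters in \<open>A\<close>.\<close>

definition weighted_count :: "('m::finite \<Rightarrow> real) \<Rightarrow> ('m \<Rightarrow> real) \<Rightarrow> (real^2) set \<Rightarrow> (real^2) set \<Rightarrow> real" where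
  "weighted_count \<theta> \<tau> A F = (\<Sum>i\<in>UNIV. \<theta> i * real (card (critical_in (\<tau> i) A F)))"

lemma triples_in_local:
  assumes "\<And>a. a \<in> A \<Longrightarrow> cball a s \<subseteq> R"
  shows "triples_in s A (F \<inter> R) = triples_in s A F"
proof -
  have "y \<in> R" if "Y \<in> triples_in s A F" "y \<in> Y" for Y y
  proof -
    have Y: "morse_cond s Y" "card Y = 3" "circumcenter Y \<in> A" using that(1) by (auto simp: triples_in_def)
    have "y \<in> cball (circumcenter Y) s" using circumdisk_radius[OF Y(1,2)] that(2) by simp
    then show ?thesis using assms[OF Y(3)] by blast
  qed
  then show ?thesis by (auto simp: triples_in_def)
qed

text \<open>The triple lies on the circumcircle, and together with the open disk it is contained in the closed ball of radius \<open>s\<close> around the circumcenter.\<close>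

lemma critical_in_local:
  assumes "\<And>a. a \<in> A \<Longrightarrow> cball a s \<subseteq> R"
  shows "critical_in s A (F \<inter> R) = critical_in s A F"
proof -
  have eq: "critical_in s A F = {Y \<in> triples_in s A F. circumdisk Y \<inter> F = {}}" for F
    by (auto simp: critical_in_def triples_in_def)
  have "circumdisk Y \<subseteq> R" if "Y \<in> triples_in s A F" for Y
  proof -
    have Y: "morse_cond s Y" "card Y = 3" "circumcenter Y \<in> A" using that(1) by (auto simp: triples_in_def)
    have "circumdisk Y \<subseteq> cball (circumcenter Y) s"
      using circumdisk_radius[OF Y(1,2)] by (auto simp: circumdisk_def)
    then show ?thesis using assms[OF Y(3)] by blast
  qed
  then have "circumdisk Y \<inter> (F \<inter> R) = circumdisk Y \<inter> F" if "Y \<in> triples_in s A F" for Y using that by blast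
  then have "{Y \<in> triples_in s A F. circumdisk Y \<inter> (F \<inter> R) = {}} = {Y \<in> triples_in s A F. circumdisk Y \<inter> F = {}}"
    by auto
  moreover have "triples_in s A (F \<inter> R) = triples_in s A F"
    by (rule triples_in_local) (rule assms)
  ultimately show ?thesis unfolding eq by simp
qed

lemma weighted_count_local:
  assumes "\<And>a i. a \<in> A \<Longrightarrow> cball a (\<tau> i) \<subseteq> R"
  shows "weighted_count \<theta> \<tau> A (F \<inter> R) = weighted_count \<theta> \<tau> A F"
  unfolding weighted_count_def using critical_in_local assms by (intro sum.cong refl arg_cong2[where f="(*)"]) metis

lemma weighted_count_UN:
  assumes F: "finite F" and Z: "finite Z" and dis: "disjoint_family_on A Z"
  shows "weighted_count \<theta> \<tau> (\<Union>z\<in>Z. A z) F = (\<Sum>z\<in>Z. weighted_count \<theta> \<tau> (A z) F)"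
proof -
  have "card (critical_in s (\<Union>z\<in>Z. A z) F) = (\<Sum>z\<in>Z. card (critical_in s (A z) F))" for s
  proof -
    have "critical_in s (\<Union>z\<in>Z. A z) F = (\<Union>z\<in>Z. critical_in s (A z) F)" by (auto simp: critical_in_def)
    also have "card \<dots> = (\<Sum>z\<in>Z. card (critical_in s (A z) F))"
    proof (rule card_UN_disjoint[OF Z])
      show "\<forall>z\<in>Z. finite (critical_in s (A z) F)" using finite_critical_in[OF F] by blast
      show "\<forall>z\<in>Z. \<forall>z'\<in>Z. z \<noteq> z' \<longrightarrow> critical_in s (A z) F \<inter> critical_in s (A z') F = {}"
      proof (intro ballI impI)
        fix z z' assume "z \<in> Z" "z' \<in> Z" "z \<noteq> z'"
        then have "A z \<inter> A z' = {}" using dis unfolding disjoint_family_on_def by blast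
        then show "critical_in s (A z) F \<inter> critical_in s (A z') F = {}" by (auto simp: critical_in_def)
      qed
    qed
    finally show ?thesis .
  qed
  then show ?thesis unfolding weighted_count_def by (simp add: sum_distrib_left sum.swap[of _ _ Z])
qed

lemma weighted_count_measurable:
  assumes "counts_measurable W P" "A \<in> sets borel"
  shows "(\<lambda>w. weighted_count \<theta> \<tau> A (P w)) \<in> borel_measurable W"
  unfolding weighted_count_def using critical_in_measurable[OF assms] by measurable

text \<open>The successor makes the constant at least one, so that \<open>weight_bound\<close> also dominates \<open>weight_norm\<close>.\<close>

definition linear_const :: nat where
  "linear_const = Suc (SOME \<kappa>. \<forall>s F. finite F \<and> no_cocircular F \<longrightarrow> card (critical s F) \<le> \<kappa> * card F)"

lemma card_critical_le:
  assumes "finite F" "no_cocircular F"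
  shows "card (critical s F) \<le> linear_const * card F"
proof -
  have "\<forall>s F. finite F \<and> no_cocircular F \<longrightarrow> card (critical s F) \<le> (SOME \<kappa>. \<forall>s F. finite F \<and> no_cocircular F \<longrightarrow> card (critical s F) \<le> \<kappa> * card F) * card F"
    by (rule someI_ex[OF card_critical_linear])
  then have "card (critical s F) \<le> (SOME \<kappa>. \<forall>s F. finite F \<and> no_cocircular F \<longrightarrow> card (critical s F) \<le> \<kappa> * card F) * card F"
    using assms by blast
  then show ?thesis by (simp add: linear_const_def)
qed

lemma no_cocircular_subset: "no_cocircular F \<Longrightarrow> G \<subseteq> F \<Longrightarrow> no_cocircular G"
  unfolding no_cocircular_def by blast

definition weight_norm :: "('m::finite \<Rightarrow> real) \<Rightarrow> real" where
  "weight_norm \<theta> = (\<Sum>i\<in>UNIV. \<bar>\<theta> i\<bar>)"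

definition weight_bound :: "('m::finite \<Rightarrow> real) \<Rightarrow> real" where
  "weight_bound \<theta> = real linear_const * weight_norm \<theta>"

lemma weight_norm_nonneg: "0 \<le> weight_norm \<theta>" by (simp add: weight_norm_def sum_nonneg)

lemma weight_norm_le_wbound: "weight_norm \<theta> \<le> weight_bound \<theta>"
proof -
  have "1 * weight_norm \<theta> \<le> real linear_const * weight_norm \<theta>"
    using weight_norm_nonneg by (intro mult_right_mono) (auto simp: linear_const_def)
  then show ?thesis by (simp add: weight_bound_def)
qed

lemma weight_bound_nonneg: "0 \<le> weight_bound \<theta>" using weight_norm_nonneg weight_norm_le_wbound order_trans by blast

lemma weighted_count_bound:
  assumes F: "finite F" "no_cocircular F" and loc: "\<And>a i. a \<in> A \<Longrightarrow> cball a (\<tau> i) \<subseteq> R"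
  shows "\<bar>weighted_count \<theta> \<tau> A F\<bar> \<le> weight_bound \<theta> * (of_bool (3 \<le> card (F \<inter> R)) * real (card (F \<inter> R)))"
proof -
  define G where "G = F \<inter> R"
  have G: "finite G" "no_cocircular G" using F no_cocircular_subset by (auto simp: G_def)
  have b: "real (card (critical_in s A G)) \<le> real linear_const * (of_bool (3 \<le> card G) * real (card G))" for s
  proof (cases "3 \<le> card G")
    case True
    have "card (critical_in s A G) \<le> card (critical s G)"
      by (rule card_mono[OF finite_critical[OF G(1)] critical_in_subset(2)])
    also have "\<dots> \<le> linear_const * card G" by (rule card_critical_le[OF G])
    finally show ?thesis using True by (simp flip: of_nat_mult)
  next
    case False
    have "critical_in s A G = {}"
    proof (rule ccontr)
      assume "critical_in s A G \<noteq> {}"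
      then obtain Y where "Y \<subseteq> G" "card Y = 3" by (auto simp: critical_in_def)
      then show False using False card_mono[OF G(1)] by metis
    qed
    then show ?thesis by simp
  qed
  have "\<bar>weighted_count \<theta> \<tau> A F\<bar> = \<bar>weighted_count \<theta> \<tau> A G\<bar>" using weighted_count_local[of A \<tau> R \<theta> F, OF loc] by (simp add: G_def)
  also have "\<dots> \<le> (\<Sum>i\<in>UNIV. \<bar>\<theta> i\<bar> * real (card (critical_in (\<tau> i) A G)))"
    unfolding weighted_count_def by (rule order_trans[OF sum_abs]) (simp add: abs_mult)
  also have "\<dots> \<le> (\<Sum>i\<in>UNIV. \<bar>\<theta> i\<bar> * (real linear_const * (of_bool (3 \<le> card G) * real (card G))))"
    by (intro sum_mono mult_left_mono b) auto
  also have "\<dots> = weight_bound \<theta> * (of_bool (3 \<le> card G) * real (card G))"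
    by (simp add: weight_bound_def weight_norm_def sum_distrib_left sum_distrib_right mult_ac)
  finally show ?thesis by (simp add: G_def)
qed

lemma weighted_count_cluster:
  assumes P: "poisson_point_process M S lam P" and lam: "0 \<le> lam"
    and S: "S \<in> sets borel" "emeasure lborel S < \<infinity>"
    and R: "R \<in> sets borel" and mu: "lam * measure lborel (S \<inter> R) \<le> \<mu>" "\<mu> \<le> 1"
    and A: "A \<in> sets borel" and loc: "\<And>a i. a \<in> A \<Longrightarrow> cball a (\<tau> i) \<subseteq> R"
  shows "cluster_var M S lam P R \<mu> (weight_bound \<theta>) (\<lambda>\<omega>. weighted_count \<theta> \<tau> A (P \<omega>))"
proof
  show "AE \<omega> in M. \<bar>weighted_count \<theta> \<tau> A (P \<omega>)\<bar> \<le> weight_bound \<theta> * (of_bool (3 \<le> card (P \<omega> \<inter> R)) * real (card (P \<omega> \<inter> R)))"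
    using AE_no_cocircular[OF P lam S] AE_space
  proof eventually_elim
    case (elim \<omega>)
    show ?case by (rule weighted_count_bound[OF poissonD(2)[OF P elim(2)] elim(1) loc])
  qed
qed (use assms weight_bound_nonneg weighted_count_measurable[OF poissonD(4)[OF P] A] in auto)

lemma weighted_count_exp_integrable:
  assumes P: "poisson_point_process M S lam P" and lam: "0 \<le> lam"
    and S: "S \<in> sets borel" "emeasure lborel S < \<infinity>" and A: "A \<in> sets borel"
  shows "integrable M (\<lambda>\<omega>. exp (a * weighted_count \<theta> \<tau> A (P \<omega>)))" "integrable M (\<lambda>\<omega>. weighted_count \<theta> \<tau> A (P \<omega>))"
proof -
  note [measurable] = weighted_count_measurable[OF poissonD(4)[OF P] A]
  have b: "AE \<omega> in M. \<bar>weighted_count \<theta> \<tau> A (P \<omega>)\<bar> \<le> weight_bound \<theta> * real (card (P \<omega> \<inter> UNIV))"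
    using AE_no_cocircular[OF P lam S] AE_space
  proof eventually_elim
    case (elim \<omega>)
    have "\<bar>weighted_count \<theta> \<tau> A (P \<omega>)\<bar> \<le> weight_bound \<theta> * (of_bool (3 \<le> card (P \<omega> \<inter> UNIV)) * real (card (P \<omega> \<inter> UNIV)))"
      by (rule weighted_count_bound[OF poissonD(2)[OF P elim(2)] elim(1)]) simp
    also have "\<dots> \<le> weight_bound \<theta> * real (card (P \<omega> \<inter> UNIV))" using weight_bound_nonneg by (intro mult_left_mono) auto
    finally show ?case .
  qed
  have UN: "UNIV \<in> sets (borel :: (real^2) measure)" by simp
  show e: "integrable M (\<lambda>\<omega>. exp (a * weighted_count \<theta> \<tau> A (P \<omega>)))" for a
  proof (rule Bochner_Integration.integrable_bound[OF poisson_count_exp_finite[OF P UN lam, of "\<bar>a\<bar> * weight_bound \<theta>"]])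
    show "AE \<omega> in M. norm (exp (a * weighted_count \<theta> \<tau> A (P \<omega>))) \<le> norm (exp (\<bar>a\<bar> * weight_bound \<theta> * real (card (P \<omega> \<inter> UNIV))))"
      using b
    proof eventually_elim
      case (elim \<omega>)
      have "a * weighted_count \<theta> \<tau> A (P \<omega>) \<le> \<bar>a\<bar> * \<bar>weighted_count \<theta> \<tau> A (P \<omega>)\<bar>" by (metis abs_ge_self abs_mult)
      also have "\<dots> \<le> \<bar>a\<bar> * (weight_bound \<theta> * real (card (P \<omega> \<inter> UNIV)))" using elim by (intro mult_left_mono) auto
      finally show ?case by (simp add: mult.assoc)
    qed
  qed measurable
  have "integrable M (\<lambda>\<omega>. exp (1 * weighted_count \<theta> \<tau> A (P \<omega>)) + exp (- 1 * weighted_count \<theta> \<tau> A (P \<omega>)))"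
    using e by (intro Bochner_Integration.integrable_add)
  then show "integrable M (\<lambda>\<omega>. weighted_count \<theta> \<tau> A (P \<omega>))"
  proof (rule Bochner_Integration.integrable_bound)
    have "\<bar>x\<bar> \<le> exp x + exp (- x)" for x :: real
      using exp_ge_add_one_self[of x] exp_ge_add_one_self[of "- x"] exp_gt_zero[of x] exp_gt_zero[of "- x"] by linarith
    then show "AE \<omega> in M. norm (weighted_count \<theta> \<tau> A (P \<omega>)) \<le> norm (exp (1 * weighted_count \<theta> \<tau> A (P \<omega>)) + exp (- 1 * weighted_count \<theta> \<tau> A (P \<omega>)))"
      by (simp add: add_pos_pos abs_of_pos)
  qed measurable
qed

lemma card_triples_in_le: "finite F \<Longrightarrow> card (triples_in s A F) \<le> card F ^ 3"
proof -
  assume F: "finite F"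
  have "card (triples_in s A F) \<le> card {Y. Y \<subseteq> F \<and> card Y = 3}"
  proof (rule card_mono)
    show "finite {Y. Y \<subseteq> F \<and> card Y = 3}"
      by (rule finite_subset[of _ "Pow F"]) (use F in \<open>blast, simp\<close>)
  qed (auto simp: triples_in_def)
  also have "\<dots> = card F choose 3" by (rule n_subsets[OF F])
  also have "\<dots> \<le> card F ^ 3"
    by (cases "3 \<le> card F") (simp_all add: binomial_le_pow binomial_eq_0)
  finally show ?thesis .
qed

text \<open>With at most three points there is at most one triple, and its circumdisk is empty because
the three points lie on the boundary. So all counts are indicators and products of indicators are again indicators.\<close>

lemma weighted_count_square_three:
  assumes F: "finite F" "card F \<le> 3"
  shows "(weighted_count \<theta> \<tau> A F)\<^sup>2 = (\<Sum>i\<in>UNIV. \<Sum>j\<in>UNIV. \<theta> i * \<theta> j * real (card (triples_in (min (\<tau> i) (\<tau> j)) A F)))"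
proof -
  have only: "Y = F" if "Y \<subseteq> F" "card Y = 3" for Y
    using that F by (metis card_mono card_subset_eq le_antisym)
  define q where "q = (\<lambda>s. card F = 3 \<and> morse_cond s F \<and> circumcenter F \<in> A)"
  have t: "triples_in s A F = (if q s then {F} else {})" for s
    using only by (auto simp: triples_in_def q_def)
  have emp: "circumdisk F \<inter> F = {}" if "q s" for s
  proof -
    have "morse_cond s F" "card F = 3" using that by (auto simp: q_def)
    from circumdisk_radius(3)[OF this] show ?thesis by (auto simp: circumdisk_def)
  qed
  have c: "critical_in s A F = (if q s then {F} else {})" for s
  proof -
    have "critical_in s A F = {Y \<in> triples_in s A F. circumdisk Y \<inter> F = {}}" by (auto simp: critical_in_def triples_in_def)
    then show ?thesis unfolding t using emp by auto
  qed
  have qm: "q (min s s') \<longleftrightarrow> q s \<and> q s'" for s s'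
    by (auto simp: q_def morse_cond_def)
  have "real (card (critical_in s A F)) * real (card (critical_in s' A F)) = real (card (triples_in (min s s') A F))" for s s'
    unfolding t c qm by simp
  then show ?thesis
    unfolding weighted_count_def power2_eq_square sum_product by (simp add: mult_ac)
qed

text \<open>For at most three points the square equals the sum over all triples, without any condition of emptiness, whose mean is
explicit. The difference is supported on four or more points and therefore \<open>O(\<mu>\<^sup>4)\<close>.\<close>

lemma weighted_count_second_moment:
  assumes P: "poisson_point_process M S lam P" and lam: "0 \<le> lam"
    and S: "S \<in> sets borel" "emeasure lborel S < \<infinity>"
    and R: "R \<in> sets borel" and mu: "lam * measure lborel (S \<inter> R) \<le> \<mu>" "\<mu> \<le> 1"
    and A: "A \<in> sets borel" and loc: "\<And>a i. a \<in> A \<Longrightarrow> cball a (\<tau> i) \<subseteq> R"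
    and RS: "R \<subseteq> S" and \<tau>: "\<And>i. 0 < \<tau> i"
  shows "\<bar>(\<integral>\<omega>. (weighted_count \<theta> \<tau> A (P \<omega>))\<^sup>2 \<partial>M)
     - lam ^ 3 * measure lborel A * (acute_volume / 6 * (\<Sum>i\<in>UNIV. \<Sum>j\<in>UNIV. \<theta> i * \<theta> j * min (\<tau> i) (\<tau> j) ^ 4))\<bar>
     \<le> 12 * (weight_bound \<theta>)\<^sup>2 * (\<mu> ^ 4 * tail_const)"
proof -
  interpret cluster_var M S lam P R \<mu> "weight_bound \<theta>" "\<lambda>\<omega>. weighted_count \<theta> \<tau> A (P \<omega>)"
    by (rule weighted_count_cluster[OF P lam S R mu A loc])
  note fin = poissonD(2)[OF P]
  define t where "t = (\<lambda>i j \<omega>. real (card (triples_in (min (\<tau> i) (\<tau> j)) A (P \<omega>))))"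
  define V where "V = (\<lambda>\<omega>. \<Sum>i\<in>UNIV. \<Sum>j\<in>UNIV. \<theta> i * \<theta> j * t i j \<omega>)"
  have cb: "cball a (min (\<tau> i) (\<tau> j)) \<subseteq> R" if "a \<in> A" for a i j
  proof -
    have "cball a (min (\<tau> i) (\<tau> j)) \<subseteq> cball a (\<tau> i)" by (intro subset_cball) simp
    then show ?thesis using loc[OF that, of i] by blast
  qed
  have ti: "integrable M (t i j)" "expectation (t i j) = lam ^ 3 * min (\<tau> i) (\<tau> j) ^ 4 * acute_volume * measure lborel A / 6" for i j
    unfolding t_def using triples_in_mean[OF P lam S A, of "min (\<tau> i) (\<tau> j)"] \<tau> cb RS
    by (auto simp: min_def) (metis cb order_trans min_def)+
  have tm[measurable]: "t i j \<in> borel_measurable M" for i j using ti(1) by (rule borel_measurable_integrable)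
  have Vi: "integrable M V" unfolding V_def using ti(1) by (intro Bochner_Integration.integrable_sum) simp
  have EV: "expectation V = lam ^ 3 * measure lborel A * (acute_volume / 6 * (\<Sum>i\<in>UNIV. \<Sum>j\<in>UNIV. \<theta> i * \<theta> j * min (\<tau> i) (\<tau> j) ^ 4))"
  proof -
    have "expectation V = (\<Sum>i\<in>UNIV. \<Sum>j\<in>UNIV. \<theta> i * \<theta> j * expectation (t i j))"
      unfolding V_def using ti(1) by (simp add: Bochner_Integration.integral_sum)
    then show ?thesis unfolding ti(2) by (simp add: sum_distrib_left mult_ac)
  qed
  define f where "f = (\<lambda>\<omega>. (weighted_count \<theta> \<tau> A (P \<omega>))\<^sup>2 - V \<omega>)"
  have fm: "f \<in> borel_measurable M" unfolding f_def V_def by measurable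
  have bound: "AE \<omega> in M. \<bar>f \<omega>\<bar> \<le> 12 * (weight_bound \<theta>)\<^sup>2 * (of_bool (4 \<le> X \<omega>) * exp (2 * real (X \<omega>)))"
    using dom AE_space
  proof eventually_elim
    case (elim \<omega>)
    define G where "G = P \<omega> \<inter> R"
    have G: "finite G" using fin[OF elim(2)] by (simp add: G_def)
    have tG: "t i j \<omega> = real (card (triples_in (min (\<tau> i) (\<tau> j)) A G))" for i j
      unfolding t_def G_def using triples_in_local[of A "min (\<tau> i) (\<tau> j)" R] cb by simp
    have wG: "weighted_count \<theta> \<tau> A (P \<omega>) = weighted_count \<theta> \<tau> A G" unfolding G_def using weighted_count_local[of A \<tau> R \<theta> "P \<omega>", OF loc] by simp
    show ?case
    proof (cases "4 \<le> card G")
      case False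
      then have "(weighted_count \<theta> \<tau> A G)\<^sup>2 = V \<omega>" unfolding V_def tG using G by (intro weighted_count_square_three) auto
      then show ?thesis by (simp add: f_def wG)
    next
      case True
      have w: "\<bar>weighted_count \<theta> \<tau> A (P \<omega>)\<bar> \<le> weight_bound \<theta> * real (card G)" using elim(1) True by (simp add: G_def)
      have "(weighted_count \<theta> \<tau> A (P \<omega>))\<^sup>2 \<le> (weight_bound \<theta> * real (card G))\<^sup>2"
        using power_mono[OF w, of 2] by simp
      also have "\<dots> \<le> (weight_bound \<theta>)\<^sup>2 * real (card G) ^ 3"
        unfolding power_mult_distrib using True by (intro mult_left_mono power_increasing) auto
      finally have 1: "(weighted_count \<theta> \<tau> A (P \<omega>))\<^sup>2 \<le> (weight_bound \<theta>)\<^sup>2 * real (card G) ^ 3" .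
      have "\<bar>V \<omega>\<bar> \<le> (\<Sum>i\<in>UNIV. \<Sum>j\<in>UNIV. \<bar>\<theta> i\<bar> * \<bar>\<theta> j\<bar> * t i j \<omega>)"
        unfolding V_def by (intro order_trans[OF sum_abs] sum_mono) (simp add: abs_mult t_def)
      also have "\<dots> \<le> (\<Sum>i\<in>UNIV. \<Sum>j\<in>UNIV. \<bar>\<theta> i\<bar> * \<bar>\<theta> j\<bar> * real (card G) ^ 3)"
        unfolding tG using card_triples_in_le[OF G]
        by (intro sum_mono mult_left_mono) (simp_all flip: of_nat_power)
      also have "\<dots> = (weight_norm \<theta>)\<^sup>2 * real (card G) ^ 3"
        proof -
          have "(weight_norm \<theta>)\<^sup>2 = (\<Sum>i\<in>UNIV. \<Sum>j\<in>UNIV. \<bar>\<theta> i\<bar> * \<bar>\<theta> j\<bar>)"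
            unfolding weight_norm_def power2_eq_square by (rule sum_product)
          then show ?thesis by (simp only: sum_distrib_right)
        qed
      also have "\<dots> \<le> (weight_bound \<theta>)\<^sup>2 * real (card G) ^ 3"
        using weight_norm_le_wbound weight_norm_nonneg by (intro mult_right_mono power_mono) auto
      finally have 2: "\<bar>V \<omega>\<bar> \<le> (weight_bound \<theta>)\<^sup>2 * real (card G) ^ 3" .
      have "\<bar>f \<omega>\<bar> \<le> 2 * (weight_bound \<theta>)\<^sup>2 * real (card G) ^ 3"
        using 1 2 zero_le_power2[of "weighted_count \<theta> \<tau> A (P \<omega>)"] unfolding f_def mult.assoc[of 2] by linarith
      also have "\<dots> \<le> 2 * (weight_bound \<theta>)\<^sup>2 * (fact 3 * exp (2 * real (card G)))"
      proof (intro mult_left_mono)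
        have "real (card G) ^ 3 \<le> fact 3 * exp (real (card G))" by (rule real_power_le_exp)
        also have "\<dots> \<le> fact 3 * exp (2 * real (card G))" by (intro mult_left_mono) auto
        finally show "real (card G) ^ 3 \<le> fact 3 * exp (2 * real (card G))" .
      qed simp
      finally show ?thesis using True by (simp add: G_def fact_numeral)
    qed
  qed
  have "\<bar>expectation f\<bar> \<le> 12 * (weight_bound \<theta>)\<^sup>2 * (\<mu> ^ 4 * tail_const)"
    by (rule dominated(2)[OF fm bound]) simp
  moreover have "expectation f = expectation (\<lambda>\<omega>. (weighted_count \<theta> \<tau> A (P \<omega>))\<^sup>2) - expectation V"
    unfolding f_def using square_integrable Vi by simp
  ultimately show ?thesis unfolding EV by simp
qed

text \<open>Counts over sets with disjoint neighbourhoods are functions of the restrictions of the process to disjoint regions.\<close>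

lemma lmgf_sum_local:
  fixes I :: "(nat \<times> nat) set"
  assumes P: "poisson_point_process M S lam P" and lam: "0 \<le> lam"
    and S: "S \<in> sets borel" "emeasure lborel S < \<infinity>"
    and I: "finite I" and R: "\<And>z. z \<in> I \<Longrightarrow> R z \<in> sets borel" and dis: "disjoint_family_on R I"
    and A: "\<And>z. z \<in> I \<Longrightarrow> A z \<in> sets borel"
    and loc: "\<And>z a i. z \<in> I \<Longrightarrow> a \<in> A z \<Longrightarrow> cball a (\<tau> i) \<subseteq> R z"
  shows "lmgf M (\<lambda>\<omega>. \<Sum>z\<in>I. weighted_count \<theta> \<tau> (A z) (P \<omega>)) e = (\<Sum>z\<in>I. lmgf M (\<lambda>\<omega>. weighted_count \<theta> \<tau> (A z) (P \<omega>)) e)"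
proof -
  interpret prob_space M using poissonD(1)[OF P] .
  define W where "W = (\<lambda>z \<omega>. weighted_count \<theta> \<tau> (A z) (P \<omega>))"
  have Wi: "integrable M (\<lambda>\<omega>. exp (e * W z \<omega>))" "integrable M (W z)" if "z \<in> I" for z
    unfolding W_def using weighted_count_exp_integrable[OF P lam S A[OF that]] by blast+
  define J where "J = prod_encode ` I"
  have dec: "prod_decode q \<in> I" if "q \<in> J" for q using that by (auto simp: J_def)
  define \<Phi> where "\<Phi> = (\<lambda>q F. weighted_count \<theta> \<tau> (A (prod_decode q)) F)"
  have ind: "indep_vars (\<lambda>_. borel) (\<lambda>q \<omega>. \<Phi> q (P \<omega> \<inter> R (prod_decode q))) J"
  proof (rule poisson_restrictions_indep[OF P])
    fix q assume "q \<in> J" then show "R (prod_decode q) \<in> sets borel" using R dec by blast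
  next
    show "disjoint_family_on (\<lambda>q. R (prod_decode q)) J"
      using dis unfolding disjoint_family_on_def J_def by auto
  next
    fix q and W :: "'a measure" assume "q \<in> J" "counts_measurable W (\<lambda>\<omega>. P \<omega> \<inter> R (prod_decode q))"
    then show "(\<lambda>\<omega>. \<Phi> q (P \<omega> \<inter> R (prod_decode q))) \<in> borel_measurable W"
      unfolding \<Phi>_def using weighted_count_measurable A dec by blast
  qed
  have \<Phi>eq: "\<Phi> q (P \<omega> \<inter> R (prod_decode q)) = W (prod_decode q) \<omega>" if "q \<in> J" for q \<omega>
    unfolding \<Phi>_def W_def using loc[OF dec[OF that]] by (intro weighted_count_local)
  have "indep_vars (\<lambda>_. borel) (\<lambda>q \<omega>. exp (e * (\<Phi> q (P \<omega> \<inter> R (prod_decode q)) - expectation (W (prod_decode q))))) J"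
    by (rule indep_vars_compose2[OF ind]) measurable
  then have ind2: "indep_vars (\<lambda>_. borel) (\<lambda>q \<omega>. exp (e * (W (prod_decode q) \<omega> - expectation (W (prod_decode q))))) J"
    by (subst (asm) indep_vars_cong[OF refl _ refl, where Y="\<lambda>q \<omega>. exp (e * (W (prod_decode q) \<omega> - expectation (W (prod_decode q))))"])
      (auto simp: \<Phi>eq)
  have i2: "integrable M (\<lambda>\<omega>. exp (e * (W z \<omega> - expectation (W z))))" if "z \<in> I" for z
  proof -
    have "(\<lambda>\<omega>. exp (e * (W z \<omega> - expectation (W z)))) = (\<lambda>\<omega>. exp (- (e * expectation (W z))) * exp (e * W z \<omega>))"
      by (auto simp: algebra_simps simp flip: exp_add)
    then show ?thesis using Wi(1)[OF that] by simp
  qed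
  have "expectation (\<lambda>\<omega>. \<Prod>q\<in>J. exp (e * (W (prod_decode q) \<omega> - expectation (W (prod_decode q)))))
    = (\<Prod>q\<in>J. expectation (\<lambda>\<omega>. exp (e * (W (prod_decode q) \<omega> - expectation (W (prod_decode q))))))"
    by (rule indep_vars_lebesgue_integral[OF _ ind2]) (use I i2 dec in \<open>auto simp: J_def\<close>)
  then have pr: "expectation (\<lambda>\<omega>. \<Prod>z\<in>I. exp (e * (W z \<omega> - expectation (W z)))) = (\<Prod>z\<in>I. expectation (\<lambda>\<omega>. exp (e * (W z \<omega> - expectation (W z)))))"
    unfolding J_def by (simp add: prod.reindex inj_on_def)
  have pos: "0 < expectation (\<lambda>\<omega>. exp (e * (W z \<omega> - expectation (W z))))" if "z \<in> I" for z
    by (rule expectation_exp_pos[OF i2[OF that]])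
  have "lmgf M (\<lambda>\<omega>. \<Sum>z\<in>I. W z \<omega>) e = ln (expectation (\<lambda>\<omega>. \<Prod>z\<in>I. exp (e * (W z \<omega> - expectation (W z)))))"
    unfolding lmgf_def using Wi(2) I
    by (simp add: Bochner_Integration.integral_sum sum_subtractf[symmetric] sum_distrib_left exp_sum)
  also have "\<dots> = (\<Sum>z\<in>I. lmgf M (W z) e)"
    unfolding pr lmgf_def
  proof (rule ln_prod[OF I])
    fix z assume "z \<in> I"
    then show "expectation (\<lambda>\<omega>. exp (e * (W z \<omega> - expectation (W z)))) \<noteq> 0" using pos[of z] by simp
  qed
  finally show ?thesis unfolding W_def .
qed

section \<open>Cells and blocks of the unit square\<close>

definition rect :: "real \<Rightarrow> real \<Rightarrow> real \<Rightarrow> real \<Rightarrow> (real^2) set" where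
  "rect a b c d = {x. a \<le> x $ 1 \<and> x $ 1 < b \<and> c \<le> x $ 2 \<and> x $ 2 < d}"

lemma rect_borel [measurable]: "rect a b c d \<in> sets borel"
proof -
  have "{x \<in> space borel. a \<le> x $ 1 \<and> x $ 1 < b \<and> c \<le> x $ 2 \<and> x $ 2 < d} \<in> sets (borel :: (real^2) measure)"
    by measurable
  then show ?thesis by (simp add: rect_def)
qed

lemma Basis_2: "(Basis :: (real^2) set) = {axis 1 1, axis 2 1}"
  by (auto simp: Basis_vec_def UNIV_2)

lemma prod_Basis_2:
  fixes f :: "real^2 \<Rightarrow> real"
  shows "prod f Basis = f (axis 1 1) * f (axis 2 1)"
  unfolding Basis_2 by (simp add: axis_eq_axis)

lemma measure_box_2:
  assumes "a \<le> b" "c \<le> d"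
  shows "measure lborel (box (vector [a, c]) (vector [b, d] :: real^2)) = (b - a) * (d - c)"
    and "measure lborel (cbox (vector [a, c]) (vector [b, d] :: real^2)) = (b - a) * (d - c)"
proof -
  have le: "\<forall>i\<in>Basis. (vector [a, c] :: real^2) \<bullet> i \<le> vector [b, d] \<bullet> i"
    using assms by (simp add: Basis_2 inner_axis)
  then show "measure lborel (box (vector [a, c]) (vector [b, d] :: real^2)) = (b - a) * (d - c)"
    by (subst measure_lborel_box_eq) (auto simp: prod_Basis_2 inner_axis inner_diff_left)
  show "measure lborel (cbox (vector [a, c]) (vector [b, d] :: real^2)) = (b - a) * (d - c)"
    using le by (subst measure_lborel_cbox_eq) (auto simp: prod_Basis_2 inner_axis inner_diff_left)
qed

lemma rect_between:
  "box (vector [a, c]) (vector [b, d]) \<subseteq> rect a b c d" "rect a b c d \<subseteq> cbox (vector [a, c]) (vector [b, d])"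
  by (auto simp: rect_def mem_box Basis_2 inner_axis)

lemma measure_rect:
  assumes "a \<le> b" "c \<le> d"
  shows "measure lborel (rect a b c d) = (b - a) * (d - c)"
proof (rule antisym)
  show "measure lborel (rect a b c d) \<le> (b - a) * (d - c)"
    using measure_mono_fmeasurable[OF rect_between(2)[of a b c d], of lborel] measure_box_2(2)[OF assms]
    by (simp add: fmeasurable_cbox)
  have "rect a b c d \<in> fmeasurable lborel"
    by (rule fmeasurableI2[OF fmeasurable_cbox rect_between(2)]) simp
  then show "(b - a) * (d - c) \<le> measure lborel (rect a b c d)"
    using measure_mono_fmeasurable[OF rect_between(1)[of a c b d], of lborel] measure_box_2(1)[OF assms] by simp
qed

lemma cball_rect:
  assumes "x \<in> rect a b c d" "t \<le> s" "0 < s"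
  shows "cball x t \<subseteq> rect (a - s) (b + s) (c - s) (d + s)"
proof
  fix y assume "y \<in> cball x t"
  then have n: "norm (x - y) \<le> s" using assms(2) by (simp add: dist_norm)
  have "\<bar>x $ 1 - y $ 1\<bar> \<le> s" "\<bar>x $ 2 - y $ 2\<bar> \<le> s"
    using component_le_norm_cart[of "x - y" 1] component_le_norm_cart[of "x - y" 2] n by auto
  then show "y \<in> rect (a - s) (b + s) (c - s) (d + s)" using assms(1) unfolding rect_def by auto
qed

lemma rect_subset_unit: "0 \<le> a \<Longrightarrow> b \<le> 1 \<Longrightarrow> 0 \<le> c \<Longrightarrow> d \<le> 1 \<Longrightarrow> rect a b c d \<subseteq> cbox 0 1"
  by (auto simp: rect_def mem_box Basis_2 inner_axis)

definition cell :: "real \<Rightarrow> nat \<times> nat \<Rightarrow> (real^2) set" where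
  "cell s z = rect (real (fst z) * s) (real (fst z + 1) * s) (real (snd z) * s) (real (snd z + 1) * s)"

definition cell_nbhd :: "real \<Rightarrow> nat \<times> nat \<Rightarrow> (real^2) set" where
  "cell_nbhd s z = rect (real (fst z) * s - s) (real (fst z + 1) * s + s) (real (snd z) * s - s) (real (snd z + 1) * s + s)"

definition block :: "real \<Rightarrow> nat \<Rightarrow> nat \<times> nat \<Rightarrow> (real^2) set" where
  "block s K z = rect (real (fst z * K) * s) (real ((fst z + 1) * K) * s) (real (snd z * K) * s) (real ((snd z + 1) * K) * s)"

definition block_core :: "real \<Rightarrow> nat \<Rightarrow> nat \<times> nat \<Rightarrow> (real^2) set" where
  "block_core s K z = rect (real (fst z * K) * s + s) (real ((fst z + 1) * K) * s - s) (real (snd z * K) * s + s) (real ((snd z + 1) * K) * s - s)"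

text \<open>An index in the first or last row of cells of its block. The remaining cells have distance at least \<open>s\<close> from the boundary of the block.\<close>

definition edge_index :: "nat \<Rightarrow> nat \<Rightarrow> bool" where
  "edge_index K i \<longleftrightarrow> i mod K = 0 \<or> i mod K = K - 1"

definition edge_cells :: "nat \<Rightarrow> nat \<Rightarrow> (nat \<times> nat) set" where
  "edge_cells k K = {z \<in> {..<k * K} \<times> {..<k * K}. edge_index K (fst z) \<or> edge_index K (snd z)}"

lemma index_unique:
  assumes "0 < s" "real i * s \<le> u" "u < real (i + 1) * s" "real j * s \<le> u" "u < real (j + 1) * s"
  shows "i = j"
proof -
  have "real i * s < real (j + 1) * s" "real j * s < real (i + 1) * s" using assms by linarith+
  then have "real i < real (j + 1)" "real j < real (i + 1)" using assms(1) by simp_all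
  then show ?thesis by linarith
qed

lemma index_exists:
  assumes "0 < s" "0 \<le> u" "u < real m * s"
  obtains i where "i < m" "real i * s \<le> u" "u < real (i + 1) * s"
proof -
  define i where "i = nat \<lfloor>u / s\<rfloor>"
  have "0 \<le> u / s" using assms by simp
  then have i: "real i = real_of_int \<lfloor>u / s\<rfloor>" by (simp add: i_def)
  have "real i \<le> u / s" "u / s < real i + 1" unfolding i by linarith+
  then have b: "real i * s \<le> u" "u < real (i + 1) * s" using assms(1) by (simp_all add: field_simps)
  then have "real i * s < real m * s" using assms by linarith
  then have "i < m" using assms(1) by simp
  then show ?thesis using b that by blast
qed

lemma core_index:
  assumes "0 < s" "0 < K" "real (a * K) * s + s \<le> u" "u < real ((a + 1) * K) * s - s"
    and "real i * s \<le> u" "u < real (i + 1) * s"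
  shows "i div K = a" "\<not> edge_index K i"
proof -
  have "real (a * K + 1) * s = real (a * K) * s + s" by (simp add: algebra_simps)
  then have "real (a * K + 1) * s < real (i + 1) * s" using assms by linarith
  then have "a * K + 1 < i + 1" by (simp only: mult_less_cancel_right_pos[OF assms(1)] of_nat_less_iff)
  then have 1: "a * K + 1 \<le> i" by simp
  have "real i * s + s < real ((a + 1) * K) * s" using assms by linarith
  then have "real (i + 1) * s < real ((a + 1) * K) * s" by (simp add: algebra_simps)
  then have 2: "i + 1 < (a + 1) * K" by (simp only: mult_less_cancel_right_pos[OF assms(1)] of_nat_less_iff)
  define m where "m = i - a * K"
  have m: "i = a * K + m" "1 \<le> m" "m + 1 < K" using 1 2 by (auto simp: m_def algebra_simps)
  then show "i div K = a" using assms(2) by simp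
  have "i mod K = m" using m by simp
  then show "\<not> edge_index K i" using m by (auto simp: edge_index_def)
qed

lemma index_core:
  assumes "0 < s" "0 < K" "\<not> edge_index K i" "real i * s \<le> u" "u < real (i + 1) * s"
  shows "real (i div K * K) * s + s \<le> u" "u < real ((i div K + 1) * K) * s - s"
proof -
  define a m where "a = i div K" and "m = i mod K"
  have i: "i = a * K + m" by (simp add: a_def m_def)
  have m: "1 \<le> m" "m + 2 \<le> K" using assms(2,3) mod_less_divisor[OF assms(2), of i] by (auto simp: edge_index_def m_def)
  have "real (a * K + 1) * s \<le> real i * s" using m assms(1) by (intro mult_right_mono) (auto simp: i)
  then show "real (i div K * K) * s + s \<le> u" using assms(4) by (simp add: a_def[symmetric] algebra_simps)
  have "i + 2 \<le> (a + 1) * K" using m by (simp add: i)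
  then have "real (i + 2) * s \<le> real ((a + 1) * K) * s" using assms(1) by (intro mult_right_mono) (simp_all only: of_nat_le_iff less_imp_le)
  then show "u < real ((i div K + 1) * K) * s - s" using assms(5) by (simp add: a_def[symmetric] algebra_simps)
qed

lemma unit_partition:
  assumes s: "0 < s" and K: "0 < K" and kK: "real (k * K) * s = 1"
  shows "rect 0 1 0 1 = (\<Union>z\<in>{..<k} \<times> {..<k}. block_core s K z) \<union> (\<Union>z\<in>edge_cells k K. cell s z)"
    and "disjoint_family_on (cell s) Z"
    and "disjoint_family_on (block_core s K) Z"
    and "(\<Union>z\<in>Z'. block_core s K z) \<inter> (\<Union>z\<in>edge_cells k K. cell s z) = {}"
    and "disjoint_family_on (block s K) Z"
proof -
  show "rect 0 1 0 1 = (\<Union>z\<in>{..<k} \<times> {..<k}. block_core s K z) \<union> (\<Union>z\<in>edge_cells k K. cell s z)"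
  proof (intro equalityI subsetI)
    fix x assume x: "x \<in> rect 0 1 0 1"
    then have x1: "0 \<le> x $ 1" "x $ 1 < real (k * K) * s" and x2: "0 \<le> x $ 2" "x $ 2 < real (k * K) * s"
      unfolding kK by (auto simp: rect_def)
    obtain i where i: "i < k * K" "real i * s \<le> x $ 1" "x $ 1 < real (i + 1) * s" using index_exists[OF s x1] .
    obtain j where j: "j < k * K" "real j * s \<le> x $ 2" "x $ 2 < real (j + 1) * s" using index_exists[OF s x2] .
    show "x \<in> (\<Union>z\<in>{..<k} \<times> {..<k}. block_core s K z) \<union> (\<Union>z\<in>edge_cells k K. cell s z)"
    proof (cases "edge_index K i \<or> edge_index K j")
      case True
      then have "(i, j) \<in> edge_cells k K" using i j by (simp add: edge_cells_def)
      moreover have "x \<in> cell s (i, j)" using i j by (simp add: cell_def rect_def)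
      ultimately show ?thesis by blast
    next
      case False
      have "x \<in> block_core s K (i div K, j div K)"
        using index_core[OF s K _ i(2,3)] index_core[OF s K _ j(2,3)] False by (simp add: block_core_def rect_def)
      moreover have "i div K < k" "j div K < k" using i(1) j(1) by (simp_all add: less_mult_imp_div_less)
      ultimately show ?thesis by blast
    qed
  next
    fix x assume "x \<in> (\<Union>z\<in>{..<k} \<times> {..<k}. block_core s K z) \<union> (\<Union>z\<in>edge_cells k K. cell s z)"
    then consider a b where "a < k" "b < k" "x \<in> block_core s K (a, b)" | i j where "i < k * K" "j < k * K" "x \<in> cell s (i, j)"
      by (auto simp: edge_cells_def)
    then show "x \<in> rect 0 1 0 1"
    proof cases
      case (1 a b)
      have le: "real ((a + 1) * K) * s \<le> real (k * K) * s" if "a < k" for a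
      proof -
        have "(a + 1) * K \<le> k * K" using that by (intro mult_le_mono1) simp
        then show ?thesis using s by (intro mult_right_mono) (simp_all only: of_nat_le_iff less_imp_le)
      qed
      have "real ((a + 1) * K) * s \<le> real (k * K) * s" "real ((b + 1) * K) * s \<le> real (k * K) * s"
        using 1 le by blast+
      moreover have "0 \<le> real (a * K) * s" "0 \<le> real (b * K) * s" using s by simp_all
      moreover have "real (a * K) * s + s \<le> x $ 1" "x $ 1 < real ((a + 1) * K) * s - s"
        "real (b * K) * s + s \<le> x $ 2" "x $ 2 < real ((b + 1) * K) * s - s"
        using 1(3) unfolding block_core_def rect_def by simp_all
      ultimately have "0 \<le> x $ 1" "x $ 1 < 1" "0 \<le> x $ 2" "x $ 2 < 1" using s unfolding kK by linarith+
      then show ?thesis by (simp add: rect_def)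
    next
      case (2 i j)
      have le: "real (i + 1) * s \<le> real (k * K) * s" if "i < k * K" for i
      proof -
        have "i + 1 \<le> k * K" using that by simp
        then show ?thesis using s by (intro mult_right_mono) (simp_all only: of_nat_le_iff less_imp_le)
      qed
      have "real (i + 1) * s \<le> real (k * K) * s" "real (j + 1) * s \<le> real (k * K) * s"
        using 2 le by blast+
      moreover have "0 \<le> real i * s" "0 \<le> real j * s" using s by simp_all
      moreover have "real i * s \<le> x $ 1" "x $ 1 < real (i + 1) * s" "real j * s \<le> x $ 2" "x $ 2 < real (j + 1) * s"
        using 2(3) unfolding cell_def rect_def by simp_all
      ultimately have "0 \<le> x $ 1" "x $ 1 < 1" "0 \<le> x $ 2" "x $ 2 < 1" unfolding kK by linarith+
      then show ?thesis by (simp add: rect_def)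
    qed
  qed
  have cellu: "z = z'" if "x \<in> cell s z" "x \<in> cell s z'" for x z z'
    using that index_unique[OF s, of "fst z" "x $ 1" "fst z'"] index_unique[OF s, of "snd z" "x $ 2" "snd z'"]
    by (intro prod_eqI) (auto simp: cell_def rect_def)
  show "disjoint_family_on (cell s) Z" using cellu unfolding disjoint_family_on_def by blast
  have blocku: "z = z'" if "x \<in> block s K z" "x \<in> block s K z'" for x z z'
  proof -
    have sK: "0 < real K * s" using s K by simp
    show ?thesis
      using that index_unique[OF sK, of "fst z" "x $ 1" "fst z'"] index_unique[OF sK, of "snd z" "x $ 2" "snd z'"]
      by (intro prod_eqI) (auto simp: block_def rect_def algebra_simps)
  qed
  show "disjoint_family_on (block s K) Z" using blocku unfolding disjoint_family_on_def by blast
  have sub: "block_core s K z \<subseteq> block s K z" for z using s by (auto simp: block_core_def block_def rect_def)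
  show "disjoint_family_on (block_core s K) Z" using blocku sub unfolding disjoint_family_on_def by blast
  show "(\<Union>z\<in>Z'. block_core s K z) \<inter> (\<Union>z\<in>edge_cells k K. cell s z) = {}"
  proof (rule ccontr)
    assume "(\<Union>z\<in>Z'. block_core s K z) \<inter> (\<Union>z\<in>edge_cells k K. cell s z) \<noteq> {}"
    then obtain x z w where x: "x \<in> block_core s K z" "x \<in> cell s w" "w \<in> edge_cells k K" by blast
    then have "\<not> edge_index K (fst w)" "\<not> edge_index K (snd w)"
      using core_index(2)[OF s K, of "fst z" "x $ 1" "fst w"] core_index(2)[OF s K, of "snd z" "x $ 2" "snd w"]
      by (auto simp: block_core_def cell_def rect_def)
    then show False using x(3) by (simp add: edge_cells_def)
  qed
qed

text \<open>Cells whose indices agree modulo three are equal or separated by two full cells, so their neighbourhoods are disjoint.\<close>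

lemma cell_nbhd_disjoint:
  assumes s: "0 < s"
  shows "disjoint_family_on (cell_nbhd s) {z \<in> Z. fst z mod 3 = c \<and> snd z mod 3 = d}"
proof -
  have far: "i = j" if "i mod 3 = j mod 3" "real i * s - s \<le> u" "u < real (i + 1) * s + s" "real j * s - s \<le> u" "u < real (j + 1) * s + s"
    for i j :: nat and u
  proof -
    have "real i * s < real (j + 3) * s" "real j * s < real (i + 3) * s" using that by (simp_all add: algebra_simps)
    then have "i < j + 3" "j < i + 3" by (simp_all only: mult_less_cancel_right_pos[OF s] of_nat_less_iff)
    \<comment> \<open>Two indices at distance less than three that agree modulo three are equal.\<close>
    moreover have "i = 3 * (i div 3) + i mod 3" "j = 3 * (j div 3) + j mod 3" by simp_all
    ultimately show ?thesis using that(1) by arith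
  qed
  show ?thesis unfolding disjoint_family_on_def
  proof (intro ballI impI)
    fix z w assume zw: "z \<in> {z \<in> Z. fst z mod 3 = c \<and> snd z mod 3 = d}" "w \<in> {z \<in> Z. fst z mod 3 = c \<and> snd z mod 3 = d}" "z \<noteq> w"
    show "cell_nbhd s z \<inter> cell_nbhd s w = {}"
    proof (rule ccontr)
      assume "cell_nbhd s z \<inter> cell_nbhd s w \<noteq> {}"
      then obtain x where x: "x \<in> cell_nbhd s z" "x \<in> cell_nbhd s w" by blast
      have "fst z = fst w" by (rule far[of _ _ "x $ 1"]) (use zw x in \<open>auto simp: cell_nbhd_def rect_def\<close>)
      moreover have "snd z = snd w" by (rule far[of _ _ "x $ 2"]) (use zw x in \<open>auto simp: cell_nbhd_def rect_def\<close>)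
      ultimately show False using zw(3) prod_eqI by blast
    qed
  qed
qed

lemma card_edge_cells:
  assumes "0 < K"
  shows "finite (edge_cells k K)" "card (edge_cells k K) \<le> 4 * K * k\<^sup>2"
proof -
  define E where "E = {i \<in> {..<k * K}. edge_index K i}"
  have "E \<subseteq> (\<lambda>(a, m). a * K + m) ` ({..<k} \<times> {0, K - 1})"
  proof
    fix i assume i: "i \<in> E"
    then have "i div K < k" by (simp add: E_def less_mult_imp_div_less)
    moreover have "i mod K \<in> {0, K - 1}" using i by (auto simp: E_def edge_index_def)
    ultimately show "i \<in> (\<lambda>(a, m). a * K + m) ` ({..<k} \<times> {0, K - 1})"
      by (intro image_eqI[of _ _ "(i div K, i mod K)"]) auto
  qed
  then have "card E \<le> card ((\<lambda>(a, m). a * K + m) ` ({..<k} \<times> {0, K - 1}))" by (intro card_mono) auto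
  also have "\<dots> \<le> card ({..<k} \<times> {0, K - 1})" by (rule card_image_le) simp
  also have "\<dots> \<le> k * 2" by (simp add: card_cartesian_product card_insert_le_m1)
  finally have E: "card E \<le> 2 * k" by simp
  have Efin: "finite E" by (simp add: E_def)
  have sub: "edge_cells k K \<subseteq> (E \<times> {..<k * K}) \<union> ({..<k * K} \<times> E)"
    by (auto simp: edge_cells_def E_def)
  show "finite (edge_cells k K)" by (rule finite_subset[OF sub]) (use Efin in auto)
  have "card (edge_cells k K) \<le> card ((E \<times> {..<k * K}) \<union> ({..<k * K} \<times> E))"
    using sub Efin by (intro card_mono) auto
  also have "\<dots> \<le> card (E \<times> {..<k * K}) + card ({..<k * K} \<times> E)" by (rule card_Un_le)
  also have "\<dots> = 2 * (card E * (k * K))" by (simp add: card_cartesian_product)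
  also have "\<dots> \<le> 2 * (2 * k * (k * K))" using E by (intro mult_le_mono) auto
  finally show "card (edge_cells k K) \<le> 4 * K * k\<^sup>2" by (simp add: power2_eq_square mult_ac)
qed

section \<open>Splitting the count into block cores and edge cells\<close>

text \<open>Hoelder's inequality with exponent \<open>p\<close> for the main part and with the same exponent \<open>q (card C)\<close> for each of the remaining parts.\<close>

lemma (in prob_space) lmgf_holder:
  fixes X Y :: "'a \<Rightarrow> real" and Z :: "'c \<Rightarrow> 'a \<Rightarrow> real"
  assumes C: "finite C" "C \<noteq> {}" and p: "0 < p" "0 < q" "1 / p + 1 / q = 1"
    and X: "\<And>\<omega>. \<omega> \<in> space M \<Longrightarrow> X \<omega> = Y \<omega> + (\<Sum>c\<in>C. Z c \<omega>)"
    and Xi: "integrable M (\<lambda>\<omega>. exp (e * X \<omega>))"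
    and Yi: "integrable M Y" "integrable M (\<lambda>\<omega>. exp (p * e * Y \<omega>))"
    and Zi: "\<And>c. c \<in> C \<Longrightarrow> integrable M (Z c)" "\<And>c. c \<in> C \<Longrightarrow> integrable M (\<lambda>\<omega>. exp (q * real (card C) * e * Z c \<omega>))"
  shows "lmgf M X e \<le> 1 / p * lmgf M Y (p * e) + (\<Sum>c\<in>C. 1 / (q * real (card C)) * lmgf M (Z c) (q * real (card C) * e))"
proof -
  define N where "N = real (card C)"
  have N: "N > 0" using C by (simp add: N_def card_gt_0_iff)
  \<comment> \<open>The index \<open>None\<close> stands for the main part.\<close>
  define G where "G = (\<lambda>c \<omega>. case c of None \<Rightarrow> p * e * (Y \<omega> - expectation Y) | Some c \<Rightarrow> q * N * e * (Z c \<omega> - expectation (Z c)))"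
  define w where "w = (\<lambda>c :: 'c option. case c of None \<Rightarrow> 1 / p | Some c \<Rightarrow> 1 / (q * N))"
  define C' where "C' = insert None (Some ` C)"
  have C': "finite C'" using C by (simp add: C'_def)
  have sumC': "sum f C' = f None + (\<Sum>c\<in>C. f (Some c))" for f :: "'c option \<Rightarrow> real"
  proof -
    have "None \<notin> Some ` C" by auto
    then show ?thesis unfolding C'_def using C by (simp add: sum.reindex)
  qed
  have shift: "integrable M (\<lambda>\<omega>. exp (a * (V \<omega> - m)))" if "integrable M (\<lambda>\<omega>. exp (a * V \<omega>))" for a m and V :: "'a \<Rightarrow> real"
  proof -
    have "(\<lambda>\<omega>. exp (a * (V \<omega> - m))) = (\<lambda>\<omega>. exp (- (a * m)) * exp (a * V \<omega>))"
      by (auto simp: algebra_simps simp flip: exp_add)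
    then show ?thesis using that by simp
  qed
  have EX: "expectation X = expectation Y + (\<Sum>c\<in>C. expectation (Z c))"
  proof -
    have "expectation X = expectation (\<lambda>\<omega>. Y \<omega> + (\<Sum>c\<in>C. Z c \<omega>))" using X by (intro Bochner_Integration.integral_cong) auto
    then show ?thesis using Yi Zi by (simp add: Bochner_Integration.integral_sum)
  qed
  have sumG: "(\<Sum>c\<in>C'. w c * G c \<omega>) = e * (X \<omega> - expectation X)" if "\<omega> \<in> space M" for \<omega>
    unfolding sumC' EX X[OF that] using p N
    by (simp add: w_def G_def algebra_simps sum_subtractf sum_distrib_left)
  have i1: "integrable M (\<lambda>\<omega>. exp (\<Sum>c\<in>C'. w c * G c \<omega>))"
    using shift[OF Xi, of "expectation X"] by (subst Bochner_Integration.integrable_cong[OF refl, of _ _ "\<lambda>\<omega>. exp (e * (X \<omega> - expectation X))"]) (simp_all add: sumG)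
  have "lmgf M X e = ln (expectation (\<lambda>\<omega>. exp (\<Sum>c\<in>C'. w c * G c \<omega>)))"
    unfolding lmgf_def by (intro arg_cong[where f=ln] Bochner_Integration.integral_cong) (simp_all add: sumG)
  also have "\<dots> \<le> (\<Sum>c\<in>C'. w c * ln (expectation (\<lambda>\<omega>. exp (G c \<omega>))))"
  proof (rule ln_expectation_exp_convex[OF C' _ _ _ i1])
    show "0 \<le> w c" for c using p N by (auto simp: w_def split: option.splits)
    show "sum w C' = 1" unfolding sumC' using p N by (simp add: w_def N_def)
    show "integrable M (\<lambda>\<omega>. exp (G c \<omega>))" if "c \<in> C'" for c
      using that shift[OF Yi(2)] shift[OF Zi(2)] by (auto simp: C'_def G_def N_def)
  qed
  also have "\<dots> = 1 / p * lmgf M Y (p * e) + (\<Sum>c\<in>C. 1 / (q * N) * lmgf M (Z c) (q * N * e))"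
    unfolding sumC' by (simp add: w_def G_def lmgf_def)
  finally show ?thesis by (simp add: N_def)
qed

lemma weighted_count_Un:
  assumes "finite F" "A \<inter> B = {}"
  shows "weighted_count \<theta> \<tau> (A \<union> B) F = weighted_count \<theta> \<tau> A F + weighted_count \<theta> \<tau> B F"
  using weighted_count_UN[OF assms(1), of "{True, False}" "\<lambda>b. if b then A else B" \<theta> \<tau>] assms(2)
  by (simp add: disjoint_family_on_def Int_commute Un_commute)

text \<open>The circumcenter is interior to the convex hull of the triple, hence to the unit square; so half-open cells cover all circumcenters.\<close>

lemma weighted_count_unit_square:
  assumes "F \<subseteq> cbox 0 1"
  shows "weighted_count \<theta> \<tau> UNIV F = weighted_count \<theta> \<tau> (rect 0 1 0 1) F"
proof -
  have "circumcenter Y \<in> rect 0 1 0 1" if "Y \<subseteq> F" "morse_cond s Y" for Y s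
  proof -
    have "convex hull Y \<subseteq> cbox 0 1" using that(1) assms by (intro hull_minimal convex_box) auto
    then have "interior (convex hull Y) \<subseteq> box 0 1" using interior_mono interior_cbox by blast
    then have "circumcenter Y \<in> box 0 1" using that(2) by (auto simp: morse_cond_def)
    then show ?thesis by (simp add: mem_box Basis_2 inner_axis rect_def)
  qed
  then have "critical_in s UNIV F = critical_in s (rect 0 1 0 1) F" for s by (auto simp: critical_in_def)
  then show ?thesis by (simp add: weighted_count_def)
qed

text \<open>The unit square consists of \<open>k\<close> by \<open>k\<close> blocks, each of \<open>K\<close> by \<open>K\<close> cells of side \<open>s\<close>, and \<open>s\<close> dominates all radii.\<close>

locale morse_grid =
  fixes M :: "'w measure" and P :: "'w \<Rightarrow> (real^2) set" and lam s :: real and K k :: nat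
    and \<tau> \<theta> :: "'m::finite \<Rightarrow> real"
  assumes poi: "poisson_point_process M (cbox 0 1) lam P" and lam: "0 \<le> lam"
    and \<tau>: "\<And>i. 0 < \<tau> i" "\<And>i. \<tau> i \<le> s" and s: "0 < s" and K: "3 \<le> K" and kK: "real (k * K) * s = 1"
begin

sublocale prob_space M using poissonD(1)[OF poi] .

definition core_sum :: "'w \<Rightarrow> real" where
  "core_sum \<omega> = (\<Sum>z\<in>{..<k} \<times> {..<k}. weighted_count \<theta> \<tau> (block_core s K z) (P \<omega>))"

definition colour :: "nat \<times> nat \<Rightarrow> (nat \<times> nat) set" where
  "colour c = {z \<in> edge_cells k K. fst z mod 3 = fst c \<and> snd z mod 3 = snd c}"

definition edge_sum :: "nat \<times> nat \<Rightarrow> 'w \<Rightarrow> real" where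
  "edge_sum c \<omega> = (\<Sum>z\<in>colour c. weighted_count \<theta> \<tau> (cell s z) (P \<omega>))"

abbreviation colours :: "(nat \<times> nat) set" where "colours \<equiv> {..<3} \<times> {..<3}"

lemma unit_sets: "cbox 0 1 \<in> sets (borel :: (real^2) measure)" "emeasure lborel (cbox 0 (1 :: real^2)) < \<infinity>"
  using emeasure_bounded_finite[OF bounded_cbox] by auto

lemmas weighted_count_integrable = weighted_count_exp_integrable[OF poi lam unit_sets]

lemma Kpos: "0 < K" using K by simp

lemma finite_edges: "finite (edge_cells k K)" by (rule card_edge_cells(1)[OF Kpos])

lemma total_eq:
  assumes "\<omega> \<in> space M"
  shows "weighted_count \<theta> \<tau> UNIV (P \<omega>) = core_sum \<omega> + (\<Sum>c\<in>colours. edge_sum c \<omega>)"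
proof -
  have F: "finite (P \<omega>)" "P \<omega> \<subseteq> cbox 0 1" using poissonD(2,3)[OF poi assms] .
  note part = unit_partition[OF s Kpos kK]
  have "weighted_count \<theta> \<tau> UNIV (P \<omega>) = weighted_count \<theta> \<tau> (\<Union>z\<in>{..<k} \<times> {..<k}. block_core s K z) (P \<omega>) + weighted_count \<theta> \<tau> (\<Union>z\<in>edge_cells k K. cell s z) (P \<omega>)"
    unfolding weighted_count_unit_square[OF F(2)] part(1) by (rule weighted_count_Un[OF F(1) part(4)])
  also have "weighted_count \<theta> \<tau> (\<Union>z\<in>{..<k} \<times> {..<k}. block_core s K z) (P \<omega>) = core_sum \<omega>"
    unfolding core_sum_def by (rule weighted_count_UN[OF F(1) _ part(3)]) simp
  also have "weighted_count \<theta> \<tau> (\<Union>z\<in>edge_cells k K. cell s z) (P \<omega>) = (\<Sum>z\<in>edge_cells k K. weighted_count \<theta> \<tau> (cell s z) (P \<omega>))"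
    by (rule weighted_count_UN[OF F(1) finite_edges part(2)])
  also have "\<dots> = (\<Sum>c\<in>colours. \<Sum>z\<in>{z \<in> edge_cells k K. (fst z mod 3, snd z mod 3) = c}. weighted_count \<theta> \<tau> (cell s z) (P \<omega>))"
    by (rule sum.group[OF finite_edges, symmetric]) auto
  also have "\<dots> = (\<Sum>c\<in>colours. edge_sum c \<omega>)"
    unfolding edge_sum_def colour_def by (intro sum.cong refl) auto
  finally show ?thesis .
qed

lemma core_local: "a \<in> block_core s K z \<Longrightarrow> cball a (\<tau> i) \<subseteq> block s K z"
  using cball_rect[of a _ _ _ _ "\<tau> i" s] \<tau>(2) s unfolding block_core_def block_def by fastforce

lemma cell_local: "a \<in> cell s z \<Longrightarrow> cball a (\<tau> i) \<subseteq> cell_nbhd s z"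
  using cball_rect[of a _ _ _ _ "\<tau> i" s] \<tau>(2) s unfolding cell_def cell_nbhd_def by blast

lemma sets_cells [measurable]: "cell s z \<in> sets borel" "cell_nbhd s z \<in> sets borel" "block s K z \<in> sets borel" "block_core s K z \<in> sets borel"
  by (simp_all add: cell_def cell_nbhd_def block_def block_core_def)

lemma block_subset: "z \<in> {..<k} \<times> {..<k} \<Longrightarrow> block s K z \<subseteq> cbox 0 1"
proof -
  assume z: "z \<in> {..<k} \<times> {..<k}"
  have le: "real ((a + 1) * K) * s \<le> 1" if "a < k" for a
  proof -
    have "(a + 1) * K \<le> k * K" using that by (intro mult_le_mono1) simp
    then have "real ((a + 1) * K) * s \<le> real (k * K) * s" using s by (intro mult_right_mono) (simp_all only: of_nat_le_iff less_imp_le)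
    then show ?thesis unfolding kK .
  qed
  show ?thesis unfolding block_def using le z s by (intro rect_subset_unit) auto
qed

lemma measure_block: "measure lborel (block s K z) = (real K * s)\<^sup>2"
  and measure_block_core: "measure lborel (block_core s K z) = ((real K - 2) * s)\<^sup>2"
  and measure_cell_nbhd: "measure lborel (cell_nbhd s z) = 9 * s\<^sup>2"
proof -
  have K2: "2 * s \<le> real K * s" using K s by (intro mult_right_mono) auto
  show "measure lborel (block s K z) = (real K * s)\<^sup>2"
    unfolding block_def using s by (subst measure_rect) (auto simp: algebra_simps power2_eq_square)
  show "measure lborel (block_core s K z) = ((real K - 2) * s)\<^sup>2"
    unfolding block_core_def using s K2 by (subst measure_rect) (auto simp: algebra_simps power2_eq_square)
  show "measure lborel (cell_nbhd s z) = 9 * s\<^sup>2"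
    unfolding cell_nbhd_def using s by (subst measure_rect) (auto simp: algebra_simps power2_eq_square)
qed

definition block_mean :: real where "block_mean = lam * (real K * s)\<^sup>2"

definition Q :: real where
  "Q = acute_volume / 6 * (\<Sum>i\<in>UNIV. \<Sum>j\<in>UNIV. \<theta> i * \<theta> j * min (\<tau> i) (\<tau> j) ^ 4)"

lemma k_eq: "(real k)\<^sup>2 * (real K * s)\<^sup>2 = 1"
  using kK by (simp add: power_mult_distrib[symmetric] mult.assoc)

text \<open>There are at most \<open>4 K k\<^sup>2\<close> edge cells, and \<open>k\<^sup>2 = 1 / (K s)\<^sup>2\<close>. With \<open>\<mu> \<le> 9 lam s\<^sup>2\<close> per cell the sum of the coarse bounds is a
multiple of \<open>lam\<^sup>3 s\<^sup>4 / K\<close>.\<close>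

lemma edge_lmgf:
  assumes e: "\<bar>e\<bar> * weight_bound \<theta> \<le> 1" and mu: "9 * lam * s\<^sup>2 \<le> 1"
  shows "lmgf M (edge_sum c) e \<le> e\<^sup>2 * lam ^ 3 * s ^ 4 * (2916 * (weight_bound \<theta>)\<^sup>2 * tail_const / real K)"
proof -
  have fin: "finite (colour c)" using finite_edges by (simp add: colour_def)
  have "lmgf M (edge_sum c) e = (\<Sum>z\<in>colour c. lmgf M (\<lambda>\<omega>. weighted_count \<theta> \<tau> (cell s z) (P \<omega>)) e)"
    unfolding edge_sum_def
  proof (rule lmgf_sum_local[OF poi lam unit_sets fin, where R="cell_nbhd s"])
    show "disjoint_family_on (cell_nbhd s) (colour c)" unfolding colour_def by (rule cell_nbhd_disjoint[OF s])
  qed (use cell_local in auto)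
  also have "\<dots> \<le> (\<Sum>z\<in>colour c. e\<^sup>2 * (weight_bound \<theta>)\<^sup>2 * ((9 * lam * s\<^sup>2) ^ 3 * tail_const))"
  proof (rule sum_mono)
    fix z
    have "measure lborel (cbox 0 1 \<inter> cell_nbhd s z) \<le> 9 * s\<^sup>2"
    proof -
      have "measure lborel (cbox 0 1 \<inter> cell_nbhd s z) \<le> measure lborel (cell_nbhd s z)"
        using unit_sets(1) rect_borel fmeasurableI2[OF fmeasurable_cbox rect_between(2)]
        by (intro measure_mono_fmeasurable) (auto simp: cell_nbhd_def)
      then show ?thesis by (simp add: measure_cell_nbhd)
    qed
    then have m: "lam * measure lborel (cbox 0 1 \<inter> cell_nbhd s z) \<le> 9 * lam * s\<^sup>2"
      using mult_left_mono[OF _ lam] by fastforce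
    interpret cluster_var M "cbox 0 1" lam P "cell_nbhd s z" "9 * lam * s\<^sup>2" "weight_bound \<theta>" "\<lambda>\<omega>. weighted_count \<theta> \<tau> (cell s z) (P \<omega>)"
      by (rule weighted_count_cluster[OF poi lam unit_sets _ m mu _ cell_local]) auto
    show "lmgf M (\<lambda>\<omega>. weighted_count \<theta> \<tau> (cell s z) (P \<omega>)) e \<le> e\<^sup>2 * (weight_bound \<theta>)\<^sup>2 * ((9 * lam * s\<^sup>2) ^ 3 * tail_const)"
      by (rule lmgf_coarse[OF e])
  qed
  also have "\<dots> = real (card (colour c)) * (e\<^sup>2 * (weight_bound \<theta>)\<^sup>2 * ((9 * lam * s\<^sup>2) ^ 3 * tail_const))" by simp
  also have "\<dots> \<le> real (4 * K * k\<^sup>2) * (e\<^sup>2 * (weight_bound \<theta>)\<^sup>2 * ((9 * lam * s\<^sup>2) ^ 3 * tail_const))"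
  proof (rule mult_right_mono)
    have "card (colour c) \<le> card (edge_cells k K)" using finite_edges by (intro card_mono) (auto simp: colour_def)
    also have "\<dots> \<le> 4 * K * k\<^sup>2" by (rule card_edge_cells(2)[OF Kpos])
    finally show "real (card (colour c)) \<le> real (4 * K * k\<^sup>2)" by (simp only: of_nat_le_iff)
  qed (use lam tail_const_ge_1 in simp)
  also have "\<dots> = e\<^sup>2 * lam ^ 3 * s ^ 4 * (2916 * (weight_bound \<theta>)\<^sup>2 * tail_const / real K)"
  proof -
    have "real K * (real k)\<^sup>2 * s\<^sup>2 = 1 / real K"
      using k_eq Kpos by (simp add: power_mult_distrib power2_eq_square field_simps)
    moreover have "real (4 * K * k\<^sup>2) * (9 * lam * s\<^sup>2) ^ 3 = 2916 * lam ^ 3 * s ^ 4 * (real K * (real k)\<^sup>2 * s\<^sup>2)"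
      by (simp add: power_mult_distrib power_mult[symmetric] eval_nat_numeral mult_ac)
    ultimately have "real (4 * K * k\<^sup>2) * (9 * lam * s\<^sup>2) ^ 3 = 2916 * lam ^ 3 * s ^ 4 * (1 / real K)"
      by (simp only:)
    then show ?thesis by (simp add: mult_ac)
  qed
  finally show ?thesis .
qed

text \<open>The inner parts of the \<open>k\<^sup>2\<close> blocks have total area \<open>(1 - 2 / K)\<^sup>2\<close>, which produces the main term. The errors are \<open>k\<^sup>2 \<mu>\<^sup>3\<close> times
small factors, and \<open>k\<^sup>2 \<mu>\<^sup>3\<close> is \<open>lam\<^sup>3 s\<^sup>4 K\<^sup>4\<close>.\<close>

lemma main_lmgf:
  assumes e: "\<bar>e\<bar> * weight_bound \<theta> \<le> 1" and mm: "block_mean \<le> 1" "6 * (block_mean ^ 3 * tail_const) \<le> 1"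
  shows "\<bar>lmgf M core_sum e - e\<^sup>2 / 2 * lam ^ 3 * Q * (1 - 2 / real K)\<^sup>2\<bar>
     \<le> e\<^sup>2 * lam ^ 3 * s ^ 4 * (real K ^ 4 * (6 * (weight_bound \<theta>)\<^sup>2 * tail_const * block_mean
        + 3 * \<bar>e\<bar> * weight_bound \<theta> ^ 3 * tail_const + 18 * (weight_bound \<theta>)\<^sup>2 * tail_const\<^sup>2 * block_mean ^ 3))"
proof -
  define B where "B = e\<^sup>2 / 2 * (12 * (weight_bound \<theta>)\<^sup>2 * (block_mean ^ 4 * tail_const)) + \<bar>e\<bar> ^ 3 * (3 * weight_bound \<theta> ^ 3 * (block_mean ^ 3 * tail_const))
    + 18 * e\<^sup>2 * (weight_bound \<theta>)\<^sup>2 * (block_mean ^ 3 * tail_const)\<^sup>2"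
  define m where "m = e\<^sup>2 / 2 * (lam ^ 3 * ((real K - 2) * s)\<^sup>2 * Q)"
  have mub: "0 \<le> block_mean" using lam by (simp add: block_mean_def)
  have one: "\<bar>lmgf M (\<lambda>\<omega>. weighted_count \<theta> \<tau> (block_core s K z) (P \<omega>)) e - m\<bar> \<le> B" if z: "z \<in> {..<k} \<times> {..<k}" for z
  proof -
    have "lam * measure lborel (cbox 0 1 \<inter> block s K z) \<le> block_mean"
      using block_subset[OF z] measure_block by (simp add: Int_absorb1 block_mean_def)
    note mb = this mm(1)
    interpret cluster_var M "cbox 0 1" lam P "block s K z" block_mean "weight_bound \<theta>" "\<lambda>\<omega>. weighted_count \<theta> \<tau> (block_core s K z) (P \<omega>)"
      by (rule weighted_count_cluster[OF poi lam unit_sets _ mb _ core_local]) auto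
    have "\<bar>expectation (\<lambda>\<omega>. (weighted_count \<theta> \<tau> (block_core s K z) (P \<omega>))\<^sup>2) - lam ^ 3 * measure lborel (block_core s K z) * Q\<bar>
        \<le> 12 * (weight_bound \<theta>)\<^sup>2 * (block_mean ^ 4 * tail_const)"
      unfolding Q_def
      by (rule weighted_count_second_moment[OF poi lam unit_sets _ mb _ core_local block_subset[OF z] \<tau>(1)]) auto
    then have "\<bar>expectation (\<lambda>\<omega>. (weighted_count \<theta> \<tau> (block_core s K z) (P \<omega>))\<^sup>2) - lam ^ 3 * ((real K - 2) * s)\<^sup>2 * Q\<bar>
        \<le> 12 * (weight_bound \<theta>)\<^sup>2 * (block_mean ^ 4 * tail_const)"
      unfolding measure_block_core .
    then have "e\<^sup>2 / 2 * \<bar>expectation (\<lambda>\<omega>. (weighted_count \<theta> \<tau> (block_core s K z) (P \<omega>))\<^sup>2) - lam ^ 3 * ((real K - 2) * s)\<^sup>2 * Q\<bar>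
        \<le> e\<^sup>2 / 2 * (12 * (weight_bound \<theta>)\<^sup>2 * (block_mean ^ 4 * tail_const))"
      by (rule mult_left_mono) simp
    moreover have "\<bar>e\<^sup>2 / 2 * expectation (\<lambda>\<omega>. (weighted_count \<theta> \<tau> (block_core s K z) (P \<omega>))\<^sup>2) - m\<bar>
        = e\<^sup>2 / 2 * \<bar>expectation (\<lambda>\<omega>. (weighted_count \<theta> \<tau> (block_core s K z) (P \<omega>))\<^sup>2) - lam ^ 3 * ((real K - 2) * s)\<^sup>2 * Q\<bar>"
      unfolding m_def right_diff_distrib[symmetric] abs_mult by simp
    ultimately have "\<bar>e\<^sup>2 / 2 * expectation (\<lambda>\<omega>. (weighted_count \<theta> \<tau> (block_core s K z) (P \<omega>))\<^sup>2) - m\<bar>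
        \<le> e\<^sup>2 / 2 * (12 * (weight_bound \<theta>)\<^sup>2 * (block_mean ^ 4 * tail_const))"
      by simp
    moreover have "0 \<le> 18 * e\<^sup>2 * (weight_bound \<theta>)\<^sup>2 * (block_mean ^ 3 * tail_const)\<^sup>2" by simp
    moreover have "\<bar>e\<bar> ^ 3 * (weight_bound \<theta> ^ 3 * (block_mean ^ 3 * tail_const)) \<le> \<bar>e\<bar> ^ 3 * (3 * weight_bound \<theta> ^ 3 * (block_mean ^ 3 * tail_const))"
      using weight_bound_nonneg[of \<theta>] mub by (intro mult_left_mono) auto
    ultimately show ?thesis
      using lmgf_fine_upper[OF e] lmgf_fine_lower[OF e mm(2)] unfolding B_def by linarith
  qed
  have fin: "finite ({..<k} \<times> {..<k})" by simp
  have sum: "lmgf M core_sum e = (\<Sum>z\<in>{..<k} \<times> {..<k}. lmgf M (\<lambda>\<omega>. weighted_count \<theta> \<tau> (block_core s K z) (P \<omega>)) e)"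
    unfolding core_sum_def
  proof (rule lmgf_sum_local[OF poi lam unit_sets fin, where R="block s K"])
    show "disjoint_family_on (block s K) ({..<k} \<times> {..<k})" by (rule unit_partition(5)[OF s Kpos kK])
  qed (use core_local in auto)
  have "\<bar>lmgf M core_sum e - (real k)\<^sup>2 * m\<bar> = \<bar>\<Sum>z\<in>{..<k} \<times> {..<k}. (lmgf M (\<lambda>\<omega>. weighted_count \<theta> \<tau> (block_core s K z) (P \<omega>)) e - m)\<bar>"
    unfolding sum by (simp add: sum_subtractf card_cartesian_product power2_eq_square)
  also have "\<dots> \<le> (\<Sum>z\<in>{..<k} \<times> {..<k}. B)"
    by (rule order_trans[OF sum_abs]) (intro sum_mono one)
  also have "\<dots> = (real k)\<^sup>2 * B" by (simp add: card_cartesian_product power2_eq_square)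
  finally have main: "\<bar>lmgf M core_sum e - (real k)\<^sup>2 * m\<bar> \<le> (real k)\<^sup>2 * B" .
  have ks: "real k * s = 1 / real K" using kK Kpos by (simp add: field_simps)
  have "(real k)\<^sup>2 * m = e\<^sup>2 / 2 * lam ^ 3 * Q * (1 - 2 / real K)\<^sup>2"
  proof -
    have "real k * ((real K - 2) * s) = (real K - 2) * (real k * s)" by (simp add: mult_ac)
    also have "\<dots> = 1 - 2 / real K" unfolding ks using Kpos by (simp add: field_simps)
    finally have "(real k)\<^sup>2 * ((real K - 2) * s)\<^sup>2 = (1 - 2 / real K)\<^sup>2" by (simp add: power_mult_distrib[symmetric])
    then show ?thesis unfolding m_def by (simp add: mult_ac)
  qed
  moreover have "(real k)\<^sup>2 * B = e\<^sup>2 * lam ^ 3 * s ^ 4 * (real K ^ 4 * (6 * (weight_bound \<theta>)\<^sup>2 * tail_const * block_mean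
        + 3 * \<bar>e\<bar> * weight_bound \<theta> ^ 3 * tail_const + 18 * (weight_bound \<theta>)\<^sup>2 * tail_const\<^sup>2 * block_mean ^ 3))"
  proof -
    have "(real k)\<^sup>2 * block_mean ^ 3 = lam ^ 3 * ((real k)\<^sup>2 * (real K * s)\<^sup>2) * (real K * s) ^ 4"
      unfolding block_mean_def by (simp add: power_mult_distrib power_mult[symmetric] eval_nat_numeral mult_ac)
    then have k3: "(real k)\<^sup>2 * block_mean ^ 3 = lam ^ 3 * s ^ 4 * real K ^ 4" unfolding k_eq by (simp add: power_mult_distrib mult_ac)
    have "(real k)\<^sup>2 * B = ((real k)\<^sup>2 * block_mean ^ 3) * e\<^sup>2 * (6 * (weight_bound \<theta>)\<^sup>2 * tail_const * block_mean
        + 3 * \<bar>e\<bar> * weight_bound \<theta> ^ 3 * tail_const + 18 * (weight_bound \<theta>)\<^sup>2 * tail_const\<^sup>2 * block_mean ^ 3)"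
    proof -
      have e3: "\<bar>e\<bar> ^ 3 = e\<^sup>2 * \<bar>e\<bar>" by (simp add: power3_eq_cube power2_eq_square[symmetric])
      show ?thesis unfolding B_def e3 by (simp add: power_mult_distrib eval_nat_numeral algebra_simps)
    qed
    then show ?thesis unfolding k3 by (simp add: mult_ac)
  qed
  ultimately show ?thesis using main by simp
qed

lemma sums_integrable:
  "integrable M core_sum" "integrable M (\<lambda>\<omega>. exp (a * core_sum \<omega>))"
  "integrable M (edge_sum c)" "integrable M (\<lambda>\<omega>. exp (a * edge_sum c \<omega>))"
proof -
  have U: "(\<Union>z\<in>{..<k} \<times> {..<k}. block_core s K z) \<in> sets borel" by auto
  have mainU: "core_sum \<omega> = weighted_count \<theta> \<tau> (\<Union>z\<in>{..<k} \<times> {..<k}. block_core s K z) (P \<omega>)" if "\<omega> \<in> space M" for \<omega>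
    unfolding core_sum_def by (rule weighted_count_UN[symmetric, OF poissonD(2)[OF poi that] _ unit_partition(3)[OF s Kpos kK]]) simp
  show "integrable M core_sum" "integrable M (\<lambda>\<omega>. exp (a * core_sum \<omega>))"
    using weighted_count_integrable(2)[OF U] weighted_count_integrable(1)[OF U] mainU by (auto cong: Bochner_Integration.integrable_cong)
  have fin: "finite (colour c)" using finite_edges by (simp add: colour_def)
  have V: "(\<Union>z\<in>colour c. cell s z) \<in> sets borel" using fin by auto
  have edgeV: "edge_sum c \<omega> = weighted_count \<theta> \<tau> (\<Union>z\<in>colour c. cell s z) (P \<omega>)" if "\<omega> \<in> space M" for \<omega>
    unfolding edge_sum_def by (rule weighted_count_UN[symmetric, OF poissonD(2)[OF poi that] fin unit_partition(2)[OF s Kpos kK]])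
  show "integrable M (edge_sum c)" "integrable M (\<lambda>\<omega>. exp (a * edge_sum c \<omega>))"
    using weighted_count_integrable(2)[OF V] weighted_count_integrable(1)[OF V] edgeV by (auto cong: Bochner_Integration.integrable_cong)
qed

lemma colours_ne: "finite colours" "colours \<noteq> {}"
proof -
  have "(0, 0) \<in> colours" by simp
  then show "colours \<noteq> {}" by blast
qed simp

lemma total_upper:
  assumes p: "0 < p" "0 < q" "1 / p + 1 / q = 1"
  shows "lmgf M (\<lambda>\<omega>. weighted_count \<theta> \<tau> UNIV (P \<omega>)) e \<le> 1 / p * lmgf M core_sum (p * e) + (\<Sum>c\<in>colours. 1 / (9 * q) * lmgf M (edge_sum c) (9 * q * e))"
proof -
  have "lmgf M (\<lambda>\<omega>. weighted_count \<theta> \<tau> UNIV (P \<omega>)) e \<le> 1 / p * lmgf M core_sum (p * e)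
     + (\<Sum>c\<in>colours. 1 / (q * real (card colours)) * lmgf M (edge_sum c) (q * real (card colours) * e))"
    by (rule lmgf_holder[OF colours_ne p total_eq]) (auto intro: sums_integrable weighted_count_integrable)
  then show ?thesis by (simp add: card_cartesian_product mult_ac)
qed

text \<open>Hoelder's inequality with the roles exchanged: the core sum is the total minus the edge sums.\<close>

lemma total_lower:
  assumes p: "0 < p" "0 < q" "1 / p + 1 / q = 1"
  shows "lmgf M core_sum e \<le> 1 / p * lmgf M (\<lambda>\<omega>. weighted_count \<theta> \<tau> UNIV (P \<omega>)) (p * e) + (\<Sum>c\<in>colours. 1 / (9 * q) * lmgf M (edge_sum c) (- (9 * q * e)))"
proof -
  have "lmgf M core_sum e \<le> 1 / p * lmgf M (\<lambda>\<omega>. weighted_count \<theta> \<tau> UNIV (P \<omega>)) (p * e)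
     + (\<Sum>c\<in>colours. 1 / (q * real (card colours)) * lmgf M (\<lambda>\<omega>. - edge_sum c \<omega>) (q * real (card colours) * e))"
  proof (rule lmgf_holder[OF colours_ne p])
    fix \<omega> assume "\<omega> \<in> space M"
    then show "core_sum \<omega> = weighted_count \<theta> \<tau> UNIV (P \<omega>) + (\<Sum>c\<in>colours. - edge_sum c \<omega>)"
      using total_eq by (simp add: sum_negf)
  next
    show "integrable M (\<lambda>\<omega>. exp (q * real (card colours) * e * - edge_sum c \<omega>))" for c
      using sums_integrable(4)[of "- (q * real (card colours) * e)" c] by simp
  qed (auto intro: sums_integrable weighted_count_integrable)
  moreover have "lmgf M (\<lambda>\<omega>. - edge_sum c \<omega>) a = lmgf M (edge_sum c) (- a)" for c a
    by (simp add: lmgf_def algebra_simps)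
  ultimately show ?thesis by (simp add: card_cartesian_product mult_ac)
qed

end

section \<open>Limit of the log moment generating function\<close>

text \<open>The quadratic form of the limiting covariance matrix, see \<open>Gamma_quadratic\<close>.\<close>

definition limit_form :: "('m::finite \<Rightarrow> real) \<Rightarrow> ('m \<Rightarrow> real) \<Rightarrow> real" where
  "limit_form \<theta> t = acute_volume / 6 * (\<Sum>i\<in>UNIV. \<Sum>j\<in>UNIV. \<theta> i * \<theta> j * min (t i) (t j) ^ 4)"

text \<open>The relative error of the block cores; it vanishes as \<open>e\<close> and the mean \<open>\<mu>\<close> tend to \<open>0\<close> while \<open>K\<close> stays fixed.\<close>

definition grid_err :: "('m::finite \<Rightarrow> real) \<Rightarrow> real \<Rightarrow> real \<Rightarrow> real \<Rightarrow> real \<Rightarrow> real" where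
  "grid_err \<theta> T K e \<mu> = 16 * T ^ 4 * (K ^ 4 * (6 * (weight_bound \<theta>)\<^sup>2 * tail_const * \<mu>
     + 6 * e * weight_bound \<theta> ^ 3 * tail_const + 18 * (weight_bound \<theta>)\<^sup>2 * tail_const\<^sup>2 * \<mu> ^ 3))"

definition edge_const :: "('m::finite \<Rightarrow> real) \<Rightarrow> real \<Rightarrow> real" where
  "edge_const \<theta> T = 16 * T ^ 4 * (2916 * (weight_bound \<theta>)\<^sup>2 * tail_const)"

text \<open>The number of blocks is chosen such that \<open>T r \<le> s \<le> 2 T r\<close>; the first inequality gives locality and the second converts \<open>lam\<^sup>3 s\<^sup>4\<close>
into a multiple of \<open>lam\<^sup>3 r\<^sup>4\<close>. The exponents \<open>p\<close> and \<open>q\<close> come from Hoelder's inequality.\<close>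

lemma total_lmgf_bounds:
  fixes \<theta> t :: "'m::finite \<Rightarrow> real"
  assumes poi: "poisson_point_process M (cbox 0 1) lam P" and lam: "0 \<le> lam"
    and r: "0 < r" and t: "\<And>i. 0 < t i" "\<And>i. t i \<le> T" and K: "3 \<le> K"
    and small: "real K * T * r \<le> 1 / 2" and p: "1 < p" "p \<le> 2" "1 / p + 1 / q = 1"
    and e: "0 \<le> e" "18 * q * e * weight_bound \<theta> \<le> 1"
    and mu: "\<mu> = 4 * (real K)\<^sup>2 * T\<^sup>2 * (lam * r\<^sup>2)" "\<mu> \<le> 1" "6 * (\<mu> ^ 3 * tail_const) \<le> 1"
  defines "W \<equiv> \<lambda>\<omega>. weighted_count \<theta> (\<lambda>i. r * t i) UNIV (P \<omega>)"
  shows "lmgf M W e \<le> e\<^sup>2 * (lam ^ 3 * r ^ 4) * (p * (limit_form \<theta> t / 2 * (1 - 2 / real K)\<^sup>2 + grid_err \<theta> T (real K) e \<mu>) + 81 * q * edge_const \<theta> T / real K)"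
    and "e\<^sup>2 * (lam ^ 3 * r ^ 4) * (1 / p * (limit_form \<theta> t / 2 * (1 - 2 / real K)\<^sup>2 - grid_err \<theta> T (real K) e \<mu>) - 81 * q * edge_const \<theta> T / real K) \<le> lmgf M W e"
proof -
  have T: "0 < T" using t[of undefined] by linarith
  have Kp: "0 < real K" using K by simp
  have q: "1 \<le> q"
  proof -
    have "1 / q = 1 - 1 / p" using p by linarith
    also have "\<dots> > 0" using p by simp
    finally have q0: "0 < q" by simp
    have "0 \<le> 1 / p" using p by simp
    then have "1 / q \<le> 1" using p by linarith
    then show ?thesis using q0 by simp
  qed
  have KTr: "0 < real K * T * r" using Kp T r by simp
  define v where "v = 1 / (real K * T * r)"
  define k where "k = nat \<lfloor>v\<rfloor>"
  define s where "s = 1 / (real k * real K)"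
  have inv2: "2 \<le> v" using small KTr by (simp add: v_def le_divide_eq)
  then have "0 \<le> \<lfloor>v\<rfloor>" by linarith
  then have kr: "real k = real_of_int \<lfloor>v\<rfloor>" by (simp add: k_def)
  have k1: "real k \<le> v" "v < real k + 1" unfolding kr by linarith+
  have k2: "v / 2 \<le> real k" using k1 inv2 by linarith
  have kpos: "0 < real k" using k2 inv2 by linarith
  have s: "0 < s" "real (k * K) * s = 1" using kpos Kp by (simp_all add: s_def)
  have sT: "T * r \<le> s"
  proof -
    have "real k * (real K * T * r) \<le> 1" using k1(1) KTr by (simp add: v_def le_divide_eq)
    then have "T * r * (real k * real K) \<le> 1" by (simp add: mult_ac)
    then show ?thesis unfolding s_def using kpos Kp by (simp add: le_divide_eq)
  qed
  have s2T: "s \<le> 2 * T * r"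
  proof -
    have "1 \<le> 2 * real k * (real K * T * r)" using k2 KTr by (simp add: v_def divide_le_eq)
    then show ?thesis unfolding s_def using kpos Kp by (simp add: divide_le_eq mult_ac)
  qed
  interpret g: morse_grid M P lam s K k "\<lambda>i. r * t i" \<theta>
  proof
    show "r * t i \<le> s" for i
    proof -
      have "r * t i \<le> r * T" using t(2)[of i] r by (intro mult_left_mono) auto
      then show ?thesis using sT by (simp add: mult.commute)
    qed
  qed (use poi lam r t K s in auto)
  define \<rho> where "\<rho> = lam ^ 3 * r ^ 4"
  have rho: "0 \<le> \<rho>" using lam r by (simp add: \<rho>_def)
  have Q: "lam ^ 3 * g.Q = \<rho> * limit_form \<theta> t"
  proof -
    have "min (r * t i) (r * t j) = r * min (t i) (t j)" for i j using r by (simp add: min_def)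
    then show ?thesis by (simp add: g.Q_def limit_form_def \<rho>_def power_mult_distrib sum_distrib_left mult_ac)
  qed
  have ls: "lam ^ 3 * s ^ 4 \<le> 16 * T ^ 4 * \<rho>"
  proof -
    have "s ^ 4 \<le> (2 * T * r) ^ 4" using s s2T by (intro power_mono) auto
    then have "lam ^ 3 * s ^ 4 \<le> lam ^ 3 * (2 * T * r) ^ 4" using lam by (intro mult_left_mono) auto
    then show ?thesis by (simp add: \<rho>_def power_mult_distrib mult_ac)
  qed
  have ss: "s\<^sup>2 \<le> 4 * T\<^sup>2 * r\<^sup>2"
    using power_mono[OF s2T, of 2] s by (simp add: power_mult_distrib)
  have mub: "g.block_mean \<le> \<mu>"
  proof -
    have "lam * (real K)\<^sup>2 * s\<^sup>2 \<le> lam * (real K)\<^sup>2 * (4 * T\<^sup>2 * r\<^sup>2)" using ss lam by (intro mult_left_mono) auto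
    then show ?thesis by (simp add: g.block_mean_def mu(1) power_mult_distrib mult_ac)
  qed
  have mub0: "0 \<le> g.block_mean" using lam by (simp add: g.block_mean_def)
  have mu_c: "9 * lam * s\<^sup>2 \<le> 1"
  proof -
    have "9 \<le> (real K)\<^sup>2" using power_mono[of 3 "real K" 2] K by simp
    then have "9 * (lam * s\<^sup>2) \<le> (real K)\<^sup>2 * (lam * s\<^sup>2)" using lam by (intro mult_right_mono) auto
    then have "9 * lam * s\<^sup>2 \<le> g.block_mean" by (simp add: g.block_mean_def power_mult_distrib mult_ac)
    then show ?thesis using mub mu(2) by linarith
  qed
  have mub3: "6 * (g.block_mean ^ 3 * tail_const) \<le> 1"
  proof -
    have "g.block_mean ^ 3 * tail_const \<le> \<mu> ^ 3 * tail_const"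
      using mub mub0 tail_const_ge_1 by (intro mult_right_mono power_mono) auto
    then show ?thesis using mu(3) by linarith
  qed
  define m where "m = limit_form \<theta> t / 2 * (1 - 2 / real K)\<^sup>2"
  define E where "E = grid_err \<theta> T (real K) e \<mu>"
  define D where "D = edge_const \<theta> T"
  have main: "\<bar>lmgf M g.core_sum a - a\<^sup>2 * \<rho> * m\<bar> \<le> a\<^sup>2 * \<rho> * E" if a: "0 \<le> a" "a \<le> 2 * e" for a
  proof -
    define G where "G = real K ^ 4 * (6 * (weight_bound \<theta>)\<^sup>2 * tail_const * g.block_mean
        + 3 * \<bar>a\<bar> * weight_bound \<theta> ^ 3 * tail_const + 18 * (weight_bound \<theta>)\<^sup>2 * tail_const\<^sup>2 * g.block_mean ^ 3)"
    define G' where "G' = real K ^ 4 * (6 * (weight_bound \<theta>)\<^sup>2 * tail_const * \<mu>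
        + 6 * e * weight_bound \<theta> ^ 3 * tail_const + 18 * (weight_bound \<theta>)\<^sup>2 * tail_const\<^sup>2 * \<mu> ^ 3)"
    have "a * weight_bound \<theta> \<le> 2 * e * weight_bound \<theta>" using a weight_bound_nonneg by (intro mult_right_mono) auto
    also have "\<dots> \<le> 18 * q * e * weight_bound \<theta>" using q e weight_bound_nonneg by (intro mult_right_mono) auto
    finally have aw: "\<bar>a\<bar> * weight_bound \<theta> \<le> 1" using e a by simp
    have "3 * \<bar>a\<bar> * weight_bound \<theta> ^ 3 * tail_const \<le> 6 * e * weight_bound \<theta> ^ 3 * tail_const"
      using a weight_bound_nonneg tail_const_ge_1 by (intro mult_right_mono) auto
    moreover have "6 * (weight_bound \<theta>)\<^sup>2 * tail_const * g.block_mean \<le> 6 * (weight_bound \<theta>)\<^sup>2 * tail_const * \<mu>"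
      using mub tail_const_ge_1 by (intro mult_left_mono) auto
    moreover have "18 * (weight_bound \<theta>)\<^sup>2 * tail_const\<^sup>2 * g.block_mean ^ 3 \<le> 18 * (weight_bound \<theta>)\<^sup>2 * tail_const\<^sup>2 * \<mu> ^ 3"
      using mub mub0 by (intro mult_left_mono power_mono) auto
    ultimately have GG: "G \<le> G'" unfolding G_def G'_def by - (rule mult_left_mono, linarith, simp)
    have G0: "0 \<le> G" unfolding G_def using mub0 weight_bound_nonneg[of \<theta>] tail_const_ge_1 by simp
    have "\<bar>lmgf M g.core_sum a - a\<^sup>2 / 2 * lam ^ 3 * g.Q * (1 - 2 / real K)\<^sup>2\<bar> \<le> a\<^sup>2 * lam ^ 3 * s ^ 4 * G"
      unfolding G_def using mub mu(2) mub3 by (intro g.main_lmgf aw) auto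
    moreover have "a\<^sup>2 / 2 * lam ^ 3 * g.Q * (1 - 2 / real K)\<^sup>2 = a\<^sup>2 * \<rho> * m"
    proof -
      have "a\<^sup>2 / 2 * lam ^ 3 * g.Q * (1 - 2 / real K)\<^sup>2 = a\<^sup>2 / 2 * (lam ^ 3 * g.Q) * (1 - 2 / real K)\<^sup>2"
        by (simp only: mult.assoc)
      also have "\<dots> = a\<^sup>2 * \<rho> * m" unfolding Q m_def by simp
      finally show ?thesis .
    qed
    moreover have "a\<^sup>2 * lam ^ 3 * s ^ 4 * G \<le> a\<^sup>2 * \<rho> * E"
    proof -
      have "(lam ^ 3 * s ^ 4) * G \<le> (16 * T ^ 4 * \<rho>) * G'"
        by (rule mult_mono[OF ls GG]) (use G0 T rho in auto)
      then have "a\<^sup>2 * ((lam ^ 3 * s ^ 4) * G) \<le> a\<^sup>2 * ((16 * T ^ 4 * \<rho>) * G')" by (intro mult_left_mono) auto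
      moreover have "E = 16 * T ^ 4 * G'" unfolding E_def grid_err_def G'_def ..
      ultimately show ?thesis by (simp add: mult_ac)
    qed
    ultimately show ?thesis by linarith
  qed
  have edge: "lmgf M (g.edge_sum c) a \<le> a\<^sup>2 * \<rho> * (D / real K)" if a: "\<bar>a\<bar> \<le> 9 * q * e" for a c
  proof -
    have "\<bar>a\<bar> * weight_bound \<theta> \<le> 9 * q * e * weight_bound \<theta>" using a weight_bound_nonneg by (intro mult_right_mono) auto
    also have "\<dots> \<le> 18 * q * e * weight_bound \<theta>" using q e weight_bound_nonneg by (intro mult_right_mono) auto
    finally have aw: "\<bar>a\<bar> * weight_bound \<theta> \<le> 1" using e by linarith
    have "lmgf M (g.edge_sum c) a \<le> a\<^sup>2 * lam ^ 3 * s ^ 4 * (2916 * (weight_bound \<theta>)\<^sup>2 * tail_const / real K)"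
      by (rule g.edge_lmgf[OF aw mu_c])
    also have "\<dots> = a\<^sup>2 * ((lam ^ 3 * s ^ 4) * (2916 * (weight_bound \<theta>)\<^sup>2 * tail_const / real K))" by simp
    also have "\<dots> \<le> a\<^sup>2 * ((16 * T ^ 4 * \<rho>) * (2916 * (weight_bound \<theta>)\<^sup>2 * tail_const / real K))"
      by (rule mult_left_mono[OF mult_right_mono[OF ls]]) auto
    also have "\<dots> = a\<^sup>2 * \<rho> * (D / real K)" by (simp add: D_def edge_const_def mult_ac)
    finally show ?thesis .
  qed
  have D0: "0 \<le> D" unfolding D_def edge_const_def using T tail_const_ge_1 by simp
  have edges: "(\<Sum>c\<in>g.colours. 1 / (9 * q) * lmgf M (g.edge_sum c) (f a)) \<le> 81 * q * a\<^sup>2 * \<rho> * (D / real K)"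
    if a: "0 \<le> a" "a \<le> e" and f: "\<And>x. \<bar>f x\<bar> = 9 * q * \<bar>x\<bar>" for a and f :: "real \<Rightarrow> real"
  proof -
    have "(\<Sum>c\<in>g.colours. 1 / (9 * q) * lmgf M (g.edge_sum c) (f a)) \<le> (\<Sum>c\<in>g.colours. 1 / (9 * q) * ((9 * q * a)\<^sup>2 * \<rho> * (D / real K)))"
    proof (intro sum_mono mult_left_mono)
      fix c
      have "\<bar>f a\<bar> \<le> 9 * q * e" unfolding f using a q by simp
      from edge[OF this, of c] have "lmgf M (g.edge_sum c) (f a) \<le> (f a)\<^sup>2 * \<rho> * (D / real K)" .
      moreover have "(f a)\<^sup>2 = (9 * q * a)\<^sup>2" using f[of a] a q by (metis abs_of_nonneg power2_abs)
      ultimately show "lmgf M (g.edge_sum c) (f a) \<le> (9 * q * a)\<^sup>2 * \<rho> * (D / real K)" by simp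
    qed (use q in simp)
    also have "\<dots> = 81 * q * a\<^sup>2 * \<rho> * (D / real K)"
      using q by (simp add: card_cartesian_product power2_eq_square)
    finally show ?thesis .
  qed
  have p0: "0 < p" "0 < q" using p q by linarith+
  show "lmgf M W e \<le> e\<^sup>2 * (lam ^ 3 * r ^ 4) * (p * (limit_form \<theta> t / 2 * (1 - 2 / real K)\<^sup>2 + grid_err \<theta> T (real K) e \<mu>) + 81 * q * edge_const \<theta> T / real K)"
  proof -
    have "lmgf M W e \<le> 1 / p * lmgf M g.core_sum (p * e) + (\<Sum>c\<in>g.colours. 1 / (9 * q) * lmgf M (g.edge_sum c) (9 * q * e))"
      unfolding W_def by (rule g.total_upper[OF p0 p(3)])
    also have "\<dots> \<le> 1 / p * ((p * e)\<^sup>2 * \<rho> * (m + E)) + 81 * q * e\<^sup>2 * \<rho> * (D / real K)"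
    proof (rule add_mono)
      have "lmgf M g.core_sum (p * e) \<le> (p * e)\<^sup>2 * \<rho> * m + (p * e)\<^sup>2 * \<rho> * E"
        using main[of "p * e"] p e mult_right_mono[of p 2 e] by auto
      then show "1 / p * lmgf M g.core_sum (p * e) \<le> 1 / p * ((p * e)\<^sup>2 * \<rho> * (m + E))"
        using p0 by (intro mult_left_mono) (simp_all add: distrib_left)
      show "(\<Sum>c\<in>g.colours. 1 / (9 * q) * lmgf M (g.edge_sum c) (9 * q * e)) \<le> 81 * q * e\<^sup>2 * \<rho> * (D / real K)"
        by (rule edges[of e "\<lambda>x. 9 * q * x"]) (use e q in \<open>auto simp: abs_mult\<close>)
    qed
    also have "\<dots> = e\<^sup>2 * \<rho> * (p * (m + E) + 81 * q * D / real K)"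
      using p0 by (simp add: power2_eq_square algebra_simps)
    finally show ?thesis by (simp add: \<rho>_def m_def E_def D_def)
  qed
  show "e\<^sup>2 * (lam ^ 3 * r ^ 4) * (1 / p * (limit_form \<theta> t / 2 * (1 - 2 / real K)\<^sup>2 - grid_err \<theta> T (real K) e \<mu>) - 81 * q * edge_const \<theta> T / real K) \<le> lmgf M W e"
  proof -
    define a where "a = e / p"
    have a: "0 \<le> a" "a \<le> e" using e p mult_left_mono[of 1 p e] by (simp_all add: a_def divide_le_eq)
    have pa: "p * a = e" using p0 by (simp add: a_def)
    have "lmgf M g.core_sum a \<le> 1 / p * lmgf M W (p * a) + (\<Sum>c\<in>g.colours. 1 / (9 * q) * lmgf M (g.edge_sum c) (- (9 * q * a)))"
      unfolding W_def by (rule g.total_lower[OF p0 p(3)])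
    moreover have "(\<Sum>c\<in>g.colours. 1 / (9 * q) * lmgf M (g.edge_sum c) (- (9 * q * a))) \<le> 81 * q * a\<^sup>2 * \<rho> * (D / real K)"
      by (rule edges[of a "\<lambda>x. - (9 * q * x)"]) (use a q in \<open>auto simp: abs_mult\<close>)
    moreover have "a\<^sup>2 * \<rho> * m - a\<^sup>2 * \<rho> * E \<le> lmgf M g.core_sum a" using main[of a] a e by auto
    ultimately have "a\<^sup>2 * \<rho> * m - a\<^sup>2 * \<rho> * E - 81 * q * a\<^sup>2 * \<rho> * (D / real K) \<le> 1 / p * lmgf M W e"
      unfolding pa by linarith
    from mult_left_mono[OF this, of p] have "p * (a\<^sup>2 * \<rho> * m - a\<^sup>2 * \<rho> * E - 81 * q * a\<^sup>2 * \<rho> * (D / real K)) \<le> lmgf M W e"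
      using p0 by simp
    moreover have "p * (a\<^sup>2 * \<rho> * m - a\<^sup>2 * \<rho> * E - 81 * q * a\<^sup>2 * \<rho> * (D / real K)) = e\<^sup>2 * \<rho> * (1 / p * (m - E) - 81 * q * (D / real K) / p)"
      using p0 by (simp add: a_def power2_eq_square field_simps)
    moreover have "e\<^sup>2 * \<rho> * (1 / p * (m - E) - 81 * q * (D / real K)) \<le> e\<^sup>2 * \<rho> * (1 / p * (m - E) - 81 * q * (D / real K) / p)"
    proof -
      have "0 \<le> 81 * q * (D / real K)" using q D0 by simp
      then have "81 * q * (D / real K) / p \<le> 81 * q * (D / real K)" using divide_left_mono[of 1 p "81 * q * (D / real K)"] p by simp
      then show ?thesis using rho by (intro mult_left_mono) auto
    qed
    ultimately show ?thesis by (simp add: \<rho>_def m_def E_def D_def)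
  qed
qed

text \<open>First \<open>p\<close> is taken close to \<open>1\<close>, which makes the conjugate exponent \<open>q\<close> large, and then \<open>K\<close> so large that it absorbs \<open>q\<close>.\<close>

lemma parameter_choice:
  fixes sg D \<delta> :: real
  assumes "0 \<le> sg" "0 \<le> D" "0 < \<delta>"
  shows "\<exists>p q (K::nat). 1 < p \<and> p \<le> 2 \<and> 1 / p + 1 / q = 1 \<and> 3 \<le> K \<and>
     (\<forall>E. 0 \<le> E \<and> E \<le> \<delta> / 8 \<longrightarrow>
        p * (sg / 2 * (1 - 2 / real K)\<^sup>2 + E) + 81 * q * D / real K < sg / 2 + \<delta> \<and>
        sg / 2 - \<delta> < 1 / p * (sg / 2 * (1 - 2 / real K)\<^sup>2 - E) - 81 * q * D / real K)"
proof -
  \<comment> \<open>The \<open>+ 1\<close> only avoids a division by zero.\<close>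
  define \<eta> where "\<eta> = min 1 (\<delta> / (2 * (sg + 1)))"
  have eta: "0 < \<eta>" "\<eta> \<le> 1" using assms by (simp_all add: \<eta>_def)
  have eta2: "\<eta> * (sg / 2) \<le> \<delta> / 4"
  proof -
    have "\<eta> * (sg / 2) \<le> \<delta> / (2 * (sg + 1)) * ((sg + 1) / 2)" using assms eta by (intro mult_mono) (auto simp: \<eta>_def)
    also have "\<dots> = \<delta> / 4" using assms by (simp add: field_simps)
    finally show ?thesis .
  qed
  define p q where "p = 1 + \<eta>" and "q = (1 + \<eta>) / \<eta>"
  have pq: "1 < p" "p \<le> 2" "1 / p + 1 / q = 1" "0 < q"
    using eta by (auto simp: p_def q_def add_divide_distrib[symmetric])
  obtain K :: nat where K: "max 3 ((81 * q * D + 2 * sg) * 4 / \<delta>) \<le> real K" using real_arch_simple by blast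
  then have K3: "3 \<le> real K" by simp
  have KD: "(81 * q * D + 2 * sg) / real K \<le> \<delta> / 4" using K K3 assms by (simp add: field_simps)
  have k1: "0 \<le> 81 * q * D / real K" "0 \<le> 2 * sg / real K" using pq assms by simp_all
  have KD2: "81 * q * D / real K \<le> \<delta> / 4 - 2 * sg / real K" using KD by (simp add: add_divide_distrib)
  define x where "x = (1 - 2 / real K)\<^sup>2"
  have x1: "x \<le> 1" "1 - 4 / real K \<le> x"
  proof -
    have "0 \<le> 2 / real K" "2 / real K \<le> 1" using K3 by simp_all
    then show "x \<le> 1" unfolding x_def by (simp add: power_le_one)
    have "x = 1 - 4 / real K + (2 / real K)\<^sup>2" by (simp add: x_def power2_eq_square algebra_simps)
    then show "1 - 4 / real K \<le> x" by simp
  qed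
  have x0: "0 \<le> x" by (simp add: x_def)
  show ?thesis
  proof (rule exI[of _ p], rule exI[of _ q], rule exI[of _ K], intro conjI allI impI)
    show "3 \<le> K" using K3 by simp
    fix E assume E: "0 \<le> E \<and> E \<le> \<delta> / 8"
    have "p * (sg / 2 * x + E) \<le> p * (sg / 2 + \<delta> / 8)"
      using E x1 assms pq mult_left_mono[of x 1 "sg / 2"] by (intro mult_left_mono) auto
    also have "\<dots> = sg / 2 + \<eta> * (sg / 2) + p * (\<delta> / 8)" by (simp add: p_def algebra_simps)
    also have "\<dots> \<le> sg / 2 + \<delta> / 4 + 2 * (\<delta> / 8)" using eta2 pq assms by (intro add_mono mult_right_mono) auto
    finally show "p * (sg / 2 * (1 - 2 / real K)\<^sup>2 + E) + 81 * q * D / real K < sg / 2 + \<delta>"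
      using KD2 k1 assms unfolding x_def by linarith
    have "1 - \<eta> \<le> 1 / p"
    proof -
      have "(1 - \<eta>) * (1 + \<eta>) \<le> 1" by (simp add: algebra_simps)
      then show ?thesis using eta by (simp add: p_def le_divide_eq)
    qed
    then have "(1 - \<eta>) * (sg / 2 * x) \<le> 1 / p * (sg / 2 * x)" using assms x0 by (intro mult_right_mono) auto
    moreover have "(1 - \<eta>) * (sg / 2 * x) = sg / 2 * x - \<eta> * (sg / 2) * x" by (simp add: left_diff_distrib mult.assoc)
    moreover have "\<eta> * (sg / 2) * x \<le> \<eta> * (sg / 2) * 1" using x1 eta assms by (intro mult_left_mono) auto
    moreover have "sg / 2 * (1 - 4 / real K) \<le> sg / 2 * x" using x1 assms by (intro mult_left_mono) auto
    moreover have "sg / 2 * (1 - 4 / real K) = sg / 2 - 2 * sg / real K" by (simp add: algebra_simps)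
    moreover have "1 / p * E \<le> 1 * E" using pq E by (intro mult_right_mono) auto
    moreover have "1 / p * (sg / 2 * x - E) = 1 / p * (sg / 2 * x) - 1 / p * E" by (simp add: right_diff_distrib)
    ultimately show "sg / 2 - \<delta> < 1 / p * (sg / 2 * (1 - 2 / real K)\<^sup>2 - E) - 81 * q * D / real K"
      using eta2 KD2 k1 E assms unfolding x_def by linarith
  qed (use pq in auto)
qed

lemma lmgf_limit:
  fixes M :: "nat \<Rightarrow> 'w measure" and \<theta> t :: "'m::finite \<Rightarrow> real" and r e :: "nat \<Rightarrow> real"
  assumes poi: "\<And>n. poisson_point_process (M n) (cbox 0 1) (real n) (P n)"
    and r: "\<And>n. 0 < r n" "r \<longlonglongrightarrow> 0" and t: "\<And>i. 0 < t i"
    and nr: "(\<lambda>n. real n * r n ^ 2) \<longlonglongrightarrow> 0"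
    and e: "\<And>n. 0 \<le> e n" "eventually (\<lambda>n. 0 < e n) sequentially" "e \<longlonglongrightarrow> 0"
    and sg: "0 \<le> limit_form \<theta> t"
  shows "(\<lambda>n. lmgf (M n) (\<lambda>\<omega>. weighted_count \<theta> (\<lambda>i. r n * t i) UNIV (P n \<omega>)) (e n) / ((e n)\<^sup>2 * (real n ^ 3 * r n ^ 4))) \<longlonglongrightarrow> limit_form \<theta> t / 2"
proof (rule tendstoI)
  fix \<delta> :: real assume d: "0 < \<delta>"
  define T where "T = Max (range t)"
  have tT: "t i \<le> T" for i by (simp add: T_def)
  have T: "0 < T" using t[of undefined] tT[of undefined] by linarith
  have D: "0 \<le> edge_const \<theta> T" unfolding edge_const_def using T tail_const_ge_1 by simp
  obtain p q K where pq: "1 < p" "p \<le> 2" "1 / p + 1 / q = 1" "3 \<le> (K::nat)" and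
    fin: "\<And>E. 0 \<le> E \<Longrightarrow> E \<le> \<delta> / 8 \<Longrightarrow>
        p * (limit_form \<theta> t / 2 * (1 - 2 / real K)\<^sup>2 + E) + 81 * q * edge_const \<theta> T / real K < limit_form \<theta> t / 2 + \<delta> \<and>
        limit_form \<theta> t / 2 - \<delta> < 1 / p * (limit_form \<theta> t / 2 * (1 - 2 / real K)\<^sup>2 - E) - 81 * q * edge_const \<theta> T / real K"
    using parameter_choice[OF sg D d] by blast
  define \<mu> where "\<mu> = (\<lambda>n. 4 * (real K)\<^sup>2 * T\<^sup>2 * (real n * (r n)\<^sup>2))"
  have mu0: "\<mu> \<longlonglongrightarrow> 0" unfolding \<mu>_def using tendsto_mult_right_zero[OF nr] by simp
  have "(\<lambda>n. real K * T * r n) \<longlonglongrightarrow> 0" using tendsto_mult_right_zero[OF r(2)] by simp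
  then have ev1: "eventually (\<lambda>n. real K * T * r n < 1 / 2) sequentially" by (rule order_tendstoD) simp
  have "(\<lambda>n. 18 * q * e n * weight_bound \<theta>) \<longlonglongrightarrow> 18 * q * 0 * weight_bound \<theta>" by (intro tendsto_intros e)
  then have ev2: "eventually (\<lambda>n. 18 * q * e n * weight_bound \<theta> < 1) sequentially" by (rule order_tendstoD) simp
  have ev3: "eventually (\<lambda>n. \<mu> n < 1) sequentially" using mu0 by (rule order_tendstoD) simp
  have "(\<lambda>n. 6 * (\<mu> n ^ 3 * tail_const)) \<longlonglongrightarrow> 6 * (0 ^ 3 * tail_const)" by (intro tendsto_intros mu0)
  then have ev4: "eventually (\<lambda>n. 6 * (\<mu> n ^ 3 * tail_const) < 1) sequentially" by (rule order_tendstoD) simp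
  have "(\<lambda>n. grid_err \<theta> T (real K) (e n) (\<mu> n)) \<longlonglongrightarrow> grid_err \<theta> T (real K) 0 0"
    unfolding grid_err_def by (intro tendsto_intros mu0 e)
  then have ev5: "eventually (\<lambda>n. grid_err \<theta> T (real K) (e n) (\<mu> n) < \<delta> / 8) sequentially"
    by (rule order_tendstoD) (use d in \<open>simp add: grid_err_def\<close>)
  show "eventually (\<lambda>n. dist (lmgf (M n) (\<lambda>\<omega>. weighted_count \<theta> (\<lambda>i. r n * t i) UNIV (P n \<omega>)) (e n) / ((e n)\<^sup>2 * (real n ^ 3 * r n ^ 4))) (limit_form \<theta> t / 2) < \<delta>) sequentially"
    using ev1 ev2 ev3 ev4 ev5 e(2) eventually_gt_at_top[of 0]
  proof eventually_elim
    case (elim n)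
    define L where "L = lmgf (M n) (\<lambda>\<omega>. weighted_count \<theta> (\<lambda>i. r n * t i) UNIV (P n \<omega>)) (e n)"
    define N where "N = (e n)\<^sup>2 * (real n ^ 3 * r n ^ 4)"
    have N: "0 < N" using elim r(1)[of n] by (simp add: N_def)
    have mun: "0 \<le> \<mu> n" by (simp add: \<mu>_def)
    have E: "0 \<le> grid_err \<theta> T (real K) (e n) (\<mu> n)"
      unfolding grid_err_def using T mun e(1)[of n] weight_bound_nonneg[of \<theta>] tail_const_ge_1 by simp
    have "L \<le> N * (p * (limit_form \<theta> t / 2 * (1 - 2 / real K)\<^sup>2 + grid_err \<theta> T (real K) (e n) (\<mu> n)) + 81 * q * edge_const \<theta> T / real K)"
      unfolding L_def N_def
      by (rule total_lmgf_bounds(1)[OF poi _ r(1) t tT pq(4) _ pq(1-3) e(1)]) (use elim in \<open>auto simp: \<mu>_def\<close>)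
    also have "\<dots> < N * (limit_form \<theta> t / 2 + \<delta>)" using fin[OF E] elim N by (intro mult_strict_left_mono) auto
    finally have u: "L / N < limit_form \<theta> t / 2 + \<delta>" using N by (simp add: divide_less_eq mult.commute)
    have "N * (limit_form \<theta> t / 2 - \<delta>) < N * (1 / p * (limit_form \<theta> t / 2 * (1 - 2 / real K)\<^sup>2 - grid_err \<theta> T (real K) (e n) (\<mu> n)) - 81 * q * edge_const \<theta> T / real K)"
      using fin[OF E] elim N by (intro mult_strict_left_mono) auto
    also have "\<dots> \<le> L"
      unfolding L_def N_def
      by (rule total_lmgf_bounds(2)[OF poi _ r(1) t tT pq(4) _ pq(1-3) e(1)]) (use elim in \<open>auto simp: \<mu>_def\<close>)
    finally have l: "limit_form \<theta> t / 2 - \<delta> < L / N" using N by (simp add: less_divide_eq mult.commute)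
    show ?case using u l unfolding L_def[symmetric] N_def[symmetric] dist_real_def by linarith
  qed
qed

section \<open>The covariance matrix and the moderate deviation principle\<close>

lemma min_power: "0 \<le> x \<Longrightarrow> 0 \<le> y \<Longrightarrow> min (x :: real) y ^ n = min (x ^ n) (y ^ n)"
  using power_mono[of x y n] power_mono[of y x n] by (cases "x \<le> y") (auto simp: min_def)

text \<open>The matrix of \<open>min (a\<^sub>i, a\<^sub>j)\<close> is the Gram matrix of the indicators of the intervals from \<open>0\<close> to \<open>a\<^sub>i\<close>. On the interval just below
the largest \<open>a\<^sub>i\<close> with nonzero coefficient, the linear combination is equal to that coefficient.\<close>

lemma min_kernel_pos:
  fixes \<theta> a :: "'m::finite \<Rightarrow> real"
  assumes a: "\<And>i. 0 < a i" "inj a" and nz: "\<theta> \<noteq> (\<lambda>_. 0)"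
  shows "0 < (\<Sum>i\<in>UNIV. \<Sum>j\<in>UNIV. \<theta> i * \<theta> j * min (a i) (a j))"
proof -
  define f where "f = (\<lambda>u. \<Sum>i\<in>UNIV. \<theta> i * indicator {0<..a i} u :: real)"
  have I: "has_bochner_integral lborel (indicator {0<..min (a i) (a j)}) (min (a i) (a j))" for i j
    using has_bochner_integral_real_indicator[of "{0<..min (a i) (a j)}" lborel] a(1)[of i] a(1)[of j] by simp
  have sq: "(f u)\<^sup>2 = (\<Sum>i\<in>UNIV. \<Sum>j\<in>UNIV. \<theta> i * \<theta> j * indicator {0<..min (a i) (a j)} u)" for u
    unfolding f_def power2_eq_square sum_product
    by (intro sum.cong refl) (auto simp: indicator_def)
  have B: "has_bochner_integral lborel (\<lambda>u. (f u)\<^sup>2) (\<Sum>i\<in>UNIV. \<Sum>j\<in>UNIV. \<theta> i * \<theta> j * min (a i) (a j))"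
    unfolding sq by (intro has_bochner_integral_sum has_bochner_integral_mult_right I)
  define Z where "Z = {i. \<theta> i \<noteq> 0}"
  have "Z \<noteq> {}" using nz by (auto simp: Z_def)
  then have "Max (a ` Z) \<in> a ` Z" by (intro Max_in) auto
  then obtain i0 where i0: "i0 \<in> Z" "a i0 = Max (a ` Z)" by auto
  have top: "a j \<le> a i0" if "\<theta> j \<noteq> 0" for j using that i0(2) by (simp add: Z_def)
  \<comment> \<open>The largest smaller value, or \<open>0\<close> if there is none.\<close>
  define l where "l = Max (insert 0 (a ` {j. a j < a i0}))"
  have l: "0 \<le> l" "l < a i0" using a(1)[of i0] by (auto simp: l_def)
  have lj: "a j \<le> l" if "a j < a i0" for j using that by (auto simp: l_def)
  have fu: "f u = \<theta> i0" if u: "l < u" "u \<le> a i0" for u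
  proof -
    have ind: "\<theta> j * indicator {0<..a j} u = (if j = i0 then \<theta> i0 else 0)" for j
    proof (cases "j = i0")
      case True then show ?thesis using u l by simp
    next
      case False
      then have "a j \<noteq> a i0" using a(2) by (auto simp: inj_def)
      show ?thesis
      proof (cases "a j < a i0")
        case True then show ?thesis using lj[OF True] u False by simp
      next
        case False2: False
        then have "\<theta> j = 0" using top[of j] \<open>a j \<noteq> a i0\<close> by fastforce
        then show ?thesis using False by simp
      qed
    qed
    show ?thesis unfolding f_def ind by simp
  qed
  have "0 < (\<theta> i0)\<^sup>2 * (a i0 - l)" using i0(1) l by (simp add: Z_def)
  also have "\<dots> = (\<integral>u. (\<theta> i0)\<^sup>2 * indicator {l<..a i0} u \<partial>lborel)" using l by simp
  also have "\<dots> \<le> (\<integral>u. (f u)\<^sup>2 \<partial>lborel)"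
  proof (rule integral_mono)
    show "integrable lborel (\<lambda>u. (\<theta> i0)\<^sup>2 * indicator {l<..a i0} u)"
      using l by (intro integrable_mult_right integrable_real_indicator) auto
    show "integrable lborel (\<lambda>u. (f u)\<^sup>2)" using B by (rule integrable.intros)
    show "(\<theta> i0)\<^sup>2 * indicator {l<..a i0} u \<le> (f u)\<^sup>2" for u using fu by (auto simp: indicator_def)
  qed
  also have "\<dots> = (\<Sum>i\<in>UNIV. \<Sum>j\<in>UNIV. \<theta> i * \<theta> j * min (a i) (a j))"
    using B by (rule has_bochner_integral_integral_eq)
  finally show ?thesis .
qed

lemma limit_form_pos:
  assumes t: "\<And>i. 0 < t i" "inj t" and nz: "\<theta> \<noteq> (\<lambda>_. 0)"
  shows "0 < limit_form \<theta> t"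
proof -
  have inj4: "inj (\<lambda>i. t i ^ 4)"
  proof (rule injI)
    fix i j assume "t i ^ 4 = t j ^ 4"
    then have "t i = t j" using t(1)[of i] t(1)[of j] by (metis less_imp_le power_eq_imp_eq_base zero_less_numeral)
    then show "i = j" using t(2) by (simp add: inj_eq)
  qed
  have "0 < (\<Sum>i\<in>UNIV. \<Sum>j\<in>UNIV. \<theta> i * \<theta> j * min (t i ^ 4) (t j ^ 4))"
  proof (rule min_kernel_pos)
    show "0 < t i ^ 4" for i using t(1)[of i] by simp
  qed (rule inj4, rule nz)
  moreover have "min (t i) (t j) ^ 4 = min (t i ^ 4) (t j ^ 4)" for i j
    using t(1)[of i] t(1)[of j] by (intro min_power) auto
  ultimately show ?thesis unfolding limit_form_def using acute_volume_pos by simp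
qed

text \<open>The product of two indicators is the indicator for the smaller radius, and the volume scales with the fourth power of the radius.\<close>

lemma Gamma_mat_entry:
  assumes "\<And>i. 0 < t i"
  shows "Gamma_mat t $ i $ j = acute_volume / 6 * min (t i) (t j) ^ 4"
proof -
  have "morse_h s 0 p q = of_bool (acute s p q)" for s p q
    using morse_cond_iff[of s 0 p q] by (simp add: morse_h_def)
  then have "(\<lambda>y. morse_h (t i) 0 (fst y) (snd y) * morse_h (t j) 0 (fst y) (snd y)) = indicator (acute_pairs (min (t i) (t j)))"
    by (auto simp: fun_eq_iff indicator_def acute_pairs_def acute_min)
  then have "(\<integral>y. morse_h (t i) 0 (fst y) (snd y) * morse_h (t j) 0 (fst y) (snd y) \<partial>lborel) = measure lborel (acute_pairs (min (t i) (t j)))"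
    by simp
  also have "\<dots> = min (t i) (t j) ^ 4 * acute_volume" using assms by (intro measure_acute_pairs) simp
  finally show ?thesis by (simp add: Gamma_mat_def)
qed

lemma Gamma_quadratic:
  assumes "\<And>i. 0 < t i"
  shows "x \<bullet> (Gamma_mat t *v x) = limit_form (\<lambda>i. x $ i) t"
  by (simp add: inner_vec_def matrix_vector_mult_def Gamma_mat_entry[OF assms] limit_form_def sum_distrib_left mult_ac)

lemma Gamma_selfadjoint:
  assumes "\<And>i. 0 < t i"
  shows "x \<bullet> (Gamma_mat t *v y) = (Gamma_mat t *v x) \<bullet> y"
proof -
  have "transpose (Gamma_mat t) = Gamma_mat t"
    by (simp add: transpose_def vec_eq_iff Gamma_mat_entry[OF assms] min.commute)
  then show ?thesis by (metis dot_lmul_matrix vector_transpose_matrix)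
qed

lemma Gamma_inverse:
  assumes t: "\<And>i. 0 < t i" "inj t"
  shows "Gamma_mat t *v (matrix_inv (Gamma_mat t) *v x) = x"
proof -
  have "x = 0" if "Gamma_mat t *v x = 0" for x
  proof (rule ccontr)
    assume "x \<noteq> 0"
    then have "(\<lambda>i. x $ i) \<noteq> (\<lambda>_. 0)" by (auto simp: vec_eq_iff fun_eq_iff)
    from limit_form_pos[OF t this] show False using Gamma_quadratic[of t x, OF t(1)] that by simp
  qed
  then have "\<exists>B. B ** Gamma_mat t = mat 1" by (subst matrix_left_invertible_ker) blast
  then have "invertible (Gamma_mat t)" by (simp add: invertible_left_inverse)
  then have "\<exists>B. Gamma_mat t ** B = mat 1 \<and> B ** Gamma_mat t = mat 1" by (simp add: invertible_def)
  then have "Gamma_mat t ** matrix_inv (Gamma_mat t) = mat 1 \<and> matrix_inv (Gamma_mat t) ** Gamma_mat t = mat 1"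
    unfolding matrix_inv_def by (rule someI_ex)
  then show ?thesis by (simp add: matrix_vector_mul_assoc)
qed

lemma inner_morse_count_vec:
  assumes "finite F"
  shows "x \<bullet> morse_count_vec r t F = weighted_count (\<lambda>i. x $ i) (\<lambda>i. r * t i) UNIV F"
proof -
  have "critical_in s UNIV F = critical s F" for s by (auto simp: critical_in_def critical_def)
  then show ?thesis by (simp add: inner_vec_def morse_count_vec_def weighted_count_def morse_count_eq_card[OF assms])
qed

lemma integrable_euclidean:
  fixes f :: "'w \<Rightarrow> 'a::euclidean_space"
  assumes "\<And>x. integrable M (\<lambda>\<omega>. x \<bullet> f \<omega>)"
  shows "integrable M f"
proof -
  have "integrable M (\<lambda>\<omega>. f \<omega> \<bullet> b)" for b using assms[of b] by (simp add: inner_commute)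
  then have "integrable M (\<lambda>\<omega>. \<Sum>b\<in>Basis. (f \<omega> \<bullet> b) *\<^sub>R b)"
    by (intro Bochner_Integration.integrable_sum) simp
  then show ?thesis by (simp add: euclidean_representation)
qed

theorem corollary2p15:
  fixes M :: "nat \<Rightarrow> 'w measure"
    and P :: "nat \<Rightarrow> 'w \<Rightarrow> (real^2) set"
    and r b \<rho> :: "nat \<Rightarrow> real"
    and t :: "'m::finite \<Rightarrow> real"
    and N :: "nat \<Rightarrow> 'w \<Rightarrow> real^'m"
    and L :: "nat \<Rightarrow> ereal"
    and A :: "(real^'m) set"
  assumes "\<And>n. poisson_point_process (M n) (cbox 0 1) (real n) (P n)"
    and "\<And>n. r n > 0" and "r \<longlonglongrightarrow> 0"
    and "\<And>i. t i > 0" and "inj t"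
    and \<rho>_def: "\<And>n. \<rho> n = real n ^ 3 * r n ^ 4"
    and "filterlim \<rho> at_top sequentially"
    and "(\<lambda>n. real n * r n ^ 2) \<longlonglongrightarrow> 0"
    and "\<And>n. b n > 0"
    and "filterlim (\<lambda>n. \<rho> n / b n) at_top sequentially"
    and "(\<lambda>n. \<rho> n / b n ^ 2) \<longlonglongrightarrow> 0"
    and N_def: "\<And>n \<omega>. N n \<omega> = morse_count_vec (r n) t (P n \<omega>)"
    and "A \<in> sets borel"
    and L_def: "\<And>n. L n = ereal (\<rho> n / b n ^ 2) *
        elog (measure (M n) {\<omega> \<in> space (M n). (1 / b n) *\<^sub>R centered (M n) (N n) \<omega> \<in> A})"
  shows "- (INF u\<in>interior A. ereal (rate_fun t u)) \<le> liminf L \<and>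
         liminf L \<le> limsup L \<and>
         limsup L \<le> - (INF u\<in>closure A. ereal (rate_fun t u))"
proof -
  note poi = assms(1) and rpos = assms(2) and r0 = assms(3) and tpos = assms(4) and injt = assms(5)
    and rho_top = assms(7) and nr = assms(8) and bpos = assms(9) and eps = assms(10) and speed = assms(11)
    and A = assms(13)
  note unit = emeasure_bounded_finite[OF bounded_cbox, of 0 "1 :: real^2"]
  define W where "W = (\<lambda>x n \<omega>. weighted_count (\<lambda>i. x $ i) (\<lambda>i. r n * t i) UNIV (P n \<omega>))"
  have WN: "x \<bullet> N n \<omega> = W x n \<omega>" if "\<omega> \<in> space (M n)" for x n \<omega>
    unfolding N_def W_def using poissonD(2)[OF poi that] by (rule inner_morse_count_vec)
  have cb: "cbox 0 1 \<in> sets (borel :: (real^2) measure)" "emeasure lborel (cbox 0 (1 :: real^2)) < \<infinity>"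
    using unit by auto
  have Wint: "integrable (M n) (\<lambda>\<omega>. exp (c * W x n \<omega>))" "integrable (M n) (W x n)" for x n c
    unfolding W_def using weighted_count_exp_integrable[where A=UNIV, OF poi _ cb] by simp_all
  have Nint: "integrable (M n) (N n)" for n
  proof (rule integrable_euclidean)
    fix x show "integrable (M n) (\<lambda>\<omega>. x \<bullet> N n \<omega>)"
      using Wint(2)[of n x] by (subst Bochner_Integration.integrable_cong[OF refl, of _ _ "W x n"]) (auto simp: WN)
  qed
  have Nmean: "x \<bullet> integral\<^sup>L (M n) (N n) = (\<integral>\<omega>. W x n \<omega> \<partial>M n)" for x n
  proof -
    have "x \<bullet> integral\<^sup>L (M n) (N n) = (\<integral>\<omega>. x \<bullet> N n \<omega> \<partial>M n)"
      using Nint by (intro integral_inner_right[symmetric]) auto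
    also have "\<dots> = (\<integral>\<omega>. W x n \<omega> \<partial>M n)" by (intro Bochner_Integration.integral_cong) (auto simp: WN)
    finally show ?thesis .
  qed
  define Z where "Z = (\<lambda>n \<omega>. (1 / b n) *\<^sub>R centered (M n) (N n) \<omega>)"
  have ZW: "x \<bullet> Z n \<omega> = (1 / b n) * (W x n \<omega> - (\<integral>\<omega>. W x n \<omega> \<partial>M n))" if "\<omega> \<in> space (M n)" for x n \<omega>
    unfolding Z_def centered_def using WN[OF that] Nmean by (simp add: inner_diff_right)
  define a where "a = (\<lambda>n. b n ^ 2 / \<rho> n)"
  define e where "e = (\<lambda>n. b n / \<rho> n)"
  have rho_ev: "eventually (\<lambda>n. 0 < \<rho> n) sequentially" using rho_top filterlim_at_top_dense by blast
  have rho0: "0 \<le> \<rho> n" for n unfolding \<rho>_def using rpos[of n] by simp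
  have a_top: "filterlim a at_top sequentially"
  proof -
    have "eventually (\<lambda>n. 0 < \<rho> n / b n ^ 2) sequentially" using rho_ev by eventually_elim (intro divide_pos_pos zero_less_power bpos)
    from filterlim_inverse_at_top[OF speed this] show ?thesis unfolding a_def by simp
  qed
  have e_lim: "e \<longlonglongrightarrow> 0"
    using tendsto_inverse_0_at_top[OF eps] unfolding e_def by simp
  have lim: "(\<lambda>n. ln (\<integral>\<omega>. exp (a n * (x \<bullet> Z n \<omega>)) \<partial>M n) / a n) \<longlonglongrightarrow> (x \<bullet> (Gamma_mat t *v x)) / 2" for x
  proof -
    have sg: "0 \<le> limit_form (\<lambda>i. x $ i) t"
      using limit_form_pos[OF tpos injt, of "\<lambda>i. x $ i"] by (cases "(\<lambda>i. x $ i) = (\<lambda>_. 0)") (auto simp: limit_form_def)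
    have "(\<lambda>n. lmgf (M n) (W x n) (e n) / ((e n)\<^sup>2 * (real n ^ 3 * r n ^ 4))) \<longlonglongrightarrow> limit_form (\<lambda>i. x $ i) t / 2"
      unfolding W_def
    proof (rule lmgf_limit[OF poi rpos r0 tpos nr _ _ e_lim sg])
      show "0 \<le> e n" for n using rho0[of n] bpos[of n] by (simp add: e_def)
      show "eventually (\<lambda>n. 0 < e n) sequentially" using rho_ev by eventually_elim (auto simp: e_def intro!: divide_pos_pos bpos)
    qed
    moreover have "eventually (\<lambda>n. lmgf (M n) (W x n) (e n) / ((e n)\<^sup>2 * (real n ^ 3 * r n ^ 4)) = ln (\<integral>\<omega>. exp (a n * (x \<bullet> Z n \<omega>)) \<partial>M n) / a n) sequentially"
      using rho_ev
    proof eventually_elim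
      case (elim n)
      have e1: "(e n)\<^sup>2 * \<rho> n = a n" using elim by (simp add: e_def a_def power2_eq_square)
      have e2: "a n * (1 / b n) = e n" using bpos[of n] by (simp add: e_def a_def power2_eq_square)
      have "(\<integral>\<omega>. exp (a n * (x \<bullet> Z n \<omega>)) \<partial>M n) = (\<integral>\<omega>. exp (e n * (W x n \<omega> - (\<integral>\<omega>. W x n \<omega> \<partial>M n))) \<partial>M n)"
        by (intro Bochner_Integration.integral_cong refl) (simp add: ZW e2[symmetric])
      then show ?case unfolding lmgf_def \<rho>_def[symmetric] e1 by simp
    qed
    ultimately show ?thesis unfolding Gamma_quadratic[of t, OF tpos] by (rule Lim_transform_eventually)
  qed
  interpret Q: quadratic_lmgf M Z a "\<lambda>x. Gamma_mat t *v x" "\<lambda>x. matrix_inv (Gamma_mat t) *v x"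
  proof (rule quadratic_lmgf.intro)
    show "prob_space (M n)" for n by (rule poissonD(1)[OF poi])
    show "Z n \<in> borel_measurable (M n)" for n
      unfolding Z_def centered_def using borel_measurable_integrable[OF Nint[of n]] by measurable
    show "integrable (M n) (\<lambda>\<omega>. exp (x \<bullet> Z n \<omega>))" for n x
    proof -
      have "integrable (M n) (\<lambda>\<omega>. exp (- ((1 / b n) * (\<integral>\<omega>. W x n \<omega> \<partial>M n))) * exp ((1 / b n) * W x n \<omega>))"
        using Wint(1)[of n "1 / b n" x] by simp
      then show ?thesis
        by (subst Bochner_Integration.integrable_cong[OF refl, where g="\<lambda>\<omega>. exp (- ((1 / b n) * (\<integral>\<omega>. W x n \<omega> \<partial>M n))) * exp ((1 / b n) * W x n \<omega>)"])
          (auto simp: ZW algebra_simps diff_divide_distrib simp flip: exp_add)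
    qed
    show "0 < x \<bullet> (Gamma_mat t *v x)" if "x \<noteq> 0" for x
      unfolding Gamma_quadratic[of t, OF tpos] by (rule limit_form_pos[OF tpos injt]) (use that in \<open>auto simp: vec_eq_iff fun_eq_iff\<close>)
  qed (use a_top lim Gamma_selfadjoint[of t, OF tpos] Gamma_inverse[of t, OF tpos injt] matrix_vector_mul_linear in auto)
  have rate: "rate_fun t u = Q.rate u" for u by (simp add: rate_fun_def Q.rate_def)
  define pr where "pr = (\<lambda>n. measure (M n) {\<omega> \<in> space (M n). Z n \<omega> \<in> A})"
  have La: "L n = ereal (1 / a n) * elog (pr n)" for n unfolding L_def pr_def Z_def a_def by simp
  have upper: "limsup L \<le> - (INF u\<in>closure A. ereal (rate_fun t u))"
  proof -
    have "(INF u\<in>closure A. ereal (rate_fun t u)) \<le> - limsup L"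
    proof (rule dense_le)
      fix z assume z: "z < (INF u\<in>closure A. ereal (rate_fun t u))"
      show "z \<le> - limsup L"
      proof (cases z)
        case (real c)
        show ?thesis
        proof (cases "0 \<le> c")
          case False
          \<comment> \<open>For a negative bound it suffices that probabilities are at most one.\<close>
          have "eventually (\<lambda>n. L n \<le> 0) sequentially"
            using Q.a_pos
          proof eventually_elim
            case (elim n)
            interpret prob_space "M n" by (rule Q.ps)
            have "elog (pr n) \<le> 0" unfolding elog_def pr_def by (auto simp: ln_le_zero_iff zero_less_measure_iff)
            then show ?case unfolding La using elim by (cases "elog (pr n)") (auto simp: mult_nonneg_nonpos divide_nonpos_pos)
          qed
          then have "limsup L \<le> 0" by (rule Limsup_bounded)
          then show ?thesis using False real by (cases "limsup L") auto
        next
          case True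
          obtain \<alpha> where \<alpha>: "c < \<alpha>" "ereal \<alpha> < (INF u\<in>closure A. ereal (rate_fun t u))"
            using ereal_dense2[OF z] real by auto
          have "\<alpha> \<le> Q.rate u" if "u \<in> A" for u
          proof -
            have "(INF u\<in>closure A. ereal (rate_fun t u)) \<le> ereal (rate_fun t u)"
              using that closure_subset by (intro INF_lower) blast
            then have "ereal \<alpha> \<le> ereal (rate_fun t u)" using \<alpha>(2) by (meson less_le_trans less_imp_le)
            then show ?thesis by (simp add: rate)
          qed
          then obtain C where C: "0 < C" "eventually (\<lambda>n. pr n \<le> C * exp (- (a n * c))) sequentially"
            using Q.upper_bound[OF _ True \<alpha>(1), of A] unfolding pr_def by blast
          have "eventually (\<lambda>n. L n \<le> ereal (ln C / a n - c)) sequentially"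
            using C(2) Q.a_pos
          proof eventually_elim
            case (elim n)
            show ?case
            proof (cases "pr n = 0")
              case True then show ?thesis unfolding La elog_def using elim by simp
            next
              case False
              then have pos: "0 < pr n" by (simp add: pr_def zero_less_measure_iff)
              then have "ln (pr n) \<le> ln (C * exp (- (a n * c)))" using elim(1) by (intro ln_mono) auto
              also have "\<dots> = ln C - a n * c" using C(1) by (simp add: ln_mult)
              finally have "1 / a n * ln (pr n) \<le> 1 / a n * (ln C - a n * c)" using elim by (intro mult_left_mono) auto
              also have "\<dots> = ln C / a n - c" using elim by (simp add: field_simps)
              finally show ?thesis unfolding La elog_def using False by simp
            qed
          qed
          then have "limsup L \<le> limsup (\<lambda>n. ereal (ln C / a n - c))" by (rule Limsup_mono)
          also have "limsup (\<lambda>n. ereal (ln C / a n - c)) = ereal (0 - c)"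
            by (intro lim_imp_Limsup tendsto_ereal tendsto_diff tendsto_const real_tendsto_divide_at_top[OF tendsto_const a_top]) simp
          finally show ?thesis using real by (cases "limsup L") auto
        qed
      qed (use z in auto)
    qed
    then have "- (- limsup L) \<le> - (INF u\<in>closure A. ereal (rate_fun t u))" by (simp only: ereal_minus_le_minus)
    then show ?thesis by simp
  qed
  have lower: "- (INF u\<in>interior A. ereal (rate_fun t u)) \<le> liminf L"
  proof -
    have "- liminf L \<le> (INF u\<in>interior A. ereal (rate_fun t u))"
    proof (rule INF_greatest)
      fix u assume "u \<in> interior A"
      then obtain d where d: "0 < d" "ball u d \<subseteq> A" by (auto simp: mem_interior)
      show "- liminf L \<le> ereal (rate_fun t u)"
      proof (rule ereal_le_epsilon2)
        fix \<eta> :: real assume eta: "0 < \<eta>"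
        have "eventually (\<lambda>n. ereal (- (Q.rate u + \<eta>)) \<le> L n) sequentially"
          using Q.lower_bound[OF d(2,1) A eta] Q.a_pos
        proof eventually_elim
          case (elim n)
          have pr: "exp (- (a n * (Q.rate u + \<eta>))) \<le> pr n" using elim(1) by (simp add: pr_def)
          then have pos: "0 < pr n" using exp_gt_zero less_le_trans by blast
          have "- (a n * (Q.rate u + \<eta>)) \<le> ln (pr n)" using pr pos by (simp add: ln_ge_iff)
          from mult_left_mono[OF this, of "1 / a n"]
          have "- (Q.rate u + \<eta>) \<le> 1 / a n * ln (pr n)" using elim by simp
          then show ?case unfolding La elog_def using pos by simp
        qed
        then have "ereal (- (Q.rate u + \<eta>)) \<le> liminf L" by (rule Liminf_bounded)
        then show "- liminf L \<le> ereal (rate_fun t u) + ereal \<eta>" unfolding rate by (cases "liminf L") auto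
      qed
    qed
    then have "- (INF u\<in>interior A. ereal (rate_fun t u)) \<le> - (- liminf L)" by (simp only: ereal_minus_le_minus)
    then show ?thesis by simp
  qed
  show ?thesis using lower upper by (auto intro: Liminf_le_Limsup)
qed

end
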